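(* Let $L$ be a sectionally complemented modular $\aleph_0$-meet-continuous lattice. Then $\operatorname{Dim}L$ is a generalized cardinal algebra (GCA). Moreover, if $\langle a_n\mid n\in\omega\rangle$ is any increasing sequence of elements of $L$ and $a=\bigvee_{n\in\omega}a_n$, then $\Delta(a)=\bigvee_{n\in\omega}\Delta(a_n)$ in $\operatorname{Dim}L$.
   Context: A lattice is sectionally complemented if it has a least element $0$ and every interval $[0,a]$ is complemented. A lattice $L$ is $\aleph_0$-meet-continuous if for every $a\in L$ and every increasing sequence $\langle b_n\mid n\in\omega\rangle$ of elements of $L$, the supremum $\bigvee_nb_n$ exists and $a\wedge\bigvee_nb_n=\bigvee_n(a\wedge b_n)$. For a lattice $L$, the dimension monoid $\operatorname{Dim}L$ is the commutative monoid defined by generators $\Delta(a,b)$ (for $a\leq b$ in $L$) and the relations: (D0) $\Delta(a,a)=0$; (D1) $\Delta(a,c)=\Delta(a,b)+\Delta(b,c)$ for $a\leq b\leq c$; (D2) $\Delta(a,a\vee b)=\Delta(a\wedge b,b)$ for all $a,b\in L$. If $L$ has a least element $0$, write $\Delta(x)=\Delta(0,x)$. A generalized cardinal algebra (GCA) is a quadruple $\langle A,+,0,\sum\rangle$ where $0\in A$, $+$ is a partial binary operation on $A$, and $\sum$ is a partial function from $A^\omega$ to $A$ (written $\sum_na_n$), satisfying the following (an asserted equality includes the assertion that the terms are defined): (GCA1) if $a=\sum_na_n$, then $a=a_0+\sum_na_{n+1}$; (GCA2) if $c=\sum_n(a_n+b_n)$, then $c=\sum_na_n+\sum_nb_n$;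 (GCA3) $a+0=0+a=a$ for all $a\in A$; (GCA4) (refinement postulate) if $a+b=\sum_nc_n$, then there are $a_n,b_n\in A$ ($n\in\omega$) with $a=\sum_na_n$, $b=\sum_nb_n$ and $c_n=a_n+b_n$ for all $n$; (GCA5) (remainder postulate) if $a_n=b_n+a_{n+1}$ for all $n\in\omega$, then all sums $\sum_kb_{n+k}$ ($n\in\omega$) are defined and there is $a\in A$ with $a_n=a+\sum_kb_{n+k}$ for all $n$. A commutative monoid $\langle A,+,0\rangle$ is said to be a GCA if there is a partial function $\sum$ making $\langle A,+,0,\sum\rangle$ a GCA. In a GCA the algebraic preordering ($x\leq y$ iff $x+z=y$ for some $z$) is a partial ordering, and a defined $\sum_na_n$ is the supremum of its finite partial sums (so $\sum$ is determined by $+$); suprema in $\operatorname{Dim}L$ are taken with respect to the algebraic ordering. *)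

theory Defs
  imports "HOL-Library.Multiset" "HOL-Library.Interval" "HOL-Library.Lub_Glb"
begin

section \<open>Lattice-theoretic hypotheses\<close>

definition sectionally_complemented :: "'a::bounded_lattice_bot itself \<Rightarrow> bool" where
  "sectionally_complemented _ \<longleftrightarrow>
    (\<forall>a. \<forall>x\<in>{bot..a::'a}. \<exists>y\<in>{bot..a}. inf x y = bot \<and> sup x y = a)"

definition modular_lattice :: "'a::lattice itself \<Rightarrow> bool" where
  "modular_lattice _ \<longleftrightarrow>
    (\<forall>a b c::'a. a \<le> c \<longrightarrow> sup a (inf b c) = inf (sup a b) c)"

definition aleph0_meet_continuous :: "'a::lattice itself \<Rightarrow> bool" where
  "aleph0_meet_continuous _ \<longleftrightarrow>
    (\<forall>(a::'a) (b::nat \<Rightarrow> 'a). mono b \<longrightarrow>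
      (\<exists>s. isLub UNIV (range b) s \<and> isLub UNIV (range (\<lambda>n. inf a (b n))) (inf a s)))"


section \<open>The dimension monoid\<close>

text \<open>
  The free commutative monoid on the intervals is the type of finite multisets of intervals; the
  dimension monoid is its quotient by the least congruence that contains the defining relations.
\<close>

inductive dim_cong :: "'a::lattice interval multiset \<Rightarrow> 'a interval multiset \<Rightarrow> bool" where
  D0: "dim_cong {#Interval (a, a)#} {#}"
| D1: "a \<le> b \<Longrightarrow> b \<le> c \<Longrightarrow>
        dim_cong {#Interval (a, c)#} {#Interval (a, b), Interval (b, c)#}"
| D2: "dim_cong {#Interval (a, sup a b)#} {#Interval (inf a b, b)#}"
| refl: "dim_cong M M"
| sym: "dim_cong M N \<Longrightarrow> dim_cong N M"
| trans: "dim_cong M N \<Longrightarrow> dim_cong N P \<Longrightarrow> dim_cong M P"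
| add: "dim_cong M N \<Longrightarrow> dim_cong M' N' \<Longrightarrow> dim_cong (M + M') (N + N')"

lemma equivp_dim_cong: "equivp dim_cong"
  by (rule equivpI) (auto intro!: reflpI sympI transpI intro: dim_cong.intros)

quotient_type (overloaded) 'a dim = "'a::lattice interval multiset" / dim_cong
  by (rule equivp_dim_cong)

instantiation dim :: (lattice) comm_monoid_add
begin

lift_definition zero_dim :: "'a dim" is "{#}" .

lift_definition plus_dim :: "'a dim \<Rightarrow> 'a dim \<Rightarrow> 'a dim" is "(+)"
  by (rule dim_cong.add)

instance
  by standard (transfer; simp add: ac_simps dim_cong.refl)+

end

text \<open>\<open>\<Delta> a b\<close> is meaningful only if \<open>a \<le> b\<close>; otherwise \<open>Interval (a, b)\<close> is unspecified.\<close>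

lift_definition Delta :: "'a::lattice \<Rightarrow> 'a \<Rightarrow> 'a dim" (\<open>\<Delta>\<close>)
  is "\<lambda>a b. {#Interval (a, b)#}" .

abbreviation Delta_bot :: "'a::bounded_lattice_bot \<Rightarrow> 'a dim" (\<open>\<Delta>\<^sub>0\<close>) where
  "\<Delta>\<^sub>0 x \<equiv> \<Delta> bot x"

lemma Delta_D0: "\<Delta> a a = 0"
  by transfer (rule dim_cong.D0)

lemma Delta_D1: "a \<le> b \<Longrightarrow> b \<le> c \<Longrightarrow> \<Delta> a c = \<Delta> a b + \<Delta> b c"
  by transfer (simp, metis add_mset_commute dim_cong.D1)

lemma Delta_D2: "\<Delta> a (sup a b) = \<Delta> (inf a b) b"
  by transfer (rule dim_cong.D2)

lemma Delta_universal:
  fixes f :: "'a::lattice \<Rightarrow> 'a \<Rightarrow> 'm::comm_monoid_add"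
  assumes D0: "\<And>a. f a a = 0"
    and D1: "\<And>a b c. a \<le> b \<Longrightarrow> b \<le> c \<Longrightarrow> f a c = f a b + f b c"
    and D2: "\<And>a b. f a (sup a b) = f (inf a b) b"
  shows "\<exists>!h :: 'a dim \<Rightarrow> 'm.
    h 0 = 0 \<and> (\<forall>x y. h (x + y) = h x + h y) \<and> (\<forall>a b. a \<le> b \<longrightarrow> h (\<Delta> a b) = f a b)"
proof -
  define g where "g M = (\<Sum>i\<in>#M. f (lower i) (upper i))" for M :: "'a interval multiset"
  have bounds: "lower (Interval (a, b)) = a \<and> upper (Interval (a, b)) = b" if "a \<le> b" for a b :: 'a
    using that by (simp add: lower.rep_eq upper.rep_eq Interval_inverse)
  have resp: "dim_cong M N \<Longrightarrow> g M = g N" for M N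
    by (induction rule: dim_cong.induct)
      (auto simp: g_def bounds D0 D2 le_supI1 le_infI2 intro: D1 order_trans)
  show ?thesis
  proof (rule ex1I)
    define h where "h x = g (rep_dim x)" for x
    have h_abs: "h (abs_dim M) = g M" for M
      unfolding h_def by (rule resp) (meson Quotient_dim Quotient_rep_abs dim_cong.refl)
    have "h (x + y) = h x + h y" for x y
    proof -
      obtain M N where "x = abs_dim M" "y = abs_dim N"
        by (metis Quotient_abs_rep Quotient_dim)
      then show ?thesis
        by (simp add: plus_dim.abs_eq h_abs g_def)
    qed
    moreover have "h 0 = 0"
      by (simp add: zero_dim_def h_abs g_def)
    moreover have "h (\<Delta> a b) = f a b" if "a \<le> b" for a b
      using bounds[OF that] by (simp add: Delta.abs_eq h_abs g_def)
    ultimately show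
      "h 0 = 0 \<and> (\<forall>x y. h (x + y) = h x + h y) \<and> (\<forall>a b. a \<le> b \<longrightarrow> h (\<Delta> a b) = f a b)"
      by blast
    fix k :: "'a dim \<Rightarrow> 'm"
    assume k: "k 0 = 0 \<and> (\<forall>x y. k (x + y) = k x + k y) \<and> (\<forall>a b. a \<le> b \<longrightarrow> k (\<Delta> a b) = f a b)"
    have "k (abs_dim M) = g M" for M
    proof (induction M)
      case empty
      then show ?case using k by (simp add: zero_dim_def g_def)
    next
      case (add i M)
      have "i = Interval (lower i, upper i)"
        by (simp add: interval_eq_iff bounds)
      then have "abs_dim (add_mset i M) = \<Delta> (lower i) (upper i) + abs_dim M"
        by (simp add: Delta.abs_eq plus_dim.abs_eq)
      then show ?case
        using k add by (simp add: g_def)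
    qed
    then show "k = h"
      by (metis Quotient_abs_rep Quotient_dim h_abs ext)
  qed
qed

text \<open>The algebraic preordering, which need not be antisymmetric for an arbitrary lattice.\<close>

instantiation dim :: (lattice) preorder
begin

definition less_eq_dim :: "'a dim \<Rightarrow> 'a dim \<Rightarrow> bool" where
  "(x::'a dim) \<le> y \<longleftrightarrow> (\<exists>z. x + z = y)"

definition less_dim :: "'a dim \<Rightarrow> 'a dim \<Rightarrow> bool" where
  "(x::'a dim) < y \<longleftrightarrow> x \<le> y \<and> \<not> y \<le> x"

instance
proof
  fix x y z :: "'a dim"
  show "x < y \<longleftrightarrow> x \<le> y \<and> \<not> y \<le> x"
    by (rule less_dim_def)
  show "x \<le> x"
    unfolding less_eq_dim_def by (rule exI[of _ 0]) simp
  show "x \<le> y \<Longrightarrow> y \<le> z \<Longrightarrow> x \<le> z"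
    unfolding less_eq_dim_def by (metis add.assoc)
qed

end


section \<open>Generalized cardinal algebras\<close>

text \<open>
  The carrier is the whole type; the value \<^const>\<open>None\<close> of \<open>add\<close> and \<open>Sum\<close> stands for an undefined
  sum. Each equality is read as asserting that all terms in it are defined.
\<close>

locale generalized_cardinal_algebra =
  fixes add :: "'a \<Rightarrow> 'a \<Rightarrow> 'a option"
    and zero :: 'a
    and Sum :: "(nat \<Rightarrow> 'a) \<Rightarrow> 'a option"
  assumes GCA1:
    "\<And>a s. Sum a = Some s \<Longrightarrow>
      \<exists>t. Sum (\<lambda>n. a (Suc n)) = Some t \<and> add (a 0) t = Some s"
    and GCA2:
    "\<And>a b d c. (\<And>n. add (a n) (b n) = Some (d n)) \<Longrightarrow> Sum d = Some c \<Longrightarrow>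
      \<exists>s t. Sum a = Some s \<and> Sum b = Some t \<and> add s t = Some c"
    and GCA3:
    "\<And>a. add a zero = Some a \<and> add zero a = Some a"
    and GCA4:
    "\<And>a b c s. add a b = Some s \<Longrightarrow> Sum c = Some s \<Longrightarrow>
      \<exists>a' b'. Sum a' = Some a \<and> Sum b' = Some b \<and> (\<forall>n. add (a' n) (b' n) = Some (c n))"
    and GCA5:
    "\<And>a b. (\<And>n. add (b n) (a (Suc n)) = Some (a n)) \<Longrightarrow>
      \<exists>x s. \<forall>n. Sum (\<lambda>k. b (n + k)) = Some (s n) \<and> add x (s n) = Some (a n)"

definition monoid_is_gca :: "('a \<Rightarrow> 'a \<Rightarrow> 'a) \<Rightarrow> 'a \<Rightarrow> bool" where
  "monoid_is_gca add zero \<longleftrightarrow> comm_monoid add zero \<and>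
    (\<exists>Sum. generalized_cardinal_algebra (\<lambda>x y. Some (add x y)) zero Sum)"

end

theory Submission
  imports Defs "HOL-Library.Set_Algebras" "HOL-Library.Product_Plus"
begin

text \<open>
  The main point is that the dimension is countably additive: if \<open>(x n)\<close> and \<open>(y n)\<close> are independent
  sequences with \<open>\<Delta>(x n) = \<Delta>(y n)\<close>, then their joins have the same dimension. If the joins are
  disjoint, this holds because \<open>x n\<close> and \<open>y n\<close> are then perspective (normality of \<open>L\<close>) and the axes
  can be joined. In general one splits off the matched pieces outside the meet of the two joins and
  iterates; the remainders of the two sides coincide.

  Normality says that disjoint elements joined by a chain of perspectivities are perspective.
  Perspectivities compose if there is room for a third copy of the elements, and an exhaustion by
  elements with room reduces the problem to a quotient in which the composition is trivial.

  Together with the refinement property of \<open>Dim L\<close>, countable additivity shows that sums in \<open>Dim L\<close> can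
  be computed termwise in \<open>L\<close>, which gives the axioms. The statement on suprema then follows from
  the cancellation law for generalized cardinal algebras.
\<close>

section \<open>Perspectivity in modular lattices\<close>

text \<open>An equation in \<open>Dim L\<close> unfolds to a finite decomposition whose pieces are
  joined by chains of perspectivities. For a sequence of equations neither the number of pieces nor
  the lengths of the chains need be bounded, so such data cannot be joined over \<open>n\<close>. A
  single perspectivity can be, because its axis can be chosen below the join of the two elements.
  This is what normality is for, and why disjointness accompanies every statement about sums of
  perspectivities.

  Meet continuity speaks of increasing sequences. Where a decreasing sequence \<open>d n\<close>
  would call for an infimum, the proof takes a complement, inside \<open>d 0\<close>, of the join of
  the successive differences. It is determined only up to perspectivity, but its dimension is well
  defined.

  An element of \<open>Dim L\<close> can absorb another one, so equal summands must not be
  subtracted. The comparison of two sides therefore exchanges summands, and the cancellation law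
  carries absorbed error terms.\<close>

definition dsum :: "'a::bounded_lattice_bot \<Rightarrow> 'a \<Rightarrow> 'a \<Rightarrow> bool" where
  "dsum x y z \<longleftrightarrow> inf x y = bot \<and> sup x y = z"

text \<open>The axis \<open>k\<close> is not confined to \<open>sup x y\<close>, so that axes found
  in larger intervals can be used as they are; \<open>persp_axis\<close> cuts them down.\<close>

definition persp :: "'a::bounded_lattice_bot \<Rightarrow> 'a \<Rightarrow> bool" where
  "persp x y \<longleftrightarrow> (\<exists>k. inf x k = bot \<and> inf y k = bot \<and> sup x k = sup y k)"

text \<open>Both maps are total on the type, but only their values on the two lower intervals
  matter. The inverse is carried along so that composites and restrictions can be written down
  explicitly.\<close>

definition interval_iso ::
    "'a::bounded_lattice_bot \<Rightarrow> 'a \<Rightarrow> ('a \<Rightarrow> 'a) \<Rightarrow> ('a \<Rightarrow> 'a) \<Rightarrow> bool" where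
  "interval_iso x y f g \<longleftrightarrow>
    (\<forall>u\<le>x. f u \<le> y \<and> g (f u) = u) \<and> (\<forall>v\<le>y. g v \<le> x \<and> f (g v) = v) \<and>
    (\<forall>u v. u \<le> v \<and> v \<le> x \<longrightarrow> f u \<le> f v) \<and> (\<forall>u v. u \<le> v \<and> v \<le> y \<longrightarrow> g u \<le> g v)"

definition persp_iso ::
    "'a::bounded_lattice_bot \<Rightarrow> 'a \<Rightarrow> ('a \<Rightarrow> 'a) \<Rightarrow> ('a \<Rightarrow> 'a) \<Rightarrow> bool" where
  "persp_iso x y f g \<longleftrightarrow> interval_iso x y f g \<and> (\<forall>u\<le>x. persp u (f u))"

lemma dsum_inf: "dsum x y z \<Longrightarrow> inf x y = bot"
  and dsum_sup: "dsum x y z \<Longrightarrow> sup x y = z"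
  and dsum_le1: "dsum x y z \<Longrightarrow> x \<le> z"
  and dsum_le2: "dsum x y z \<Longrightarrow> y \<le> z"
  by (auto simp: dsum_def)

lemma dsum_commute: "dsum x y z \<Longrightarrow> dsum y x z"
  by (simp add: dsum_def inf_commute sup_commute)

lemma dsum_bot_left [simp]: "dsum bot y z \<longleftrightarrow> y = z"
  and dsum_bot_right [simp]: "dsum y bot z \<longleftrightarrow> y = z"
  by (auto simp: dsum_def)

lemma disj_mono:
  fixes x :: "'a::bounded_lattice_bot"
  assumes "inf x y = bot" "x' \<le> x" "y' \<le> y"
  shows "inf x' y' = bot"
  using assms by (metis bot.extremum_uniqueI inf_mono)

text \<open>Below \<open>s\<close> the element \<open>m\<close> looks like \<open>p\<close>. This
  reduces disjointness from a large join to disjointness inside a smaller interval.\<close>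

lemma disj_via:
  fixes a :: "'a::bounded_lattice_bot"
  assumes "inf a p = bot" "inf m s = p" "a \<le> s"
  shows "inf a m = bot"
proof -
  have "inf a m \<le> inf a p" using assms(2,3) by (simp add: le_infI1 inf.coboundedI1 flip: assms(2))
  then show ?thesis using assms(1) by (simp add: bot.extremum_uniqueI)
qed

lemma persp_refl [simp]: "persp x x"
  unfolding persp_def by (rule exI[of _ bot]) simp

lemma persp_sym: "persp x y \<Longrightarrow> persp y x"
  unfolding persp_def by metis

lemma persp_bot [simp]: "persp bot y \<longleftrightarrow> y = bot" "persp y bot \<longleftrightarrow> y = bot"
  unfolding persp_def by (metis inf_bot_left inf_sup_absorb sup_bot_left sup_commute)+

lemma persp_common_compl: "dsum x k z \<Longrightarrow> dsum y k z \<Longrightarrow> persp x y"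
  unfolding persp_def dsum_def by metis

section \<open>Isomorphisms between lower intervals\<close>

lemma interval_iso_sym: "interval_iso x y f g \<Longrightarrow> interval_iso y x g f"
  unfolding interval_iso_def by blast

lemma interval_isoD:
  assumes "interval_iso x y f g"
  shows "\<And>u. u \<le> x \<Longrightarrow> f u \<le> y" "\<And>u. u \<le> x \<Longrightarrow> g (f u) = u"
    "\<And>v. v \<le> y \<Longrightarrow> g v \<le> x" "\<And>v. v \<le> y \<Longrightarrow> f (g v) = v"
    "\<And>u v. u \<le> v \<Longrightarrow> v \<le> x \<Longrightarrow> f u \<le> f v" "\<And>u v. u \<le> v \<Longrightarrow> v \<le> y \<Longrightarrow> g u \<le> g v"
  using assms unfolding interval_iso_def by blast+

lemma interval_iso_trans:
  assumes "interval_iso x y f g" "interval_iso y z f' g'"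
  shows "interval_iso x z (f' \<circ> f) (g \<circ> g')"
  using interval_isoD[OF assms(1)] interval_isoD[OF assms(2)]
  unfolding interval_iso_def by auto

lemma interval_iso_restrict:
  assumes "interval_iso x y f g" "x' \<le> x"
  shows "interval_iso x' (f x') f g"
  unfolding interval_iso_def
proof (intro conjI allI impI)
  note D = interval_isoD[OF assms(1)]
  fix u v
  show "f u \<le> f x'" "g (f u) = u" if "u \<le> x'"
    using that D(2,5) assms(2) order_trans by blast+
  show "g v \<le> x'" "f (g v) = v" if "v \<le> f x'"
    using that D(1,2,4,6) assms(2) order_trans by metis+
  show "f u \<le> f v" if "u \<le> v \<and> v \<le> x'"
    using that D(5) assms(2) order_trans by blast
  show "g u \<le> g v" if "u \<le> v \<and> v \<le> f x'"
    using that D(1,6) assms(2) order_trans by meson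
qed

context
  fixes x y :: "'a::bounded_lattice_bot" and f g
  assumes iso: "interval_iso x y f g"
begin

lemma interval_iso_top: "f x = y"
  using interval_isoD[OF iso] by (metis order.antisym order_refl)

lemma interval_iso_bot: "f bot = bot"
  using interval_isoD[OF iso] by (metis bot.extremum bot.extremum_uniqueI)

lemma interval_iso_sup:
  assumes "u \<le> x" "v \<le> x"
  shows "f (sup u v) = sup (f u) (f v)"
proof (rule order.antisym)
  note D = interval_isoD[OF iso]
  have "sup (f u) (f v) \<le> y" using D(1) assms by simp
  moreover have "u \<le> g (sup (f u) (f v))" "v \<le> g (sup (f u) (f v))"
    using D assms calculation by (metis sup.cobounded1, metis sup.cobounded2)
  ultimately show "f (sup u v) \<le> sup (f u) (f v)"
    using D by (metis le_sup_iff)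
  show "sup (f u) (f v) \<le> f (sup u v)"
    using D(5) assms by simp
qed

lemma interval_iso_inf:
  assumes "u \<le> x" "v \<le> x"
  shows "f (inf u v) = inf (f u) (f v)"
proof (rule order.antisym)
  note D = interval_isoD[OF iso]
  have "inf (f u) (f v) \<le> y" using D(1) assms by (simp add: le_infI1)
  moreover have "g (inf (f u) (f v)) \<le> u" "g (inf (f u) (f v)) \<le> v"
    using D assms by (metis inf.cobounded1, metis inf.cobounded2)
  ultimately show "inf (f u) (f v) \<le> f (inf u v)"
    using D by (metis assms(1) le_infI1 le_inf_iff)
  show "f (inf u v) \<le> inf (f u) (f v)"
    using D(5) assms by simp
qed

lemma interval_iso_disj: "u \<le> x \<Longrightarrow> v \<le> x \<Longrightarrow> inf (f u) (f v) = bot \<longleftrightarrow> inf u v = bot"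
  using interval_iso_inf interval_iso_bot interval_isoD(2)[OF iso]
  by (metis bot.extremum le_infI1)

lemma interval_iso_dsum:
  assumes "dsum u v w" "w \<le> x"
  shows "dsum (f u) (f v) (f w)"
  using assms interval_iso_sup[of u v] interval_iso_disj[of u v]
  unfolding dsum_def by (metis le_sup_iff)

end

lemma persp_isoD:
  assumes "persp_iso x y f g"
  shows "interval_iso x y f g" "\<And>u. u \<le> x \<Longrightarrow> persp u (f u)"
  using assms unfolding persp_iso_def by auto

section \<open>Independence and direct sums under the modular law\<close>

locale scm_lattice =
  fixes T :: "'a::bounded_lattice_bot itself"
  assumes sectionally: "sectionally_complemented T"
    and modular: "modular_lattice T"
begin

lemma modl: "(a::'a) \<le> c \<Longrightarrow> sup a (inf b c) = inf (sup a b) c"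
  using modular unfolding modular_lattice_def by blast

lemma modl_disj: "(a::'a) \<le> c \<Longrightarrow> inf b c = bot \<Longrightarrow> inf (sup a b) c = a"
  using modl[of a c b] by simp

lemma dsum_ex:
  assumes "(x::'a) \<le> z" obtains y where "dsum x y z"
proof -
  have "x \<in> {bot..z}" using assms by simp
  then show ?thesis
    using sectionally that unfolding sectionally_complemented_def dsum_def by blast
qed

lemma relcompl_ex:
  assumes "(a::'a) \<le> t" "t \<le> b" obtains s where "inf t s = a" "sup t s = b" "a \<le> s" "s \<le> b"
proof -
  obtain u where u: "dsum t u b" using dsum_ex[OF assms(2)] by blast
  have "inf t (sup a u) = a"
    using modl_disj[of a t u] assms u by (simp add: dsum_def inf_commute)
  moreover have "sup t (sup a u) = b"
    using assms u by (metis dsum_def sup.assoc sup.absorb1)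
  ultimately show ?thesis using that[of "sup a u"] by (metis inf_le2 sup_ge2)
qed

text \<open>Independence of three elements does not depend on the bracketing: cut by
  \<open>sup x y\<close>, the join \<open>sup y z\<close> shrinks to \<open>y\<close>.\<close>

lemma disj_sup_left:
  assumes "inf (x::'a) y = bot" "inf (sup x y) z = bot"
  shows "inf x (sup y z) = bot"
proof -
  have "inf (sup y z) (sup x y) = y"
    using modl_disj[of y "sup x y" z] assms(2) by (simp add: inf_commute)
  then have "inf x (sup y z) \<le> inf x y"
    by (smt (verit) inf.absorb_iff2 inf.assoc inf.commute inf.left_commute inf_sup_absorb order_refl)
  then show ?thesis using assms(1) by (simp add: bot.extremum_uniqueI)
qed

lemma disj_sup_right:
  assumes "inf (y::'a) z = bot" "inf x (sup y z) = bot"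
  shows "inf (sup x y) z = bot"
  using disj_sup_left[of z y x] assms by (metis inf_commute sup_commute)

lemma dsum_assoc:
  assumes "dsum (x::'a) y u" "dsum u z w"
  shows "dsum y z (sup y z)" "dsum x (sup y z) w"
proof -
  show "dsum y z (sup y z)"
    using assms disj_mono[of u z y z] by (auto simp: dsum_def)
  show "dsum x (sup y z) w"
    using assms disj_sup_left[of x y z] unfolding dsum_def by (metis sup.assoc)
qed

lemma disj_interchange:
  assumes "dsum (a::'a) b u" "dsum c d v" "inf u v = bot"
  shows "inf (sup a c) (sup b d) = bot"
proof -
  have ab: "inf a b = bot" "sup a b = u" and cd: "inf c d = bot" "sup c d = v"
    using assms by (auto simp: dsum_def)
  have "inf u (sup c d) = bot" using assms cd by simp
  then have 1: "inf (sup u c) d = bot" using disj_sup_right[of c d u] cd by simp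
  have "inf u c = bot" using assms(3) cd disj_mono[of u v u c] by auto
  then have "inf (sup c a) b = bot"
    using disj_sup_right[of a b c] ab by (simp add: inf_commute)
  moreover have "inf (sup (sup c a) b) d = bot"
    using 1 ab by (metis sup.assoc sup.commute)
  ultimately have "inf (sup c a) (sup b d) = bot"
    by (rule disj_sup_left)
  then show ?thesis by (simp add: sup_commute)
qed

lemma dsum_interchange:
  assumes "dsum (a::'a) b u" "dsum c d v" "dsum u v w"
  shows "dsum (sup a c) (sup b d) w" "dsum a c (sup a c)" "dsum b d (sup b d)"
proof -
  have "sup (sup a c) (sup b d) = w"
    using assms unfolding dsum_def by (metis sup.assoc sup.left_commute)
  then show "dsum (sup a c) (sup b d) w"
    using disj_interchange[OF assms(1,2)] assms(3) by (simp add: dsum_def)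
  show "dsum a c (sup a c)" "dsum b d (sup b d)"
    using assms disj_mono[of u v] by (auto simp: dsum_def)
qed

section \<open>Perspectivities and their axes\<close>

lemma persp_axis:
  assumes "persp (x::'a) y"
  obtains k where "inf x k = bot" "inf y k = bot" "sup x k = sup x y" "sup y k = sup x y"
proof -
  obtain k where k: "inf x k = bot" "inf y k = bot" "sup x k = sup y k"
    using assms by (auto simp: persp_def)
  define k' where "k' = inf k (sup x y)"
  have "sup x k' = inf (sup x k) (sup x y)" "sup y k' = inf (sup y k) (sup x y)"
    unfolding k'_def by (simp_all add: modl)
  moreover have "sup x y \<le> sup x k" "sup x y \<le> sup y k"
    using k(3) by (metis le_supI sup.cobounded1)+
  ultimately have "sup x k' = sup x y" "sup y k' = sup x y"
    by (simp_all add: inf_absorb2)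
  moreover have "inf x k' = bot" "inf y k' = bot"
    using k disj_mono[of _ k] k'_def by auto
  ultimately show ?thesis using that by blast
qed

text \<open>The spans \<open>sup a b\<close> and \<open>sup b c\<close> overlap exactly in
  \<open>b\<close>, and axes chosen inside them avoid \<open>b\<close>. Hence the join
  \<open>m\<close> of the two axes meets each span only in the axis belonging to it, and it serves
  as an axis for \<open>a\<close> and \<open>c\<close>.\<close>

lemma persp_trans_disj:
  assumes "persp (a::'a) b" "persp b c" "inf a (sup b c) = bot"
  shows "persp a c"
proof -
  obtain p where p: "inf a p = bot" "inf b p = bot" "sup a p = sup a b" "sup b p = sup a b"
    using persp_axis[OF assms(1)] .
  obtain k where k: "inf b k = bot" "inf c k = bot" "sup b k = sup b c" "sup c k = sup b c"
    using persp_axis[OF assms(2)] .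
  have pab: "p \<le> sup a b" and kbc: "k \<le> sup b c"
    using p k by (metis sup.cobounded2)+
  have meet: "inf (sup a b) (sup b c) = b"
    using modl_disj[of b "sup b c" a] assms(3) by (simp add: sup_commute)
  have 1: "inf (sup p k) (sup a b) = p"
    using disj_via[of k b "sup a b" "sup b c"] meet kbc k
    by (intro modl_disj[OF pab]) (simp add: inf_commute)
  have 2: "inf (sup k p) (sup b c) = k"
    using disj_via[of p b "sup b c" "sup a b"] meet pab p
    by (intro modl_disj[OF kbc]) (simp add: inf_commute)
  define m where "m = sup p k"
  have am: "inf a m = bot"
    unfolding m_def by (rule disj_via[OF p(1) 1]) simp
  have cm: "inf c m = bot"
    unfolding m_def sup_commute[of p k] by (rule disj_via[OF k(2) 2]) simp
  have "sup a m = sup (sup a p) k" unfolding m_def by (simp add: sup_assoc)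
  also have "\<dots> = sup a (sup b k)" by (simp only: p(3) sup_assoc)
  finally have "sup a m = sup a (sup b c)" by (simp only: k(3))
  have "sup c m = sup (sup c k) p" unfolding m_def by (simp only: ac_simps)
  then have "sup c m = sup c (sup b p)" by (simp only: k(4) ac_simps)
  then have "sup c m = sup a (sup b c)" by (simp only: p(4) ac_simps)
  with \<open>sup a m = sup a (sup b c)\<close>
  show ?thesis using am cm unfolding persp_def by auto
qed

lemma persp_trans_disj':
  assumes "persp (a::'a) b" "persp b c" "inf c (sup a b) = bot"
  shows "persp a c"
  using persp_trans_disj[of c b a] assms by (simp add: persp_sym sup_commute)

text \<open>Projection along the axis. Since \<open>sup (inf (sup u k) y) k = sup u k\<close>,
  projecting back recovers \<open>u\<close>, and the same \<open>k\<close> is an axis for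
  \<open>u\<close> and its image.\<close>

lemma persp_iso_axis:
  assumes k: "inf (x::'a) k = bot" "inf y k = bot" "sup x k = sup y k"
  shows "persp_iso x y (\<lambda>u. inf (sup u k) y) (\<lambda>v. inf (sup v k) x)"
proof -
  have A: "sup (inf (sup u k) y) k = sup u k" if "sup x k = sup y k" "u \<le> x" for u x y
  proof -
    have "sup k (inf y (sup u k)) = inf (sup k y) (sup u k)" by (rule modl) simp
    also have "\<dots> = sup u k" using that by (metis inf.absorb2 sup.commute sup_mono order_refl)
    finally show ?thesis by (simp add: ac_simps)
  qed
  have B: "inf (sup (inf (sup u k) y) k) x = u" if "sup x k = sup y k" "u \<le> x" "inf x k = bot" for u x y
    using A[OF that(1,2)] modl_disj[of u x k] that by (simp add: inf_commute)
  have C: "persp u (inf (sup u k) y)" if "u \<le> x" for u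
    unfolding persp_def
    using A[OF k(3) that] k that disj_mono[of x k u k] disj_mono[of y k "inf (sup u k) y" k]
    by (intro exI[of _ k]) simp
  have E: "inf (sup u k) w \<le> inf (sup v k) w" if "u \<le> v" for u v w
    using that by (intro inf_mono sup_mono) auto
  show ?thesis
    unfolding persp_iso_def interval_iso_def
    using B[OF k(3) _ k(1)] B[OF k(3)[symmetric] _ k(2)] C E
    by (simp del: le_inf_iff)
qed

lemma persp_iso_ex:
  assumes "persp (x::'a) y" obtains f g where "persp_iso x y f g"
  using assms persp_iso_axis unfolding persp_def by blast

lemma persp_split:
  assumes "persp (x::'a) y" "dsum x1 x2 x"
  obtains y1 y2 where "dsum y1 y2 y" "persp x1 y1" "persp x2 y2"
proof -
  obtain f g where fg: "persp_iso x y f g" using persp_iso_ex[OF assms(1)] .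
  have "dsum (f x1) (f x2) y"
    using interval_iso_dsum[OF persp_isoD(1)[OF fg] assms(2)]
      interval_iso_top[OF persp_isoD(1)[OF fg]] by simp
  then show ?thesis
    using that persp_isoD(2)[OF fg] assms(2) dsum_le1 dsum_le2 by blast
qed

lemma persp_part:
  assumes "persp (x::'a) y" "x' \<le> x"
  obtains y' where "y' \<le> y" "persp x' y'"
  using assms by (metis dsum_ex dsum_le1 persp_split)

text \<open>Disjointness of \<open>x\<close> and \<open>y\<close> makes the spans
  \<open>sup x1 y1\<close> and \<open>sup x2 y2\<close> independent, so that axes chosen inside them
  can be joined.\<close>

lemma persp_dsum:
  assumes "persp (x1::'a) y1" "persp x2 y2" "dsum x1 x2 x" "dsum y1 y2 y" "inf x y = bot"
  shows "persp x y"
proof -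
  obtain k where k: "inf x1 k = bot" "inf y1 k = bot" "sup x1 k = sup x1 y1" "sup y1 k = sup x1 y1"
    using persp_axis[OF assms(1)] .
  obtain l where l: "inf x2 l = bot" "inf y2 l = bot" "sup x2 l = sup x2 y2" "sup y2 l = sup x2 y2"
    using persp_axis[OF assms(2)] .
  have dj: "inf (sup x1 y1) (sup x2 y2) = bot"
    using disj_interchange[OF assms(3,4,5)] .
  have X: "dsum x1 k (sup x1 y1)" "dsum x2 l (sup x2 y2)"
    and Y: "dsum y1 k (sup x1 y1)" "dsum y2 l (sup x2 y2)"
    using k l by (auto simp: dsum_def)
  have D: "dsum (sup x1 y1) (sup x2 y2) (sup (sup x1 y1) (sup x2 y2))"
    using dj by (simp add: dsum_def)
  have "dsum x (sup k l) (sup (sup x1 y1) (sup x2 y2))"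
    using dsum_interchange(1)[OF X D] assms(3) by (simp add: dsum_def)
  moreover have "dsum y (sup k l) (sup (sup x1 y1) (sup x2 y2))"
    using dsum_interchange(1)[OF Y D] assms(4) by (simp add: dsum_def)
  ultimately show ?thesis by (rule persp_common_compl)
qed

lemma persp_compl_mod:
  assumes "dsum (a::'a) x z" "dsum a y z" shows "persp x y"
  using assms persp_common_compl dsum_commute by blast

text \<open>The part of \<open>y\<close> outside \<open>s\<close> is projected into \<open>x\<close>
  along \<open>s\<close>. In this way a part of a direct sum is described, up to perspectivity, by
  parts of the summands.\<close>

lemma persp_project:
  assumes "dsum s x (t::'a)" "y \<le> t" "dsum (inf y s) y' y"
  obtains x' where "x' \<le> x" "persp y' x'"
proof -
  have "y' \<le> y" using assms(3) by (rule dsum_le2)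
  have "inf y' s = inf y' (inf y s)"
    using \<open>y' \<le> y\<close> by (simp add: inf.absorb1 inf_assoc[symmetric])
  then have ys: "inf y' s = bot" using assms(3) by (simp add: dsum_def inf_commute)
  define x' where "x' = inf x (sup s y')"
  have "sup s x' = inf (sup s x) (sup s y')" unfolding x'_def by (rule modl) simp
  also have "\<dots> = sup s y'"
    using assms(1,2) \<open>y' \<le> y\<close> by (metis dsum_def dsum_le1 inf.absorb2 le_sup_iff order_trans)
  finally have "sup x' s = sup y' s" by (simp add: sup_commute)
  moreover have "inf x' s = bot"
    unfolding x'_def using assms(1) disj_mono[of x s "inf x (sup s y')" s]
    by (simp add: dsum_def inf_commute)
  ultimately have "persp y' x'" using ys unfolding persp_def by metis
  then show ?thesis using that[of x'] x'_def by simp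
qed

end

section \<open>Countable direct sums\<close>

text \<open>Meaningful only when a least upper bound exists, as it does for increasing sequences
  under meet continuity.\<close>

definition lim :: "(nat \<Rightarrow> 'a::lattice) \<Rightarrow> 'a" where
  "lim b = (THE s. isLub UNIV (range b) s)"

primrec partial_join :: "(nat \<Rightarrow> 'a::bounded_lattice_bot) \<Rightarrow> nat \<Rightarrow> 'a" where
  "partial_join x 0 = bot"
| "partial_join x (Suc n) = sup (partial_join x n) (x n)"

definition independent :: "(nat \<Rightarrow> 'a::bounded_lattice_bot) \<Rightarrow> bool" where
  "independent x \<longleftrightarrow> (\<forall>n. inf (partial_join x n) (x n) = bot)"

definition osum :: "(nat \<Rightarrow> 'a::bounded_lattice_bot) \<Rightarrow> 'a" where
  "osum x = lim (partial_join x)"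

lemma mono_partial_join: "mono (partial_join x)"
  by (rule monoI, rule lift_Suc_mono_le) simp_all

lemma partial_join_mono: "(\<And>n. x n \<le> y n) \<Longrightarrow> partial_join x n \<le> partial_join y n"
  by (induction n) (auto intro: le_supI1 le_supI2)

lemma partial_join_le: "(\<And>n. x n \<le> z) \<Longrightarrow> partial_join x n \<le> z"
  by (induction n) auto

lemma partial_join_sup:
  "partial_join (\<lambda>n. sup (x n) (y n)) n = sup (partial_join x n) (partial_join y n)"
  by (induction n) (simp_all add: ac_simps)

lemma partial_join_shift: "partial_join x (Suc n) = sup (x 0) (partial_join (\<lambda>n. x (Suc n)) n)"
  by (induction n) (simp_all add: ac_simps)

lemma independent_mono: "independent y \<Longrightarrow> (\<And>n. x n \<le> y n) \<Longrightarrow> independent x"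
  unfolding independent_def using partial_join_mono disj_mono by metis

lemma independent_dsum:
  "independent x \<Longrightarrow> dsum (partial_join x n) (x n) (partial_join x (Suc n))"
  by (simp add: independent_def dsum_def)

lemma isLub_unique:
  fixes s :: "'a::order"
  shows "isLub UNIV S s \<Longrightarrow> isLub UNIV S t \<Longrightarrow> s = t"
  unfolding isLub_def leastP_def setge_def by (auto intro: order.antisym)

lemma isLub_UNIV_iff:
  "isLub UNIV (range b) s \<longleftrightarrow> (\<forall>n. b n \<le> s) \<and> (\<forall>z. (\<forall>n. b n \<le> z) \<longrightarrow> s \<le> z)"
  unfolding isLub_def leastP_def isUb_def setge_def setle_def by auto

locale mc_lattice = scm_lattice T for T :: "'a::bounded_lattice_bot itself" +
  assumes meet_continuous: "aleph0_meet_continuous T"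
begin

section \<open>Limits of increasing sequences\<close>

lemma isLub_lim:
  assumes "mono (b :: nat \<Rightarrow> 'a)" shows "isLub UNIV (range b) (lim b)"
proof -
  obtain s where "isLub UNIV (range b) s"
    using meet_continuous assms unfolding aleph0_meet_continuous_def by blast
  then show ?thesis
    unfolding lim_def by (rule theI) (rule isLub_unique[OF _ \<open>isLub UNIV (range b) s\<close>])
qed

lemma lim_upper: "mono b \<Longrightarrow> (b n :: 'a) \<le> lim b"
  and lim_least: "mono b \<Longrightarrow> (\<And>n. b n \<le> z) \<Longrightarrow> lim b \<le> (z::'a)"
  using isLub_lim[of b] unfolding isLub_UNIV_iff by auto

lemma lim_eqI:
  "mono b \<Longrightarrow> (\<And>n. b n \<le> s) \<Longrightarrow> (\<And>z. (\<And>n. b n \<le> z) \<Longrightarrow> s \<le> z) \<Longrightarrow> lim b = (s::'a)"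
  by (meson lim_least lim_upper order.antisym)

lemma isLub_eq_lim: "mono b \<Longrightarrow> isLub UNIV (range b) (s::'a) \<Longrightarrow> s = lim b"
  using isLub_lim isLub_unique by blast

lemma inf_lim:
  assumes "mono (b :: nat \<Rightarrow> 'a)"
  shows "inf a (lim b) = lim (\<lambda>n. inf a (b n))"
proof -
  obtain s where s: "isLub UNIV (range b) s" "isLub UNIV (range (\<lambda>n. inf a (b n))) (inf a s)"
    using meet_continuous assms unfolding aleph0_meet_continuous_def by blast
  have "mono (\<lambda>n. inf a (b n))"
    using assms by (auto simp: mono_def intro: le_infI2)
  then show ?thesis
    using isLub_eq_lim s assms by metis
qed

lemma inf_lim_le:
  assumes "mono (b :: nat \<Rightarrow> 'a)" "\<And>n. inf a (b n) \<le> z"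
  shows "inf a (lim b) \<le> z"
  unfolding inf_lim[OF assms(1)]
  using assms by (intro lim_least) (auto simp: mono_def intro: le_infI2)

lemma disj_lim:
  assumes "mono (b :: nat \<Rightarrow> 'a)" "\<And>n. inf a (b n) = bot"
  shows "inf a (lim b) = bot"
  using inf_lim_le[OF assms(1), of a bot] assms(2) by (simp add: bot.extremum_uniqueI)

text \<open>Terms with different indices \<open>m\<close> and \<open>n\<close> are compared at
  \<open>max m n\<close>; meet continuity is then applied in each argument separately.\<close>

lemma disj_lim2:
  assumes "mono (a :: nat \<Rightarrow> 'a)" "mono b" "\<And>n. inf (a n) (b n) = bot"
  shows "inf (lim a) (lim b) = bot"
proof (rule disj_lim[OF assms(2)])
  fix n
  have "inf (b n) (a m) = bot" for m
    using disj_mono[OF assms(3)[of "max m n"]] assms(1,2)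
    by (simp add: inf_commute monoD)
  then show "inf (lim a) (b n) = bot"
    using disj_lim[OF assms(1), of "b n"] by (simp add: inf_commute)
qed

lemma sup_lim:
  assumes "mono (a :: nat \<Rightarrow> 'a)" "mono b"
  shows "lim (\<lambda>n. sup (a n) (b n)) = sup (lim a) (lim b)"
proof (rule lim_eqI)
  show "mono (\<lambda>n. sup (a n) (b n))"
    using assms by (auto simp: mono_def intro: le_supI1 le_supI2)
  show "sup (a n) (b n) \<le> sup (lim a) (lim b)" for n
    using assms lim_upper by (simp add: le_supI1 le_supI2)
  show "sup (lim a) (lim b) \<le> z" if "\<And>n. sup (a n) (b n) \<le> z" for z
    using assms that by (simp add: lim_least)
qed

lemma lim_const [simp]: "lim (\<lambda>n. s) = (s::'a)"
  by (rule lim_eqI) (auto simp: mono_def)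

lemma lim_Suc:
  assumes "mono (a :: nat \<Rightarrow> 'a)" shows "lim (\<lambda>n. a (Suc n)) = lim a"
proof (rule lim_eqI)
  show "mono (\<lambda>n. a (Suc n))" using assms by (simp add: mono_def)
  show "a (Suc n) \<le> lim a" for n using assms by (rule lim_upper)
  show "lim a \<le> z" if "\<And>n. a (Suc n) \<le> z" for z
  proof (rule lim_least[OF assms])
    fix n
    have "a n \<le> a (Suc n)" using assms by (simp add: monoD)
    then show "a n \<le> z" using that order_trans by blast
  qed
qed

section \<open>Joins of independent sequences\<close>

lemma partial_join_le_osum: "partial_join x n \<le> (osum x :: 'a)"
  unfolding osum_def by (rule lim_upper[OF mono_partial_join])

lemma le_osum: "x n \<le> (osum x :: 'a)"
  using partial_join_le_osum[of x "Suc n"] by simp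

lemma osum_least: "(\<And>n. x n \<le> z) \<Longrightarrow> osum x \<le> (z::'a)"
  unfolding osum_def by (intro lim_least mono_partial_join partial_join_le)

lemma osum_eqI: "(\<And>n. x n \<le> s) \<Longrightarrow> (\<And>z. (\<And>n. x n \<le> z) \<Longrightarrow> s \<le> z) \<Longrightarrow> osum x = (s::'a)"
  by (meson le_osum order.antisym osum_least)

lemma osum_mono: "(\<And>n. x n \<le> y n) \<Longrightarrow> osum x \<le> (osum y :: 'a)"
  by (meson le_osum order_trans osum_least)

lemma osum_sup: "osum (\<lambda>n. sup (x n) (y n)) = sup (osum x) (osum y :: 'a)"
  unfolding osum_def partial_join_sup by (rule sup_lim[OF mono_partial_join mono_partial_join])

lemma osum_bot [simp]: "osum (\<lambda>n. bot) = (bot::'a)"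
  by (rule osum_eqI) simp_all

lemma independent_bot [simp]: "independent (\<lambda>n. (bot::'a))"
  by (simp add: independent_def)

lemma osum_shift:
  assumes "independent (x :: nat \<Rightarrow> 'a)"
  shows "independent (\<lambda>n. x (Suc n))" "dsum (x 0) (osum (\<lambda>n. x (Suc n))) (osum x)"
proof -
  have le: "partial_join (\<lambda>n. x (Suc n)) n \<le> partial_join x (Suc n)" for n
    unfolding partial_join_shift by simp
  show ind: "independent (\<lambda>n. x (Suc n))"
    using assms le disj_mono order_refl unfolding independent_def by metis
  have 1: "inf (x 0) (partial_join (\<lambda>n. x (Suc n)) n) = bot" for n
  proof (induction n)
    case (Suc n)
    then show ?case
      using assms partial_join_shift[of x n] unfolding independent_def partial_join.simps(2)[of "\<lambda>n. x (Suc n)"]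
      by (metis disj_sup_left)
  qed simp
  have "osum x = lim (\<lambda>n. partial_join x (Suc n))"
    unfolding osum_def using lim_Suc[OF mono_partial_join] by simp
  also have "\<dots> = sup (x 0) (osum (\<lambda>n. x (Suc n)))"
    unfolding osum_def partial_join_shift
    using sup_lim[of "\<lambda>n. x 0", OF _ mono_partial_join] by (simp add: mono_def)
  finally show "dsum (x 0) (osum (\<lambda>n. x (Suc n))) (osum x)"
    using 1 disj_lim[OF mono_partial_join] unfolding osum_def dsum_def by metis
qed

lemma osum_drop:
  assumes "independent (x :: nat \<Rightarrow> 'a)"
  shows "independent (\<lambda>n. x (m + n))" "dsum (partial_join x m) (osum (\<lambda>n. x (m + n))) (osum x)"
proof -
  have "independent (\<lambda>n. x (m + n)) \<and> dsum (partial_join x m) (osum (\<lambda>n. x (m + n))) (osum x)"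
  proof (induction m)
    case (Suc m)
    note S = osum_shift[of "\<lambda>n. x (m + n)"]
    have A: "dsum (osum (\<lambda>n. x (Suc m + n))) (x m) (osum (\<lambda>n. x (m + n)))"
      using S Suc dsum_commute by auto
    have B: "dsum (osum (\<lambda>n. x (m + n))) (partial_join x m) (osum x)"
      using Suc dsum_commute by blast
    show ?case using S Suc dsum_assoc(2)[OF A B] by (simp add: dsum_commute sup_commute)
  qed (use assms in simp)
  then show "independent (\<lambda>n. x (m + n))" "dsum (partial_join x m) (osum (\<lambda>n. x (m + n))) (osum x)"
    by auto
qed

text \<open>The partial joins of \<open>x\<close> and \<open>y\<close> stay disjoint at each finite
  stage by \<open>disj_interchange\<close>, and meet continuity carries this over to the full
  joins.\<close>

lemma osum_split:
  assumes "independent (z :: nat \<Rightarrow> 'a)" "\<And>n. dsum (x n) (y n) (z n)"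
  shows "independent x" "independent y" "dsum (osum x) (osum y) (osum z)"
proof -
  show "independent x" "independent y"
    using independent_mono[OF assms(1)] assms(2) dsum_le1 dsum_le2 by metis+
  have z: "z = (\<lambda>n. sup (x n) (y n))" using assms(2) by (auto simp: dsum_def)
  have "inf (partial_join x n) (partial_join y n) = bot" for n
  proof (induction n)
    case (Suc n)
    have "dsum (partial_join x n) (partial_join y n) (partial_join z n)"
      using Suc by (simp add: z partial_join_sup dsum_def)
    then show ?case
      using disj_interchange[OF _ assms(2)] assms(1) by (simp add: independent_def)
  qed simp
  then have "inf (osum x) (osum y) = bot"
    unfolding osum_def by (intro disj_lim2 mono_partial_join)
  then show "dsum (osum x) (osum y) (osum z)"
    by (simp add: dsum_def z osum_sup)
qed

lemma osum_merge:
  assumes "independent (x :: nat \<Rightarrow> 'a)" "independent y" "inf (osum x) (osum y) = bot"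
  shows "independent (\<lambda>n. sup (x n) (y n))" "\<And>n. dsum (x n) (y n) (sup (x n) (y n))"
proof -
  show "independent (\<lambda>n. sup (x n) (y n))"
    unfolding independent_def partial_join_sup
  proof
    fix n
    show "inf (sup (partial_join x n) (partial_join y n)) (sup (x n) (y n)) = bot"
      using disj_interchange[OF independent_dsum[OF assms(1)] independent_dsum[OF assms(2)]]
        disj_mono[OF assms(3)] partial_join_le_osum by metis
  qed
  show "dsum (x n) (y n) (sup (x n) (y n))" for n
    using disj_mono[OF assms(3)] le_osum by (simp add: dsum_def)
qed

text \<open>The standard way to turn an increasing sequence into a countable direct sum: the partial
  joins of the differences are the terms \<open>t n\<close> themselves, which makes the differences
  independent.\<close>

lemma increments:
  fixes t :: "nat \<Rightarrow> 'a"
  assumes "t 0 = bot" "\<And>n. dsum (t n) (e n) (t (Suc n))"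
  shows "independent e" "partial_join e = t" "osum e = lim t"
proof -
  have pj: "partial_join e n = t n" for n
    by (induction n) (use assms in \<open>auto simp: dsum_def\<close>)
  then show "partial_join e = t" by auto
  then show "independent e" "osum e = lim t"
    using assms by (simp_all add: independent_def osum_def dsum_def)
qed

text \<open>The first \<open>n\<close> differences of a decreasing sequence are complementary to
  \<open>d n\<close> in \<open>d 0\<close>. A complement of \<open>osum t\<close> in
  \<open>d 0\<close> later plays the role of an infimum.\<close>

lemma decrements:
  fixes t d :: "nat \<Rightarrow> 'a"
  assumes "\<And>n. dsum (t n) (d (Suc n)) (d n)"
  shows "independent t" "dsum (partial_join t n) (d n) (d 0)" "osum t \<le> d 0"
proof -
  have P: "dsum (partial_join t n) (d n) (d 0)" for n
  proof (induction n)
    case (Suc n)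
    show ?case
      using dsum_assoc(2)[OF dsum_commute[OF assms[of n]] dsum_commute[OF Suc]]
      by (simp add: dsum_commute sup_commute)
  qed simp
  then show "dsum (partial_join t n) (d n) (d 0)" .
  show "independent t"
    unfolding independent_def using P assms disj_mono dsum_inf dsum_le1 order_refl by metis
  show "osum t \<le> d 0"
    unfolding osum_def using P dsum_le1 lim_least mono_partial_join by metis
qed

lemma interval_iso_lim:
  assumes "interval_iso x y f g" "mono (b :: nat \<Rightarrow> 'a)" "\<And>n. b n \<le> x"
  shows "f (lim b) = lim (\<lambda>n. f (b n))"
proof -
  note D = interval_isoD[OF assms(1)]
  have bx: "lim b \<le> x" using assms lim_least by blast
  have m: "mono (\<lambda>n. f (b n))" using assms D(5) by (simp add: mono_def)
  show ?thesis
  proof (rule lim_eqI[OF m, symmetric])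
    show "f (b n) \<le> f (lim b)" for n using assms D(5) bx lim_upper by blast
    show "f (lim b) \<le> z" if z: "\<And>n. f (b n) \<le> z" for z
    proof -
      have "b n \<le> g (inf z y)" for n
        using D(1,2,6) z assms(3) by (metis inf_le2 le_inf_iff)
      then have "lim b \<le> g (inf z y)" using assms(2) lim_least by blast
      then have "f (lim b) \<le> inf z y" using D by (metis inf_le2)
      then show ?thesis by simp
    qed
  qed
qed

lemma interval_iso_osum:
  assumes "interval_iso x y f g" "independent (u :: nat \<Rightarrow> 'a)" "osum u = x"
  shows "independent (\<lambda>n. f (u n))" "osum (\<lambda>n. f (u n)) = y"
proof -
  have le: "u n \<le> x" "partial_join u n \<le> x" for n
    using assms(3) le_osum partial_join_le_osum by blast+
  have pj: "partial_join (\<lambda>n. f (u n)) n = f (partial_join u n)" for n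
    by (induction n) (use le interval_iso_sup[OF assms(1)] interval_iso_bot[OF assms(1)] in auto)
  show "independent (\<lambda>n. f (u n))"
    using assms(2) le interval_iso_disj[OF assms(1)] unfolding independent_def pj by auto
  have "osum (\<lambda>n. f (u n)) = lim (\<lambda>n. f (partial_join u n))"
    unfolding osum_def by (simp add: pj[abs_def] cong: arg_cong[where f = lim])
  also have "\<dots> = f (osum u)"
    unfolding osum_def using interval_iso_lim[OF assms(1) mono_partial_join le(2)] by simp
  finally show "osum (\<lambda>n. f (u n)) = y"
    using assms(3) interval_iso_top[OF assms(1)] by simp
qed

text \<open>Axes chosen inside the spans \<open>sup (x n) (y n)\<close> inherit the independence of
  these spans, so their join is an axis for the two joins.\<close>

lemma persp_osum:
  assumes "independent x" "independent y" "\<And>n. persp (x n :: 'a) (y n)"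
    "inf (osum x) (osum y) = bot"
  shows "persp (osum x) (osum y)"
proof -
  have "\<exists>k. inf (x n) k = bot \<and> inf (y n) k = bot \<and> sup (x n) k = sup (x n) (y n)
      \<and> sup (y n) k = sup (x n) (y n)" for n
    using persp_axis[OF assms(3)] by metis
  then obtain k where k: "\<And>n. inf (x n) (k n) = bot" "\<And>n. inf (y n) (k n) = bot"
    "\<And>n. sup (x n) (k n) = sup (x n) (y n)" "\<And>n. sup (y n) (k n) = sup (x n) (y n)"
    by metis
  note I = osum_merge(1)[OF assms(1,2,4)]
  have "dsum (osum x) (osum k) (osum (\<lambda>n. sup (x n) (y n)))"
    by (rule osum_split(3)[OF I]) (simp add: dsum_def k)
  moreover have "dsum (osum y) (osum k) (osum (\<lambda>n. sup (x n) (y n)))"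
    by (rule osum_split(3)[OF I]) (simp add: dsum_def k)
  ultimately show ?thesis by (rule persp_common_compl)
qed

text \<open>By meet continuity the traces of \<open>y\<close> on the partial joins increase to
  \<open>y\<close>. Each increment avoids the previous partial join and so projects into the next
  term.\<close>

lemma osum_project:
  assumes "independent x" "(y::'a) \<le> osum x"
  obtains u where "independent u" "osum u = y" "\<And>n. \<exists>x'\<le>x n. persp (u n) x'"
proof -
  define t where "t n = inf y (partial_join x n)" for n
  have mt: "mono t" unfolding t_def
    using monoD[OF mono_partial_join] by (intro monoI inf_mono) auto
  have "\<exists>e. dsum (t n) e (t (Suc n))" for n
    using dsum_ex[OF monoD[OF mt, of n "Suc n"]] by (metis le_SucI order_refl)
  then obtain u where u: "\<And>n. dsum (t n) (u n) (t (Suc n))" by metis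
  have t0: "t 0 = bot" by (simp add: t_def)
  note inc = increments[OF t0 u]
  have "lim t = inf y (osum x)"
    unfolding t_def osum_def using inf_lim[OF mono_partial_join] by simp
  then have "osum u = y" using inc(3) assms(2) by (simp add: inf_absorb1)
  moreover have "\<exists>x'\<le>x n. persp (u n) x'" for n
  proof (rule persp_project[OF independent_dsum[OF assms(1)]])
    show "t (Suc n) \<le> partial_join x (Suc n)" unfolding t_def by simp
    have "inf (t (Suc n)) (partial_join x n) = t n"
      unfolding t_def using monoD[OF mono_partial_join, of n "Suc n" x]
      by (simp add: inf_absorb2 inf_assoc del: partial_join.simps)
    then show "dsum (inf (t (Suc n)) (partial_join x n)) (u n) (t (Suc n))"
      using u by simp
  qed blast
  ultimately show ?thesis using that inc(1) by blast
qed

section \<open>Transitivity of perspectivity for disjoint elements\<close>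

text \<open>A roomy \<open>x\<close> has a perspective copy independent of \<open>x\<close> and \<open>C\<close>; this copy is the
  third element that is needed to compose perspectivities between \<open>x\<close> and parts of \<open>C\<close>.\<close>

definition roomy :: "'a \<Rightarrow> 'a \<Rightarrow> bool" where
  "roomy C x \<longleftrightarrow> (\<exists>r. persp r x \<and> inf r (sup x C) = bot)"

text \<open>Only direct sums are built in, so that an induction can join axes in each case. Closure
  under parts, arbitrary joins and limits is derived afterwards.\<close>

inductive room_ideal :: "'a \<Rightarrow> 'a \<Rightarrow> 'a \<Rightarrow> bool" for Y C where
  room_ideal_roomy: "x \<le> Y \<Longrightarrow> roomy C x \<Longrightarrow> room_ideal Y C x"
| room_ideal_dsum: "room_ideal Y C x \<Longrightarrow> room_ideal Y C y \<Longrightarrow> dsum x y z \<Longrightarrow> room_ideal Y C z"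
| room_ideal_osum: "independent x \<Longrightarrow> (\<And>n. room_ideal Y C (x n)) \<Longrightarrow> room_ideal Y C (osum x)"

text \<open>The second alternative describes a composite of two perspectivities that leaves
  \<open>Y\<close> in between; the first one covers projections inside \<open>Y\<close>.\<close>

definition step :: "'a \<Rightarrow> 'a \<Rightarrow> 'a \<Rightarrow> bool" where
  "step Y u v \<longleftrightarrow> persp u v \<or> (\<exists>b. inf b Y = bot \<and> persp u b \<and> persp b v)"

lemma step_persp: "persp u v \<Longrightarrow> step Y u v"
  by (simp add: step_def)

text \<open>An intermediate element outside \<open>Y\<close> is independent of
  \<open>sup u v\<close>, so that the elementary composition applies.\<close>

lemma step_disj:
  assumes "step Y u v" "u \<le> Y" "v \<le> Y" "inf u v = bot"
  shows "persp u v"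
proof -
  have "persp u v" if b: "inf b Y = bot" "persp u b" "persp b v" for b
  proof (rule persp_trans_disj[OF b(2,3)])
    have "inf (sup u v) b = bot"
      using disj_mono[of Y b "sup u v" b] b(1) assms by (simp add: inf_commute)
    then show "inf u (sup b v) = bot"
      using disj_sup_left[OF assms(4)] by (simp add: sup_commute)
  qed
  then show ?thesis using assms(1) unfolding step_def by blast
qed

lemma step_iso:
  assumes "step Y u v"
  obtains f g where "interval_iso u v f g" "\<And>w. w \<le> u \<Longrightarrow> step Y w (f w)"
proof -
  have "\<exists>f g. interval_iso u v f g \<and> (\<forall>w\<le>u. step Y w (f w))"
    using assms unfolding step_def
  proof (elim disjE exE conjE)
    assume "persp u v"
    then show "\<exists>f g. interval_iso u v f g \<and> (\<forall>w\<le>u. persp w (f w) \<or>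
        (\<exists>b. inf b Y = bot \<and> persp w b \<and> persp b (f w)))"
      using persp_iso_ex persp_isoD by metis
  next
    fix b assume b: "inf b Y = bot" "persp u b" "persp b v"
    obtain f g where fg: "persp_iso u b f g" using persp_iso_ex[OF b(2)] .
    obtain f' g' where fg': "persp_iso b v f' g'" using persp_iso_ex[OF b(3)] .
    have "\<exists>b. inf b Y = bot \<and> persp w b \<and> persp b ((f' \<circ> f) w)" if "w \<le> u" for w
      using persp_isoD[OF fg] persp_isoD[OF fg'] that b(1) interval_isoD(1) disj_mono order_refl
      by (metis comp_apply)
    then show "\<exists>f g. interval_iso u v f g \<and> (\<forall>w\<le>u. persp w (f w) \<or>
        (\<exists>b. inf b Y = bot \<and> persp w b \<and> persp b (f w)))"
      using interval_iso_trans[OF persp_isoD(1)[OF fg] persp_isoD(1)[OF fg']] by blast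
  qed
  then show ?thesis using that by blast
qed

lemma roomy_mono:
  assumes "roomy C x" "x' \<le> x" shows "roomy C x'"
proof -
  obtain r where r: "persp r x" "inf r (sup x C) = bot" using assms(1) unfolding roomy_def by blast
  obtain r' where "r' \<le> r" "persp x' r'" using persp_part[OF persp_sym[OF r(1)] assms(2)] .
  then show ?thesis unfolding roomy_def
    using disj_mono[OF r(2)] assms(2) persp_sym sup_mono by (metis order_refl)
qed

section \<open>Closure properties of the room ideal\<close>

context
  fixes Y C :: 'a
  assumes YC: "inf Y C = bot"
begin

lemma room_ideal_le: "room_ideal Y C x \<Longrightarrow> x \<le> Y"
  by (induction rule: room_ideal.induct) (auto simp: dsum_def intro: osum_least)

text \<open>The partner \<open>v\<close> is itself the required copy, because \<open>C\<close>
  avoids all of \<open>Y\<close>.\<close>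

lemma roomy_disj:
  assumes "persp u v" "u \<le> Y" "v \<le> Y" "inf u v = bot"
  shows "roomy C u"
proof -
  have "inf (sup v u) C = bot"
    using disj_mono[OF YC, of "sup v u" C] assms by simp
  then have "inf v (sup u C) = bot"
    using disj_sup_left[of v u C] assms(4) by (simp add: inf_commute)
  then show ?thesis using assms(1) unfolding roomy_def using persp_sym by blast
qed

text \<open>For a roomy \<open>x\<close>, the part of \<open>v\<close> inside \<open>x\<close>
  inherits room, while the part outside \<open>x\<close> is disjoint from its preimage, hence
  perspective to it and roomy as well. Sums are transported along the isomorphism
  \<open>f\<close>.\<close>

lemma room_ideal_step:
  assumes "room_ideal Y C u" "step Y u v" "v \<le> Y"
  shows "room_ideal Y C v"
  using assms
proof (induction arbitrary: v rule: room_ideal.induct)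
  case (room_ideal_roomy x)
  obtain f g where fg: "interval_iso x v f g" "\<And>w. w \<le> x \<Longrightarrow> step Y w (f w)"
    using step_iso[OF room_ideal_roomy(3)] by blast
  note D = interval_isoD[OF fg(1)]
  obtain v2 where v2: "dsum (inf v x) v2 v" using dsum_ex[of "inf v x" v] by auto
  have v2v: "v2 \<le> v" using v2 dsum_le2 by blast
  have "inf v2 x = inf v2 (inf v x)" using v2v by (simp add: inf_absorb1 flip: inf_assoc)
  then have v2x: "inf v2 x = bot" using v2 by (simp add: dsum_def inf_commute)
  have "step Y (g v2) v2" using fg(2)[of "g v2"] D v2v by simp
  moreover have gx: "g v2 \<le> x" using D v2v by simp
  moreover have "inf (g v2) v2 = bot" using disj_mono[OF v2x _ gx] by (simp add: inf_commute)
  ultimately have "persp (g v2) v2" "g v2 \<le> Y" "v2 \<le> Y" "inf (g v2) v2 = bot"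
    using step_disj room_ideal_roomy(1,4) v2v by (meson order_trans)+
  then have "roomy C v2" using roomy_disj persp_sym by (metis inf_commute)
  moreover have "roomy C (inf v x)" using roomy_mono[OF room_ideal_roomy(2)] by simp
  ultimately show ?case
    using room_ideal.intros(1,2) v2 room_ideal_roomy(4) v2v by (meson order_trans dsum_le1)
next
  case (room_ideal_dsum x y z)
  obtain f g where fg: "interval_iso z v f g" "\<And>w. w \<le> z \<Longrightarrow> step Y w (f w)"
    using step_iso[OF room_ideal_dsum(6)] by blast
  have le: "x \<le> z" "y \<le> z" using room_ideal_dsum(3) dsum_le1 dsum_le2 by blast+
  have "dsum (f x) (f y) v"
    using interval_iso_dsum[OF fg(1) room_ideal_dsum(3)] interval_iso_top[OF fg(1)] by simp
  moreover have "f x \<le> Y" "f y \<le> Y"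
    using interval_isoD(1)[OF fg(1)] le room_ideal_dsum(7) order_trans by blast+
  ultimately show ?case
    using room_ideal_dsum(4,5) fg(2) le room_ideal.room_ideal_dsum by metis
next
  case (room_ideal_osum x)
  obtain f g where fg: "interval_iso (osum x) v f g" "\<And>w. w \<le> osum x \<Longrightarrow> step Y w (f w)"
    using step_iso[OF room_ideal_osum(4)] by blast
  note O = interval_iso_osum[OF fg(1) room_ideal_osum(1) HOL.refl]
  have "room_ideal Y C (f (x n))" for n
    using room_ideal_osum(3)[of n "f (x n)"] fg(2) le_osum interval_isoD(1)[OF fg(1)]
      room_ideal_osum(5) order_trans by blast
  then show ?case using room_ideal.room_ideal_osum[OF O(1)] O(2) by metis
qed

text \<open>An element below a sum is cut into pieces that project into the summands;
  \<open>room_ideal_step\<close> carries membership back along these projections.\<close>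

lemma room_ideal_down:
  assumes "room_ideal Y C x" "y \<le> x"
  shows "room_ideal Y C y"
  using assms
proof (induction arbitrary: y rule: room_ideal.induct)
  case (room_ideal_roomy x)
  then show ?case using room_ideal.room_ideal_roomy roomy_mono by (meson order_trans)
next
  case (room_ideal_dsum x1 x2 z)
  obtain y2 where y2: "dsum (inf y x1) y2 y" using dsum_ex[of "inf y x1" y] by auto
  obtain u where u: "u \<le> x2" "persp y2 u"
    using persp_project[OF room_ideal_dsum(3,6) y2] .
  have "y2 \<le> Y"
    using room_ideal_le room_ideal_dsum y2 dsum_le2 room_ideal.room_ideal_dsum order_trans by meson
  then have "room_ideal Y C y2"
    using room_ideal_step[OF room_ideal_dsum(5)[OF u(1)]] step_persp persp_sym u(2) by blast
  then show ?case
    using room_ideal.room_ideal_dsum[OF room_ideal_dsum(4) _ y2] by simp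
next
  case (room_ideal_osum x)
  obtain u where u: "independent u" "osum u = y" "\<And>n. \<exists>x'\<le>x n. persp (u n) x'"
    using osum_project[OF room_ideal_osum(1,4)] by blast
  have "room_ideal Y C (u n)" for n
  proof -
    obtain x' where x': "x' \<le> x n" "persp (u n) x'" using u(3) by blast
    have "osum x \<le> Y" using room_ideal_le room_ideal_osum(2) osum_least by blast
    then have "u n \<le> Y" using le_osum[of u n] u(2) room_ideal_osum(4) order_trans by blast
    then show ?thesis
      using room_ideal_step[OF room_ideal_osum(3)[OF x'(1)]] step_persp persp_sym x'(2) by blast
  qed
  then show ?case using room_ideal.room_ideal_osum[OF u(1)] u(2) by metis
qed

lemma room_ideal_sup:
  assumes "room_ideal Y C x" "room_ideal Y C y"
  shows "room_ideal Y C (sup x y)"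
proof -
  obtain z where z: "dsum x z (sup x y)" using dsum_ex[of x "sup x y"] by auto
  obtain e where e: "dsum (inf x y) e y" using dsum_ex[of "inf x y" y] by auto
  have "e \<le> y" using e dsum_le2 by blast
  have "inf x e = inf e (inf x y)"
    using \<open>e \<le> y\<close> by (metis inf.absorb1 inf.assoc inf.commute)
  then have "inf x e = bot" using e by (simp add: dsum_def inf_commute)
  moreover have "sup x e = sup x y" using e by (metis dsum_def sup.assoc sup_inf_absorb)
  ultimately have "dsum x e (sup x y)" by (simp add: dsum_def)
  then show ?thesis
    using room_ideal.room_ideal_dsum assms room_ideal_down \<open>e \<le> y\<close> by blast
qed

lemma room_ideal_lim:
  assumes "mono h" "\<And>n. room_ideal Y C (h n)"
  shows "room_ideal Y C (lim h)"
proof -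
  define t where "t n = (case n of 0 \<Rightarrow> bot | Suc m \<Rightarrow> h m)" for n
  have t: "t 0 = bot" "\<And>n. t (Suc n) = h n" by (simp_all add: t_def)
  have "t n \<le> t (Suc n)" for n
    using assms(1) by (cases n) (simp_all add: t monoD)
  then have mt: "mono t" by (simp add: mono_iff_le_Suc)
  have "\<exists>e. dsum (t n) e (t (Suc n))" for n
    using dsum_ex[OF \<open>t n \<le> t (Suc n)\<close>] by blast
  then obtain e where e: "\<And>n. dsum (t n) (e n) (t (Suc n))" by metis
  note I = increments[OF t(1) e]
  have "room_ideal Y C (e n)" for n
    using room_ideal_down[OF assms(2)[of n]] e[of n] dsum_le2 t by metis
  then have "room_ideal Y C (lim t)" using room_ideal.room_ideal_osum[OF I(1)] I(3) by metis
  then show ?thesis using lim_Suc[OF mt] t(2) by simp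
qed

end

text \<open>Sums are handled by joining axes, since the images lie in \<open>C\<close> and so avoid
  \<open>Y\<close>. A roomy \<open>x\<close> is cut into pieces such that every composition involves
  an element independent of the other two: an element of the chain or a copy taken from the spare
  element \<open>r\<close>.\<close>

lemma room_transfer:
  assumes YC: "inf Y C = bot" and bY: "inf b Y = bot"
    and f: "persp_iso y0 b f f'" and g: "persp_iso b d0 g g'" and h: "persp_iso d0 y2 h h'"
    and le: "y0 \<le> Y" "d0 \<le> Y" "y2 \<le> C"
    and x: "room_ideal Y C x" "x \<le> y0"
  shows "persp x (h (g (f x)))"
  using x
proof (induction rule: room_ideal.induct)
  case (room_ideal_roomy x)
  note F = persp_isoD[OF f] and G = persp_isoD[OF g] and H = persp_isoD[OF h]
  note DF = interval_isoD[OF F(1)] and DG = interval_isoD[OF G(1)] and DH = interval_isoD[OF H(1)]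
  define \<gamma> \<theta> where "\<gamma> = g \<circ> f" and "\<theta> = h \<circ> (g \<circ> f)"
  have I\<gamma>: "interval_iso y0 d0 \<gamma> (f' \<circ> g')"
    unfolding \<gamma>_def by (rule interval_iso_trans[OF F(1) G(1)])
  have I\<theta>: "interval_iso y0 y2 \<theta> ((f' \<circ> g') \<circ> h')"
    using interval_iso_trans[OF I\<gamma> H(1)] by (simp add: \<theta>_def \<gamma>_def)
  note D\<gamma> = interval_isoD[OF I\<gamma>] and D\<theta> = interval_isoD[OF I\<theta>]
  have pf: "persp u (f u)" and pg: "persp (f u) (\<gamma> u)" and ph: "persp (\<gamma> u) (\<theta> u)"
    and fle: "f u \<le> b" and gle: "\<gamma> u \<le> Y" and hle: "\<theta> u \<le> C" if "u \<le> y0" for u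
    using that F(2) G(2) H(2) DF(1) D\<gamma>(1) D\<theta>(1) DG(1) le(1) order_trans[OF _ le(2)]
      order_trans[OF _ le(3)]
    unfolding \<gamma>_def \<theta>_def by auto
  obtain r where r: "persp r x" "inf r (sup x C) = bot"
    using room_ideal_roomy(2) unfolding roomy_def by blast
  have rx: "inf r x = bot" using disj_mono[OF r(2)] by simp
  have xC: "inf x C = bot" using disj_mono[OF YC] room_ideal_roomy(1) by simp
  have Cxr: "inf C (sup x r) = bot"
    using disj_sup_left[of r x C] disj_sup_right[of x C r] r(2) xC
    by (simp add: inf_commute sup_commute)
  \<comment> \<open>\<open>x1\<close> is the largest part of \<open>y0\<close> that
    \<open>\<gamma>\<close> maps into \<open>x\<close>. The part \<open>x2\<close> of
    \<open>x\<close> outside it has an image disjoint from \<open>x\<close>, whereas the image of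
    \<open>x1'\<close> stays in \<open>x\<close>.\<close>
  define x1 where "x1 = (f' \<circ> g') (inf d0 x)"
  have x1: "\<gamma> x1 = inf d0 x" "x1 \<le> y0"
    unfolding x1_def using D\<gamma>(3,4) by simp_all
  define x1' where "x1' = inf x1 x"
  have x1'x: "x1' \<le> x" "x1' \<le> y0" "\<gamma> x1' \<le> x"
    using x1 room_ideal_roomy(3) D\<gamma>(5)[of x1' x1] unfolding x1'_def by (auto intro: le_infI2)
  obtain x2 where x2: "dsum x1' x2 x" using dsum_ex[OF x1'x(1)] .
  have x2x: "x2 \<le> x" "x2 \<le> y0" using x2 dsum_le2 room_ideal_roomy(3) order_trans by blast+
  have "persp x2 (\<theta> x2)"
  proof -
    have "inf x2 x1 = inf x2 x1'"
      unfolding x1'_def using x2x by (metis inf.absorb1 inf.assoc inf.commute)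
    then have "inf x2 x1 = bot" using x2 by (simp add: dsum_def inf_commute)
    then have "inf (\<gamma> x2) (\<gamma> x1) = bot"
      using interval_iso_disj[OF I\<gamma> x2x(2) x1(2)] by simp
    then have "inf (\<gamma> x2) x = bot"
      using x1 D\<gamma>(1)[OF x2x(2)] by (metis inf.absorb1 inf.assoc)
    then have dis: "inf x2 (\<gamma> x2) = bot"
      using disj_mono[of x "\<gamma> x2" x2 "\<gamma> x2"] x2x(1) by (simp add: inf_commute)
    have "step Y x2 (\<gamma> x2)"
      unfolding step_def using pf pg fle x2x disj_mono[OF bY] by blast
    then have "persp x2 (\<gamma> x2)"
      using step_disj dis gle x2x le(1) order_trans by blast
    moreover have "inf (\<theta> x2) (sup x2 (\<gamma> x2)) = bot"
      using disj_mono[OF YC, of "sup x2 (\<gamma> x2)" "\<theta> x2"] gle hle x2x le(1)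
      by (metis inf_commute le_sup_iff order_trans)
    ultimately show ?thesis using persp_trans_disj' ph x2x by blast
  qed
  moreover have "persp x1' (\<theta> x1')"
  proof -
    \<comment> \<open>\<open>m\<close> is the part of \<open>x1'\<close> that \<open>f\<close> sends
      below \<open>sup x r\<close>, an element disjoint from \<open>C\<close>. The image of the
      remaining part \<open>m2\<close> is disjoint from \<open>sup x r\<close>.\<close>
    define m where "m = f' (inf (f x1') (sup x r))"
    have m: "m \<le> x1'" "f m \<le> sup x r" "f m = inf (f x1') (sup x r)"
    proof -
      have le': "inf (f x1') (sup x r) \<le> b"
        using fle[OF x1'x(2)] by (rule le_infI1)
      show "f m = inf (f x1') (sup x r)" unfolding m_def using DF(4)[OF le'] .
      then show "f m \<le> sup x r" by simp
      have "f' (inf (f x1') (sup x r)) \<le> f' (f x1')"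
        using DF(6) fle[OF x1'x(2)] by simp
      then show "m \<le> x1'" unfolding m_def using DF(2)[OF x1'x(2)] by simp
    qed
    obtain m2 where m2: "dsum m m2 x1'" using dsum_ex[OF m(1)] .
    have m2x: "m2 \<le> x1'" "m2 \<le> x" "m2 \<le> y0" and mx: "m \<le> x" "m \<le> y0"
      using m2 m x1'x dsum_le2 order_trans by blast+
    have \<gamma>x: "\<gamma> m \<le> x" "\<gamma> m2 \<le> x"
      using D\<gamma>(5) m(1) m2x x1'x order_trans by blast+
    \<comment> \<open>The chain is read backwards: \<open>\<theta> m\<close> lies in
      \<open>C\<close> and is independent of \<open>\<gamma> m\<close>, \<open>f m\<close> and
      \<open>m\<close>, all of which lie below \<open>sup x r\<close>.\<close>
    have "persp m (\<theta> m)"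
    proof -
      have 1: "inf (\<theta> m) (sup x r) = bot"
        using disj_mono[OF Cxr] hle mx by simp
      have "persp (\<theta> m) (f m)"
        using persp_trans_disj[OF persp_sym[OF ph] persp_sym[OF pg]] mx
          disj_mono[OF 1] \<gamma>x m(2) by (simp add: le_supI1)
      moreover have "inf (\<theta> m) (sup (f m) m) = bot"
        using disj_mono[OF 1] m(2) mx by (simp add: le_supI1)
      ultimately show ?thesis
        using persp_trans_disj persp_sym pf mx by blast
    qed
    moreover have "persp m2 (\<theta> m2)"
    proof -
      have "inf (f m2) (f m) = bot"
        using interval_iso_disj[OF F(1), of m2 m] m2 m2x mx by (simp add: dsum_def inf_commute)
      then have fm2: "inf (f m2) (sup x r) = bot"
        using m(3) DF(5)[OF m2x(1) x1'x(2)] by (metis inf.absorb1 inf.assoc)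
      \<comment> \<open>The copy \<open>s\<close> replaces \<open>m2\<close> as the starting point.
        It is independent of any two consecutive elements of the chain, so it can be carried to the
        end, where \<open>m2\<close> is put back.\<close>
      obtain s where s: "s \<le> r" "persp m2 s" using persp_part[OF persp_sym[OF r(1)] m2x(2)] .
      have fr: "inf r (sup x (f m2)) = bot"
        using disj_sup_left[of r x "f m2"] rx fm2 by (simp add: ac_simps)
      have 1: "persp s (f m2)"
        using persp_trans_disj[OF persp_sym[OF s(2)] pf[OF m2x(3)]]
          disj_mono[OF fr s(1)] m2x(2) by (simp add: le_supI1)
      have 2: "persp s (\<gamma> m2)"
        using persp_trans_disj[OF 1 pg[OF m2x(3)]] disj_mono[OF fr s(1)] \<gamma>x(2)
        by (simp add: le_supI1)
      have 3: "persp s (\<theta> m2)"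
        using persp_trans_disj[OF 2 ph[OF m2x(3)]] disj_mono[OF r(2) s(1)] \<gamma>x(2) hle[OF m2x(3)]
        by (simp add: le_supI1 le_supI2)
      have "inf m2 (sup s (\<theta> m2)) = bot"
      proof -
        have "inf x (sup r C) = bot"
          using disj_sup_left[of x r C] disj_sup_right[of x C r] r(2) xC rx
          by (simp add: inf_commute sup_commute)
        then show ?thesis
          using disj_mono m2x(2) s(1) hle[OF m2x(3)] sup_mono by meson
      qed
      then show ?thesis using persp_trans_disj[OF s(2) 3] by blast
    qed
    moreover have "dsum (\<theta> m) (\<theta> m2) (\<theta> x1')"
      using interval_iso_dsum[OF I\<theta> m2 x1'x(2)] .
    ultimately show ?thesis
      using persp_dsum[OF _ _ m2] disj_mono[OF YC] hle[OF x1'x(2)] x1'x le(1) order_trans by blast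
  qed
  moreover have "dsum (\<theta> x1') (\<theta> x2) (\<theta> x)"
    using interval_iso_dsum[OF I\<theta> x2 room_ideal_roomy(3)] .
  ultimately have "persp x (\<theta> x)"
    using persp_dsum[OF _ _ x2] disj_mono[OF YC] hle room_ideal_roomy(1,3) by blast
  then show ?case by (simp add: \<theta>_def)
next
  case (room_ideal_dsum x y z)
  have I: "interval_iso y0 y2 (h \<circ> (g \<circ> f)) ((f' \<circ> g') \<circ> h')"
    using interval_iso_trans interval_iso_trans persp_isoD(1) f g h by blast
  have "x \<le> y0" "y \<le> y0"
    using room_ideal_dsum(3,6) dsum_le1 dsum_le2 order_trans by blast+
  moreover have "inf z (h (g (f z))) = bot"
    using disj_mono[OF YC] interval_isoD(1)[OF I room_ideal_dsum(6)] room_ideal_dsum(6) le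
      order_trans by (metis comp_apply)
  ultimately show ?case
    using persp_dsum[OF _ _ room_ideal_dsum(3)] interval_iso_dsum[OF I room_ideal_dsum(3,6)]
      room_ideal_dsum(4,5) by simp
next
  case (room_ideal_osum x)
  have I: "interval_iso y0 y2 (h \<circ> (g \<circ> f)) ((f' \<circ> g') \<circ> h')"
    using interval_iso_trans interval_iso_trans persp_isoD(1) f g h by blast
  note J = interval_iso_osum[OF interval_iso_restrict[OF I room_ideal_osum(4)] room_ideal_osum(1) HOL.refl]
  have "x n \<le> y0" for n using le_osum room_ideal_osum(4) order_trans by blast
  then have "persp (x n) ((h \<circ> (g \<circ> f)) (x n))" for n
    using room_ideal_osum(3) by simp
  moreover have "inf (osum x) ((h \<circ> (g \<circ> f)) (osum x)) = bot"
    using disj_mono[OF YC] interval_isoD(1)[OF I room_ideal_osum(4)] room_ideal_osum(4) le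
      order_trans by metis
  ultimately have "persp (osum x) ((h \<circ> (g \<circ> f)) (osum x))"
    using persp_osum[OF room_ideal_osum(1) J(1)] J(2) by metis
  then show ?case by simp
qed

lemma step_sym: "step Y u v \<Longrightarrow> step Y v u"
  unfolding step_def using persp_sym by blast

text \<open>Wherever \<open>y0\<close> and its image \<open>d0\<close> differ there is room. The room ideal contains an element \<open>s\<close>
  modulo which \<open>y0\<close> and \<open>d0\<close> coincide, so outside \<open>s\<close> an axis of \<open>d0\<close> and \<open>y2\<close> serves for \<open>y0\<close>.\<close>

lemma persp_through:
  assumes YC: "inf (Y::'a) C = bot" and bY: "inf b Y = bot"
    and le: "y0 \<le> Y" "d0 \<le> Y" "y2 \<le> C"
    and p: "persp y0 b" "persp b d0" "persp d0 y2"
  shows "persp y0 y2"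
proof -
  obtain f f' where f: "persp_iso y0 b f f'" using persp_iso_ex[OF p(1)] .
  obtain g g' where g: "persp_iso b d0 g g'" using persp_iso_ex[OF p(2)] .
  \<comment> \<open>This perspectivity keeps its axis explicit, because the axis for
    \<open>e\<close> at the end is built from it.\<close>
  obtain k where k: "inf d0 k = bot" "inf y2 k = bot" "sup d0 k = sup d0 y2" "sup y2 k = sup d0 y2"
    using persp_axis[OF p(3)] .
  define h where "h u = inf (sup u k) y2" for u
  define h' where "h' u = inf (sup u k) d0" for u
  have h: "persp_iso d0 y2 h h'"
    using persp_iso_axis[OF k(1,2)] k(3,4) unfolding h_def[abs_def] h'_def[abs_def] by simp
  note F = persp_isoD[OF f] and G = persp_isoD[OF g] and H = persp_isoD[OF h]
  define \<gamma> \<gamma>' where "\<gamma> = g \<circ> f" and "\<gamma>' = f' \<circ> g'"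
  have I\<gamma>: "interval_iso y0 d0 \<gamma> \<gamma>'"
    unfolding \<gamma>_def \<gamma>'_def by (rule interval_iso_trans[OF F(1) G(1)])
  note D = interval_isoD[OF I\<gamma>]
  have I\<theta>: "interval_iso y0 y2 (h \<circ> \<gamma>) (\<gamma>' \<circ> h')"
    by (rule interval_iso_trans[OF I\<gamma> H(1)])
  have st: "step Y u (\<gamma> u)" if "u \<le> y0" for u
  proof -
    have "f u \<le> b" using interval_isoD(1)[OF F(1) that] .
    then show ?thesis
      unfolding step_def \<gamma>_def using F(2)[OF that] G(2)[of "f u"] disj_mono[OF bY] by auto
  qed
  have st': "step Y v (\<gamma>' v)" if "v \<le> d0" for v
    using st[of "\<gamma>' v"] D that step_sym by simp
  have ideal: "room_ideal Y C (\<gamma> u)" if "room_ideal Y C u" "u \<le> y0" for u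
    using room_ideal_step[OF YC that(1) st[OF that(2)]] D(1)[OF that(2)] le(2) by auto
  have ideal': "room_ideal Y C (\<gamma>' v)" if "room_ideal Y C v" "v \<le> d0" for v
    using room_ideal_step[OF YC that(1) st'[OF that(2)]] D(3)[OF that(2)] le(1) by auto
  have moved: "room_ideal Y C u" "room_ideal Y C (\<gamma> u)" if "u \<le> y0" "inf u (\<gamma> u) = bot" for u
  proof -
    have uY: "u \<le> Y" "\<gamma> u \<le> Y" using D(1) that(1) le order_trans by blast+
    then have "persp u (\<gamma> u)" using step_disj[OF st] that by blast
    then have "roomy C u" using roomy_disj[OF YC _ uY that(2)] by blast
    then show "room_ideal Y C u" using room_ideal_roomy uY by blast
    then show "room_ideal Y C (\<gamma> u)" using ideal that by blast
  qed
  \<comment> \<open>\<open>z0\<close> and \<open>z1\<close> measure where \<open>y0\<close> and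
    \<open>d0\<close> differ. Each is disjoint from the element corresponding to it under
    \<open>\<gamma>\<close>, so both lie in the room ideal.\<close>
  obtain z0 where z0: "dsum (inf y0 d0) z0 y0" using dsum_ex[of "inf y0 d0" y0] by auto
  obtain z1 where z1: "dsum (inf y0 d0) z1 d0" using dsum_ex[of "inf y0 d0" d0] by auto
  have z0y: "z0 \<le> y0" and z1d: "z1 \<le> d0" using z0 z1 dsum_le2 by blast+
  have "inf z0 d0 = inf (inf y0 d0) z0" using z0y by (simp add: inf_absorb2 ac_simps)
  then have "inf z0 d0 = bot" using z0 dsum_inf by simp
  then have "inf z0 (\<gamma> z0) = bot" using disj_mono D(1)[OF z0y] order_refl by blast
  then have Hz0: "room_ideal Y C z0" using moved(1) z0y by blast
  have "inf y0 z1 = inf (inf y0 d0) z1" using z1d by (simp add: inf_absorb2 inf_assoc)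
  then have "inf y0 z1 = bot" using z1 dsum_inf by simp
  then have "inf (\<gamma>' z1) (\<gamma> (\<gamma>' z1)) = bot"
    using disj_mono[of y0 z1 "\<gamma>' z1" z1] D(3)[OF z1d] D(4)[OF z1d] by simp
  then have Hz1: "room_ideal Y C z1" using moved(2)[of "\<gamma>' z1"] D(3,4) z1d by simp
  \<comment> \<open>Iterating \<open>Q\<close> from \<open>sup z0 z1\<close> yields a limit
    \<open>s\<close> that is stable under \<open>\<gamma>\<close> and its inverse and still lies in
    the ideal. By stability, the part \<open>e\<close> of \<open>y0\<close> outside \<open>s\<close>
    has an image that is disjoint from \<open>s\<close> as well.\<close>
  define Q where "Q q = sup q (sup (\<gamma> (inf y0 q)) (\<gamma>' (inf d0 q)))" for q
  define q where "q = rec_nat (sup z0 z1) (\<lambda>_. Q)"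
  have q0: "q 0 = sup z0 z1" and qS: "q (Suc n) = Q (q n)" for n by (simp_all add: q_def)
  have Hq: "room_ideal Y C (q n)" for n
  proof (induction n)
    case 0 then show ?case using q0 room_ideal_sup[OF YC Hz0 Hz1] by simp
  next
    case (Suc n)
    have "room_ideal Y C (\<gamma> (inf y0 (q n)))" "room_ideal Y C (\<gamma>' (inf d0 (q n)))"
      using ideal ideal' room_ideal_down[OF YC Suc] by simp_all
    then show ?case unfolding qS Q_def using room_ideal_sup[OF YC] Suc by blast
  qed
  have mq: "mono q" unfolding mono_iff_le_Suc qS Q_def by simp
  define s where "s = lim q"
  have Hs: "room_ideal Y C s" unfolding s_def by (rule room_ideal_lim[OF YC mq Hq])
  have sY: "s \<le> Y" by (rule room_ideal_le[OF YC Hs])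
  have qs: "q n \<le> s" for n unfolding s_def by (rule lim_upper[OF mq])
  have minf: "mono (\<lambda>n. inf a (q n))" for a
    using mq by (auto simp: mono_def intro: le_infI2)
  have \<gamma>s: "\<gamma> (inf y0 s) \<le> s"
  proof -
    have "\<gamma> (inf y0 s) = lim (\<lambda>n. \<gamma> (inf y0 (q n)))"
      unfolding s_def inf_lim[OF mq] by (rule interval_iso_lim[OF I\<gamma> minf]) simp
    also have "\<dots> \<le> s"
    proof (rule lim_least)
      show "mono (\<lambda>n. \<gamma> (inf y0 (q n)))"
        using minf[of y0] D(5) unfolding mono_def by simp
      have "\<gamma> (inf y0 (q n)) \<le> q (Suc n)" for n unfolding qS Q_def by (simp add: le_supI2)
      then show "\<gamma> (inf y0 (q n)) \<le> s" for n using qs order_trans by blast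
    qed
    finally show ?thesis .
  qed
  have \<gamma>'s: "\<gamma>' (inf d0 s) \<le> s"
  proof -
    have "\<gamma>' (inf d0 s) = lim (\<lambda>n. \<gamma>' (inf d0 (q n)))"
      unfolding s_def inf_lim[OF mq] by (rule interval_iso_lim[OF interval_iso_sym[OF I\<gamma>] minf]) simp
    also have "\<dots> \<le> s"
    proof (rule lim_least)
      show "mono (\<lambda>n. \<gamma>' (inf d0 (q n)))"
        using minf[of d0] D(6) unfolding mono_def by simp
      have "\<gamma>' (inf d0 (q n)) \<le> q (Suc n)" for n unfolding qS Q_def by (simp add: le_supI2)
      then show "\<gamma>' (inf d0 (q n)) \<le> s" for n using qs order_trans by blast
    qed
    finally show ?thesis .
  qed
  have zs: "z0 \<le> s" "z1 \<le> s" using qs[of 0] q0 by auto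
  have spans: "sup y0 s = sup d0 s"
  proof (rule order.antisym)
    have "y0 \<le> sup d0 s" using z0 zs by (metis dsum_sup inf_le2 sup_mono)
    then show "sup y0 s \<le> sup d0 s" by simp
    have "d0 \<le> sup y0 s" using z1 zs by (metis dsum_sup inf_le1 sup_mono)
    then show "sup d0 s \<le> sup y0 s" by simp
  qed
  define x where "x = inf y0 s"
  have xy: "x \<le> y0" "x \<le> s" by (simp_all add: x_def)
  obtain e where e: "dsum x e y0" using dsum_ex[OF xy(1)] .
  have ey: "e \<le> y0" using e dsum_le2 by blast
  have ed: "\<gamma> e \<le> d0" using D(1) ey .
  have es: "inf e s = bot"
    using e ey unfolding x_def dsum_def by (metis inf.absorb1 inf.assoc inf.commute)
  have "inf (\<gamma> e) s = bot"
  proof -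
    have "inf d0 s \<le> d0" by simp
    then have 1: "\<gamma> (\<gamma>' (inf d0 s)) = inf d0 s" by (rule D(4))
    have "inf e (\<gamma>' (inf d0 s)) = bot" using disj_mono[OF es] \<gamma>'s by blast
    then have "inf (\<gamma> e) (inf d0 s) = bot"
      using interval_iso_disj[OF I\<gamma> ey D(3)[OF \<open>inf d0 s \<le> d0\<close>]] 1 by simp
    then show ?thesis using ed by (metis inf.absorb1 inf.assoc)
  qed
  have e_span: "sup e s = sup y0 s"
    using e xy(2) by (metis dsum_sup sup.absorb2 sup.assoc sup.commute)
  have \<gamma>e_span: "sup (\<gamma> e) s = sup d0 s"
  proof -
    have "dsum (\<gamma> x) (\<gamma> e) d0"
      using interval_iso_dsum[OF I\<gamma> e] interval_iso_top[OF I\<gamma>] by simp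
    moreover have "\<gamma> x \<le> s" using \<gamma>s x_def by simp
    ultimately show ?thesis by (metis dsum_sup sup.absorb2 sup.assoc sup.commute)
  qed
  have meet: "inf Y (sup d0 y2) = d0"
    using modl_disj[OF le(2), of y2] disj_mono[OF YC, of Y y2] le(3) by (simp add: ac_simps)
  have kd: "k \<le> sup d0 y2" "\<And>t. sup t k \<le> sup d0 y2 \<or> \<not> t \<le> d0"
    using k(3) by (metis sup.cobounded2, metis k(3) sup_mono order_refl)
  have Yk: "inf Y k = bot"
    by (rule disj_via[of k d0 Y "sup d0 y2", unfolded inf_commute[of k]])
       (use k(1) meet kd in simp_all)
  \<comment> \<open>The axis for \<open>e\<close> and \<open>h (\<gamma> e)\<close> is
    \<open>sup k s\<close>: together with \<open>s\<close>, the elements \<open>e\<close> and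
    \<open>\<gamma> e\<close> have the same span, and \<open>k\<close> leads from
    \<open>\<gamma> e\<close> into \<open>y2\<close>.\<close>
  have 1: "inf e (sup k s) = bot"
  proof -
    have "inf (sup s k) Y = s" using modl_disj[OF sY, of k] Yk by (simp add: inf_commute)
    then show ?thesis
      using disj_via[OF es, of "sup s k" Y] ey le(1) by (simp add: sup_commute)
  qed
  have 2: "inf (h (\<gamma> e)) (sup k s) = bot"
  proof -
    \<comment> \<open>Below \<open>sup d0 y2\<close> the new axis shrinks to \<open>sup k u\<close>.
      Its trace on \<open>y2\<close> is \<open>h u\<close>, which is disjoint from
      \<open>h (\<gamma> e)\<close> because \<open>u\<close> is disjoint from
      \<open>\<gamma> e\<close>.\<close>
    define u where "u = inf d0 s"
    have "inf s (sup d0 y2) = u"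
      unfolding u_def using meet sY by (metis inf.absorb2 inf.assoc inf.commute)
    then have m: "inf (sup k s) (sup d0 y2) = sup k u"
      using modl[OF kd(1), of s] by simp
    have "inf (\<gamma> e) u = bot"
      unfolding u_def using \<open>inf (\<gamma> e) s = bot\<close> disj_mono by (metis inf_le2 order_refl)
    then have "inf (h (\<gamma> e)) (h u) = bot"
      using interval_iso_disj[OF H(1) ed, of u] by (simp add: u_def)
    then have "inf (h (\<gamma> e)) (inf y2 (sup k u)) = bot" by (simp add: h_def ac_simps)
    moreover have hy: "h (\<gamma> e) \<le> y2" by (simp add: h_def)
    ultimately have "inf (h (\<gamma> e)) (sup k u) = bot" by (metis inf.absorb1 inf.assoc)
    then show ?thesis by (rule disj_via[OF _ m]) (use hy in \<open>simp add: le_supI2\<close>)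
  qed
  have 3: "sup e (sup k s) = sup (h (\<gamma> e)) (sup k s)"
  proof -
    have "sup k (h (\<gamma> e)) = sup k (\<gamma> e)"
    proof -
      have "sup k (h (\<gamma> e)) = inf (sup k y2) (sup (\<gamma> e) k)"
        unfolding h_def using modl[of k "sup (\<gamma> e) k" y2] by (simp add: inf_commute)
      also have "\<dots> = sup (\<gamma> e) k"
        using kd(2)[of "\<gamma> e"] ed k(4) by (simp add: sup_commute inf_absorb2)
      finally show ?thesis by (simp add: sup_commute)
    qed
    then have "sup (h (\<gamma> e)) (sup k s) = sup (\<gamma> e) (sup k s)" by (metis sup.assoc sup.commute)
    also have "\<dots> = sup k (sup (\<gamma> e) s)" by (rule sup_left_commute)
    also have "\<dots> = sup k (sup e s)" using \<gamma>e_span e_span spans by simp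
    finally show ?thesis by (simp add: sup_left_commute)
  qed
  have "persp e ((h \<circ> \<gamma>) e)" unfolding persp_def using 1 2 3 by auto
  moreover have "persp x ((h \<circ> \<gamma>) x)"
    using room_transfer[OF YC bY f g h le room_ideal_down[OF YC Hs xy(2)] xy(1)]
    by (simp add: \<gamma>_def)
  moreover have "dsum ((h \<circ> \<gamma>) x) ((h \<circ> \<gamma>) e) y2"
    using interval_iso_dsum[OF I\<theta> e] interval_iso_top[OF I\<theta>] by simp
  ultimately show ?thesis
    using persp_dsum[OF _ _ e] disj_mono[OF YC le(1,3)] by blast
qed

section \<open>Chains of perspectivities between disjoint elements\<close>

lemma persp_trans2:
  assumes "persp (a::'a) b" "persp b c" "inf a c = bot"
  shows "persp a c"
proof -
  \<comment> \<open>A splitting of the middle element induces splittings of both ends, and the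
    results add up because the ends are disjoint. The cases that follow differ only in the position
    of \<open>b\<close> relative to \<open>a\<close> and \<open>c\<close>.\<close>
  have comb: "persp a c"
    if b: "dsum b1 b2 b" and ac: "inf a c = bot" "persp a b" "persp b c"
      and 1: "\<And>a' c'. a' \<le> a \<Longrightarrow> c' \<le> c \<Longrightarrow> persp a' b1 \<Longrightarrow> persp b1 c' \<Longrightarrow> persp a' c'"
      and 2: "\<And>a' c'. a' \<le> a \<Longrightarrow> c' \<le> c \<Longrightarrow> persp a' b2 \<Longrightarrow> persp b2 c' \<Longrightarrow> persp a' c'"
    for a b c b1 b2 :: 'a
  proof -
    obtain a1 a2 where a: "dsum a1 a2 a" "persp b1 a1" "persp b2 a2"
      using persp_split[OF persp_sym[OF ac(2)] b] .
    obtain c1 c2 where c: "dsum c1 c2 c" "persp b1 c1" "persp b2 c2"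
      using persp_split[OF ac(3) b] .
    have "persp a1 c1"
      by (rule 1[OF dsum_le1[OF a(1)] dsum_le1[OF c(1)] persp_sym[OF a(2)] c(2)])
    moreover have "persp a2 c2"
      by (rule 2[OF dsum_le2[OF a(1)] dsum_le2[OF c(1)] persp_sym[OF a(3)] c(3)])
    ultimately show ?thesis by (rule persp_dsum[OF _ _ a(1) c(1) ac(1)])
  qed
  \<comment> \<open>The projections \<open>a2\<close> and \<open>c2\<close> of \<open>b\<close> into
    \<open>a\<close> and \<open>c\<close> are perspective to \<open>b\<close> and to each other.
    They supply the third link required by \<open>persp_through\<close>, which is applied once with
    \<open>a\<close> and once with \<open>c\<close> as the ambient element.\<close>
  have core: "persp a' c'"
    if b: "inf b a = bot" "inf b c = bot" "b \<le> sup a c" and ac: "inf a c = bot"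
      and le: "a' \<le> a" "c' \<le> c" and p: "persp a' b" "persp b c'" for a b c a' c' :: 'a
  proof -
    define a2 c2 where "a2 = inf a (sup b c)" and "c2 = inf c (sup b a)"
    have a2: "sup a2 c = sup b c"
    proof -
      have "sup c (inf a (sup b c)) = inf (sup c a) (sup b c)" by (rule modl) simp
      also have "\<dots> = sup b c" using b(3) by (simp add: inf_absorb2 sup_commute)
      finally show ?thesis unfolding a2_def by (simp add: sup_commute)
    qed
    have c2: "sup c2 a = sup b a"
    proof -
      have "sup a (inf c (sup b a)) = inf (sup a c) (sup b a)" by (rule modl) simp
      also have "\<dots> = sup b a" using b(3) by (simp add: inf_absorb2)
      finally show ?thesis unfolding c2_def by (simp add: sup_commute)
    qed
    have "inf a2 c = bot" "inf c2 a = bot" "inf a2 b = bot" "inf c2 b = bot"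
      using disj_mono[OF ac, of a2 c] disj_mono[OF ac, of a c2] disj_mono[OF b(1), of b a2]
        disj_mono[OF b(2), of b c2] by (simp_all add: a2_def c2_def inf_commute)
    then have ba2: "persp b a2" and bc2: "persp b c2"
      using a2 c2 b unfolding persp_def by metis+
    have "sup a2 b = sup c2 b"
    proof -
      have "sup b a2 = inf (sup b a) (sup b c)" "sup b c2 = inf (sup b c) (sup b a)"
        unfolding a2_def c2_def by (simp_all add: modl)
      then show ?thesis by (simp add: ac_simps)
    qed
    then have "persp a2 c2"
      using \<open>inf a2 b = bot\<close> \<open>inf c2 b = bot\<close> unfolding persp_def by blast
    have 1: "persp a' c2"
      by (rule persp_through[OF ac b(1) le(1) _ _ p(1) ba2 \<open>persp a2 c2\<close>])
         (simp_all add: a2_def c2_def)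
    have ca: "inf c a = bot" using ac by (simp add: inf_commute)
    have "persp c' a'"
      by (rule persp_through[OF ca b(2) le(2) _ le(1) persp_sym[OF p(2)] bc2 persp_sym[OF 1]])
         (simp add: c2_def)
    then show ?thesis by (rule persp_sym)
  qed
  have s3: "persp a c"
    if b: "inf b a = bot" "inf b c = bot" and ac: "inf a c = bot" "persp a b" "persp b c" for a b c :: 'a
  proof -
    obtain b2 where b2: "dsum (inf b (sup a c)) b2 b" using dsum_ex[of "inf b (sup a c)" b] by auto
    have le: "b2 \<le> b" using b2 dsum_le2 by blast
    have d: "inf b2 (sup a c) = bot"
      using b2 le unfolding dsum_def by (metis inf.absorb1 inf.assoc inf.commute)
    show ?thesis
    proof (rule comb[OF b2 ac])
      fix a' c' assume *: "a' \<le> a" "c' \<le> c"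
      show "persp a' c'" if p: "persp a' (inf b (sup a c))" "persp (inf b (sup a c)) c'"
        by (rule core[OF _ _ _ ac(1) * p]) (use b disj_mono in \<open>auto intro: disj_mono[of b]\<close>)
      show "persp a' c'" if p: "persp a' b2" "persp b2 c'"
      proof (rule persp_trans_disj[OF p])
        have "inf (sup c' a') b2 = bot"
          using disj_mono[OF d, of b2 "sup c' a'"] * by (simp add: inf_commute le_supI1 le_supI2)
        moreover have "inf a' c' = bot" using disj_mono[OF ac(1) *] .
        ultimately show "inf a' (sup b2 c') = bot"
          using disj_sup_left[of a' c' b2] by (simp add: ac_simps)
      qed
    qed
  qed
  have s2: "persp a c"
    if b: "inf b a = bot" and ac: "inf a c = bot" "persp a b" "persp b c" for a b c :: 'a
  proof -
    obtain b2 where b2: "dsum (inf b c) b2 b" using dsum_ex[of "inf b c" b] by auto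
    have le: "b2 \<le> b" using b2 dsum_le2 by blast
    have d: "inf b2 c = bot"
      using b2 le unfolding dsum_def by (metis inf.absorb1 inf.assoc inf.commute)
    show ?thesis
    proof (rule comb[OF b2 ac])
      fix a' c' assume *: "a' \<le> a" "c' \<le> c"
      show "persp a' c'" if p: "persp a' (inf b c)" "persp (inf b c) c'"
        by (rule persp_trans_disj[OF p]) (use disj_mono[OF ac(1)] * in simp)
      show "persp a' c'" if p: "persp a' b2" "persp b2 c'"
        by (rule s3[OF _ _ _ p]) (use disj_mono[OF b le] disj_mono[OF d] disj_mono[OF ac(1)] * in auto)
    qed
  qed
  obtain b2 where b2: "dsum (inf b a) b2 b" using dsum_ex[of "inf b a" b] by auto
  have le: "b2 \<le> b" using b2 dsum_le2 by blast
  have d: "inf b2 a = bot"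
    using b2 le unfolding dsum_def by (metis inf.absorb1 inf.assoc inf.commute)
  show ?thesis
  proof (rule comb[OF b2 assms(3,1,2)])
    fix a' c' assume *: "a' \<le> a" "c' \<le> c"
    show "persp a' c'" if p: "persp a' (inf b a)" "persp (inf b a) c'"
      by (rule persp_trans_disj'[OF p]) (use disj_mono[OF assms(3), of "sup a' (inf b a)" c'] * in \<open>simp add: inf_commute\<close>)
    show "persp a' c'" if p: "persp a' b2" "persp b2 c'"
      by (rule s2[OF _ _ p]) (use disj_mono[OF d] disj_mono[OF assms(3)] * in auto)
  qed
qed

lemma relpowp_persp_split:
  assumes "(persp ^^ n) x y" "dsum x1 x2 (x::'a)"
  obtains y1 y2 where "dsum y1 y2 y" "(persp ^^ n) x1 y1" "(persp ^^ n) x2 y2"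
proof -
  have "\<exists>y1 y2. dsum y1 y2 y \<and> (persp ^^ n) x1 y1 \<and> (persp ^^ n) x2 y2"
    using assms
  proof (induction n arbitrary: y)
    case 0 then show ?case by auto
  next
    case (Suc n)
    obtain z where z: "(persp ^^ n) x z" "persp z y" using Suc(2) by auto
    obtain z1 z2 where "dsum z1 z2 z" "(persp ^^ n) x1 z1" "(persp ^^ n) x2 z2"
      using Suc(1)[OF z(1) Suc(3)] by blast
    then show ?case using persp_split[OF z(2)] by (metis relpowp_Suc_I)
  qed
  then show ?thesis using that by blast
qed

text \<open>A piece of \<open>b\<close> inside \<open>a\<close> is disjoint from \<open>c\<close>,
  and a piece of \<open>d\<close> outside \<open>a\<close> is disjoint from \<open>a\<close>; in
  both cases composing two links at a time suffices. What remains has its middle pieces outside and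
  inside \<open>a\<close> respectively, as in \<open>persp_through\<close>.\<close>

lemma persp_trans3:
  assumes p: "persp (a::'a) b" "persp b d" "persp d c" and ac: "inf a c = bot"
  shows "persp a c"
proof -
  obtain b2 where b2: "dsum (inf b a) b2 b" using dsum_ex[of "inf b a" b] by auto
  have b2a: "inf b2 a = bot"
    using b2 dsum_le2[OF b2] unfolding dsum_def by (metis inf.absorb1 inf.assoc inf.commute)
  obtain a1 a2 where a: "dsum a1 a2 a" "persp (inf b a) a1" "persp b2 a2"
    using persp_split[OF persp_sym[OF p(1)] b2] .
  obtain d1 d2 where d: "dsum d1 d2 d" "persp (inf b a) d1" "persp b2 d2"
    using persp_split[OF p(2) b2] .
  obtain c1 c2 where c: "dsum c1 c2 c" "persp d1 c1" "persp d2 c2"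
    using persp_split[OF p(3) d(1)] .
  note le = dsum_le1[OF a(1)] dsum_le2[OF a(1)] dsum_le1[OF c(1)] dsum_le2[OF c(1)]
  have "persp (inf b a) c1"
    using persp_trans2[OF d(2) c(2)] disj_mono[OF ac] le by simp
  then have 1: "persp a1 c1"
    using persp_trans2[OF persp_sym[OF a(2)]] disj_mono[OF ac] le by simp
  obtain d4 where d4: "dsum (inf d2 a) d4 d2" using dsum_ex[of "inf d2 a" d2] by auto
  have d4a: "inf d4 a = bot"
    using d4 dsum_le2[OF d4] unfolding dsum_def by (metis inf.absorb1 inf.assoc inf.commute)
  obtain b3 b4 where b: "dsum b3 b4 b2" "persp (inf d2 a) b3" "persp d4 b4"
    using persp_split[OF persp_sym[OF d(3)] d4] .
  obtain a3 a4 where a': "dsum a3 a4 a2" "persp b3 a3" "persp b4 a4"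
    using persp_split[OF a(3) b(1)] .
  obtain c3 c4 where c': "dsum c3 c4 c2" "persp (inf d2 a) c3" "persp d4 c4"
    using persp_split[OF c(3) d4] .
  have le': "a3 \<le> a" "a4 \<le> a" "c3 \<le> c" "c4 \<le> c" "b3 \<le> b2"
    using a' c' b le dsum_le1 dsum_le2 order_trans by blast+
  have "inf b3 a = bot" using disj_mono[OF b2a] le' by simp
  then have "persp a3 c3"
    using persp_through[OF ac _ le'(1) _ le'(3) persp_sym[OF a'(2)] persp_sym[OF b(2)] c'(2)] by simp
  moreover have "persp a4 c4"
  proof -
    have "persp a4 d4"
      using persp_trans2[OF persp_sym[OF a'(3)] persp_sym[OF b(3)]]
        disj_mono[OF d4a, of d4 a4] le' by (simp add: inf_commute)
    then show ?thesis using persp_trans2[OF _ c'(3)] disj_mono[OF ac] le' by simp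
  qed
  ultimately have "persp a2 c2"
    using persp_dsum[OF _ _ a'(1) c'(1)] disj_mono[OF ac] le by simp
  then show ?thesis using persp_dsum[OF 1 _ a(1) c(1) ac] by blast
qed

text \<open>In a long chain the third element \<open>d\<close> is split by \<open>c\<close>. The
  part inside \<open>c\<close> is disjoint from \<open>a\<close>, so the first two links merge. The
  part outside \<open>c\<close> is perspective to its partner by induction, which leaves three
  links.\<close>

lemma relpowp_persp_disj:
  assumes "(persp ^^ n) (a::'a) c" "inf a c = bot"
  shows "persp a c"
  using assms
proof (induction n arbitrary: a c rule: less_induct)
  case (less n)
  consider "n = 0" | "n = 1" | "n = 2" | m where "n = Suc (Suc (Suc m))"
    by (metis One_nat_def Suc_1 not0_implies_Suc)
  then show ?case
  proof cases
    case 1 then show ?thesis using less(2) by simp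
  next
    case 2 then show ?thesis using less(2) by (metis One_nat_def relpowp_1)
  next
    case 3
    then show ?thesis using less(2) persp_trans2 less(3) by (auto simp: numeral_2_eq_2)
  next
    case 4
    obtain b d where bd: "persp a b" "persp b d" "(persp ^^ Suc m) d c"
      using less(2) 4 by (metis relpowp_Suc_D2)
    obtain d2 where d2: "dsum (inf d c) d2 d" using dsum_ex[of "inf d c" d] by auto
    have d2c: "inf d2 c = bot"
      using d2 dsum_le2[OF d2] unfolding dsum_def by (metis inf.absorb1 inf.assoc inf.commute)
    obtain c1 c2 where c: "dsum c1 c2 c" "(persp ^^ Suc m) (inf d c) c1" "(persp ^^ Suc m) d2 c2"
      using relpowp_persp_split[OF bd(3) d2] .
    obtain b1 b2 where b: "dsum b1 b2 b" "persp (inf d c) b1" "persp d2 b2"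
      using persp_split[OF persp_sym[OF bd(2)] d2] .
    obtain a1 a2 where a: "dsum a1 a2 a" "persp b1 a1" "persp b2 a2"
      using persp_split[OF persp_sym[OF bd(1)] b(1)] .
    note le = dsum_le1[OF a(1)] dsum_le2[OF a(1)] dsum_le1[OF c(1)] dsum_le2[OF c(1)]
    have "persp a1 (inf d c)"
      using persp_trans2[OF persp_sym[OF a(2)] persp_sym[OF b(2)]] disj_mono[OF less(3)] le by simp
    then have "(persp ^^ Suc (Suc m)) a1 c1" using c(2) by (rule relpowp_Suc_I2)
    then have 1: "persp a1 c1" using less(1)[of "Suc (Suc m)"] 4 disj_mono[OF less(3)] le by simp
    have "persp d2 c2" using less(1)[of "Suc m" d2 c2] 4 c(3) disj_mono[OF d2c] le by simp
    then have "persp a2 c2"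
      using persp_trans3[OF persp_sym[OF a(3)] persp_sym[OF b(3)]] disj_mono[OF less(3)] le by simp
    then show ?thesis using persp_dsum[OF 1 _ a(1) c(1) less(3)] by blast
  qed
qed

end

section \<open>Equality and refinement in the dimension monoid\<close>

text \<open>Chains form the base case because transitivity of perspectivity is available only for
  disjoint ends. The relation turns out to be equality of dimensions.\<close>

inductive equidecomposable :: "'a::bounded_lattice_bot \<Rightarrow> 'a \<Rightarrow> bool" where
  equidecomposable_chain: "persp\<^sup>*\<^sup>* x y \<Longrightarrow> equidecomposable x y"
| equidecomposable_dsum: "equidecomposable x1 y1 \<Longrightarrow> equidecomposable x2 y2 \<Longrightarrow>
    dsum x1 x2 x \<Longrightarrow> dsum y1 y2 y \<Longrightarrow> equidecomposable x y"

lemma equidecomposable_refl [simp]: "equidecomposable x x"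
  by (rule equidecomposable_chain) simp

lemma equidecomposable_persp: "persp x y \<Longrightarrow> equidecomposable x y"
  by (rule equidecomposable_chain) simp

lemma rtranclp_persp_sym:
  assumes "persp\<^sup>*\<^sup>* x y" shows "persp\<^sup>*\<^sup>* y x"
  using assms
proof (induction rule: rtranclp_induct)
  case (step y z)
  then show ?case by (blast intro: converse_rtranclp_into_rtranclp persp_sym)
qed simp

lemma equidecomposable_sym: "equidecomposable x y \<Longrightarrow> equidecomposable y x"
proof (induction rule: equidecomposable.induct)
  case (equidecomposable_chain x y)
  then show ?case by (blast intro: equidecomposable.equidecomposable_chain rtranclp_persp_sym)
qed (rule equidecomposable.equidecomposable_dsum)

lemma persp_bot_iff: "persp x y \<Longrightarrow> x = bot \<longleftrightarrow> y = bot"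
  using persp_bot by metis

lemma equidecomposable_bot:
  "equidecomposable x y \<Longrightarrow> x = bot \<longleftrightarrow> y = bot"
proof (induction rule: equidecomposable.induct)
  case (equidecomposable_chain x y)
  then show ?case by (induction rule: rtranclp_induct) (simp_all add: persp_bot_iff)
qed (auto simp: dsum_def)

lemma persp_Delta: "persp x y \<Longrightarrow> \<Delta>\<^sub>0 x = \<Delta>\<^sub>0 y"
  unfolding persp_def using Delta_D2 by (metis inf_commute sup_commute)

lemma Delta_dsum:
  assumes "dsum x y z" shows "\<Delta>\<^sub>0 z = \<Delta>\<^sub>0 x + \<Delta>\<^sub>0 y"
proof -
  have "\<Delta> bot z = \<Delta> bot x + \<Delta> x z" using assms by (intro Delta_D1 dsum_le1[of x y]) simp_all
  also have "\<Delta> x z = \<Delta> bot y" using Delta_D2[of x y] assms by (simp add: dsum_def)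
  finally show ?thesis .
qed

lemma Delta_compl: "dsum a x b \<Longrightarrow> \<Delta> a b = \<Delta>\<^sub>0 x"
  using Delta_D2[of a x] by (simp add: dsum_def)

lemma bounds_Interval [simp]:
  "a \<le> b \<Longrightarrow> lower (Interval (a, b)) = a" "a \<le> b \<Longrightarrow> upper (Interval (a, b)) = b"
  by (simp_all add: lower.rep_eq upper.rep_eq Interval_inverse)

lemma Interval_bounds: "Interval (lower i, upper i) = i"
  by (simp add: interval_eq_iff)

lemma abs_dim_add_mset: "abs_dim (add_mset i M) = \<Delta> (lower i) (upper i) + abs_dim M"
  by (simp add: Delta.abs_eq plus_dim.abs_eq Interval_bounds)

lemma abs_dim_empty: "abs_dim {#} = 0"
  by (simp add: zero_dim_def)

lemma abs_dim_exhaust: obtains M where "x = abs_dim M"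
  by (metis Quotient_abs_rep Quotient_dim)

context scm_lattice
begin

text \<open>The overlap \<open>y\<close> of \<open>d\<close> and \<open>q\<close> is kept. With
  \<open>s = sup d q\<close>, the elements \<open>w\<close> and \<open>w'\<close> are complements of
  \<open>d\<close> in \<open>s\<close>, \<open>x\<close> and \<open>x'\<close> are complements of
  \<open>q\<close> in \<open>s\<close>, and \<open>z\<close> and \<open>z'\<close> are complements
  of \<open>s\<close> in \<open>a\<close>; complements of the same element are perspective.\<close>

lemma dsum_refine:
  assumes "dsum p d (a::'a)" "dsum q r a"
  obtains w z y x w' z' y' x' where
    "dsum w z p" "dsum y x d" "dsum w' y' q" "dsum z' x' r"
    "persp w w'" "persp z z'" "persp y y'" "persp x x'"
proof -
  define s y where "s = sup d q" and "y = inf q d"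
  obtain w' where w': "dsum y w' q" using dsum_ex[of y q] by (auto simp: y_def)
  obtain x where x: "dsum y x d" using dsum_ex[of y d] by (auto simp: y_def)
  define w where "w = inf p s"
  define x' where "x' = inf r s"
  obtain z where z: "dsum w z p" using dsum_ex[of w p] by (auto simp: w_def)
  obtain z' where z': "dsum x' z' r" using dsum_ex[of x' r] by (auto simp: x'_def)
  have sa: "s \<le> a" "d \<le> s" "q \<le> s"
    using assms by (auto simp: s_def dsum_le1 dsum_le2)
  have A: "dsum u (inf t s) s" if "dsum u t a" "u \<le> s" for u t
    unfolding dsum_def
  proof
    show "inf u (inf t s) = bot" using disj_mono[OF dsum_inf[OF that(1)]] by simp
    show "sup u (inf t s) = s"
      unfolding modl[OF that(2)] using dsum_sup[OF that(1)] sa(1) by (simp add: inf_absorb2)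
  qed
  have A: "dsum d w s" "dsum q x' s"
    unfolding w_def x'_def using A dsum_commute assms sa by blast+
  have "inf d w' = inf w' (inf q d)"
    using dsum_le2[OF w'] by (metis inf.absorb1 inf.assoc inf.commute)
  then have "dsum d w' s"
    using w' x unfolding y_def s_def dsum_def by (metis inf.commute sup.assoc sup.commute sup_inf_absorb)
  moreover have "inf q x = inf x (inf q d)"
    using dsum_le2[OF x] by (metis inf.absorb1 inf.assoc inf.commute)
  then have "dsum q x s"
    using w' x unfolding y_def s_def dsum_def by (metis inf.commute sup.assoc sup.commute sup_inf_absorb)
  ultimately have 1: "persp w w'" "persp x x'"
    using A persp_compl_mod by blast+
  have "dsum s z a"
    using dsum_assoc(2)[of z w p d a] z A(1) assms(1) dsum_commute
    by (metis dsum_sup sup_commute)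
  moreover have "dsum s z' a"
    using dsum_assoc(2)[of z' x' r q a] z' A(2) assms(2) dsum_commute
    by (metis dsum_sup sup_commute)
  ultimately have "persp z z'" by (rule persp_compl_mod)
  then show ?thesis
    using that[OF z x dsum_commute[OF w'] dsum_commute[OF z'] 1(1) _ persp_refl 1(2)] by blast
qed

lemma rtranclp_persp_split:
  assumes "persp\<^sup>*\<^sup>* x y" "dsum x1 x2 (x::'a)"
  obtains y1 y2 where "dsum y1 y2 y" "persp\<^sup>*\<^sup>* x1 y1" "persp\<^sup>*\<^sup>* x2 y2"
proof -
  have "\<exists>y1 y2. dsum y1 y2 y \<and> persp\<^sup>*\<^sup>* x1 y1 \<and> persp\<^sup>*\<^sup>* x2 y2"
    using assms(1)
  proof (induction rule: rtranclp_induct)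
    case (step y z)
    then show ?case using persp_split by (metis rtranclp.rtrancl_into_rtrancl)
  qed (use assms in blast)
  then show ?thesis using that by blast
qed

lemma equidecomposable_chain_left:
  assumes "equidecomposable x y" "persp\<^sup>*\<^sup>* (u::'a) x"
  shows "equidecomposable u y"
  using assms
proof (induction arbitrary: u rule: equidecomposable.induct)
  case (equidecomposable_chain x y)
  then show ?case by (meson equidecomposable.equidecomposable_chain rtranclp_trans)
next
  case (equidecomposable_dsum x1 y1 x2 y2 x y)
  obtain u1 u2 where "dsum u1 u2 u" "persp\<^sup>*\<^sup>* x1 u1" "persp\<^sup>*\<^sup>* x2 u2"
    using rtranclp_persp_split[OF rtranclp_persp_sym[OF equidecomposable_dsum(7)] equidecomposable_dsum(3)] .
  then show ?case
    using equidecomposable_dsum(4-6) rtranclp_persp_sym equidecomposable.equidecomposable_dsum by blast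
qed

text \<open>The given sum is refined against the sum that built \<open>x\<close>, and the induction
  hypotheses carry the pieces over. Transitivity rests on this.\<close>

lemma equidecomposable_split:
  assumes "equidecomposable x y" "dsum x1 x2 (x::'a)"
  obtains y1 y2 where "dsum y1 y2 y" "equidecomposable x1 y1" "equidecomposable x2 y2"
proof -
  have "\<exists>y1 y2. dsum y1 y2 y \<and> equidecomposable x1 y1 \<and> equidecomposable x2 y2"
    using assms
  proof (induction arbitrary: x1 x2 rule: equidecomposable.induct)
    case (equidecomposable_chain x y)
    then show ?case
      using rtranclp_persp_split equidecomposable.equidecomposable_chain by metis
  next
    case (equidecomposable_dsum u u' v v' x y)
    obtain w z t s w' z' t' s' where r: "dsum w z x1" "dsum t s x2" "dsum w' t' u" "dsum z' s' v"
      "persp w w'" "persp z z'" "persp t t'" "persp s s'"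
      using dsum_refine[OF equidecomposable_dsum(7) equidecomposable_dsum(3)] .
    obtain w2 t2 where u: "dsum w2 t2 u'" "equidecomposable w' w2" "equidecomposable t' t2"
      using equidecomposable_dsum(5)[OF r(3)] by blast
    obtain z2 s2 where v: "dsum z2 s2 v'" "equidecomposable z' z2" "equidecomposable s' s2"
      using equidecomposable_dsum(6)[OF r(4)] by blast
    note I = dsum_interchange[OF u(1) v(1) equidecomposable_dsum(4)]
    have "equidecomposable w w2" "equidecomposable z z2" "equidecomposable t t2" "equidecomposable s s2"
      using r(5-8) u(2,3) v(2,3) equidecomposable_chain_left by blast+
    then have "equidecomposable x1 (sup w2 z2)" "equidecomposable x2 (sup t2 s2)"
      using equidecomposable.equidecomposable_dsum r(1,2) I(2,3) by blast+
    then show ?case using I(1) by blast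
  qed
  then show ?thesis using that by blast
qed

lemma equidecomposable_trans:
  assumes "equidecomposable x y" "equidecomposable y (z::'a)"
  shows "equidecomposable x z"
  using assms
proof (induction arbitrary: z rule: equidecomposable.induct)
  case (equidecomposable_chain x y)
  then show ?case using equidecomposable_chain_left by blast
next
  case (equidecomposable_dsum x1 y1 x2 y2 x y)
  obtain z1 z2 where "dsum z1 z2 z" "equidecomposable y1 z1" "equidecomposable y2 z2"
    using equidecomposable_split[OF equidecomposable_dsum(7,4)] .
  then show ?case
    using equidecomposable_dsum(3,5,6) equidecomposable.equidecomposable_dsum by blast
qed

section \<open>An invariant separating the dimensions of lattice elements\<close>

definition dsum_set :: "'a set \<Rightarrow> 'a set \<Rightarrow> 'a set" where
  "dsum_set A B = {z. \<exists>x\<in>A. \<exists>y\<in>B. dsum x y z}"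

definition compl_class :: "'a interval \<Rightarrow> 'a set" where
  "compl_class i = {y. \<exists>c. dsum (lower i) c (upper i) \<and> equidecomposable c y}"

text \<open>The elements of \<open>L\<close> that realize the whole multiset as a direct sum. The
  set may be empty, as the pieces need not fit side by side in \<open>L\<close>.\<close>

definition class_of :: "'a interval multiset \<Rightarrow> 'a set" where
  "class_of M = comm_monoid_mset.F dsum_set {bot} (image_mset compl_class M)"

lemma comm_monoid_mset_dsum_set: "comm_monoid_mset dsum_set {bot}"
proof
  fix A B C :: "'a set"
  have le: "dsum_set (dsum_set A B) C \<subseteq> dsum_set A (dsum_set B C)" for A B C
    unfolding dsum_set_def using dsum_assoc by blast
  have comm: "dsum_set A B = dsum_set B A" for A B
    unfolding dsum_set_def using dsum_commute by blast
  show "dsum_set A B = dsum_set B A" by (rule comm)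
  show "dsum_set (dsum_set A B) C = dsum_set A (dsum_set B C)"
    using le[of A B C] le[of C B A] comm by (metis subset_antisym)
  show "dsum_set A {bot} = A" by (simp add: dsum_set_def)
qed

lemma class_of_union: "class_of (M + N) = dsum_set (class_of M) (class_of N)"
  and class_of_empty: "class_of {#} = {bot}"
  and class_of_single: "class_of {#i#} = compl_class i"
  and class_of_add_mset: "class_of (add_mset i M) = dsum_set (compl_class i) (class_of M)"
proof -
  interpret comm_monoid_mset dsum_set "{bot}" by (rule comm_monoid_mset_dsum_set)
  show "class_of (M + N) = dsum_set (class_of M) (class_of N)" "class_of {#} = {bot}"
    "class_of {#i#} = compl_class i"
    "class_of (add_mset i M) = dsum_set (compl_class i) (class_of M)"
    by (simp_all add: class_of_def)
qed

lemma compl_class_Interval: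
  assumes "dsum a c b"
  shows "compl_class (Interval (a, b)) = {y. equidecomposable c y}"
proof -
  have "equidecomposable c y" if "dsum a c' b" "equidecomposable c' y" for c' y
    using that equidecomposable_trans equidecomposable_persp persp_compl_mod[OF assms that(1)]
    by blast
  then show ?thesis
    using assms dsum_le1[OF assms] unfolding compl_class_def by auto
qed

text \<open>For \<open>D1\<close> the splitting property of equidecomposability is needed; for
  \<open>D2\<close> a single element is a complement in both transposed intervals.\<close>

lemma dim_cong_class_of: "dim_cong M N \<Longrightarrow> class_of M = class_of N"
proof (induction rule: dim_cong.induct)
  case (D0 a)
  have "compl_class (Interval (a, a)) = {bot}"
    using compl_class_Interval[of a bot a] equidecomposable_bot[of bot] by auto
  then show ?case by (simp add: class_of_single class_of_empty)
next
  case (D1 a b c)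
  obtain u where u: "dsum a u b" using dsum_ex[OF D1(1)] .
  obtain v where v: "dsum b v c" using dsum_ex[OF D1(2)] .
  have uv: "dsum u v (sup u v)" "dsum a (sup u v) c" using dsum_assoc[OF u v] .
  have "equidecomposable (sup u v) y \<longleftrightarrow>
      (\<exists>y1 y2. equidecomposable u y1 \<and> equidecomposable v y2 \<and> dsum y1 y2 y)" for y
    using equidecomposable_split[OF _ uv(1)] equidecomposable_dsum[OF _ _ uv(1)] by metis
  then show ?case
    using compl_class_Interval[OF u] compl_class_Interval[OF v] compl_class_Interval[OF uv(2)]
      class_of_union[of "{#_#}" "{#_#}"]
    by (auto simp: class_of_single class_of_add_mset class_of_empty dsum_set_def)
next
  case (D2 a b)
  obtain c where c: "dsum (inf a b) c b" using dsum_ex[of "inf a b" b] by auto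
  have "inf a c = inf (inf a b) c" using dsum_le2[OF c] by (simp add: inf_absorb2 inf_assoc)
  moreover have "sup a c = sup a b" using c by (metis dsum_sup sup.assoc sup_inf_absorb)
  ultimately have "dsum a c (sup a b)" using c by (simp add: dsum_def)
  then show ?case using compl_class_Interval c by (simp add: class_of_single)
qed (simp_all add: class_of_union)

lemma Delta_eq_equidecomposable:
  assumes "\<Delta>\<^sub>0 x = \<Delta>\<^sub>0 (y::'a)" shows "equidecomposable x y"
proof -
  have "dim_cong {#Interval (bot, x)#} {#Interval (bot, y)#}"
    using assms by (simp add: Delta.abs_eq dim.abs_eq_iff)
  then have "{u. equidecomposable x u} = {u. equidecomposable y u}"
    using dim_cong_class_of compl_class_Interval[of bot x x] compl_class_Interval[of bot y y]
    by (metis class_of_single dsum_bot_left)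
  then show ?thesis using equidecomposable_sym by fastforce
qed

text \<open>The ways of splitting an element of the dimension monoid by splitting each interval of a
  representing multiset. Independence of the representative is the refinement property.\<close>

definition splittings :: "'a interval multiset \<Rightarrow> ('a dim \<times> 'a dim) set" where
  "splittings M = (\<Sum>i\<in>#M. {(\<Delta> (lower i) t, \<Delta> t (upper i)) |t. lower i \<le> t \<and> t \<le> upper i})"

text \<open>A cut \<open>s\<close> of the long interval gives the cuts \<open>inf s b\<close> and
  \<open>sup s b\<close> of its two halves, with dimensions matched by \<open>Delta_D2\<close>.
  Conversely, cuts \<open>t\<close> and \<open>t'\<close> come from a relative complement of
  \<open>b\<close> between \<open>t\<close> and \<open>t'\<close>.\<close>

lemma splittings_D1:
  assumes "(a::'a) \<le> b" "b \<le> c"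
  shows "{(\<Delta> a t, \<Delta> t c) |t. a \<le> t \<and> t \<le> c} =
    {(\<Delta> a t, \<Delta> t b) |t. a \<le> t \<and> t \<le> b} + {(\<Delta> b t, \<Delta> t c) |t. b \<le> t \<and> t \<le> c}"
proof -
  have key: "\<Delta> a s = \<Delta> a (inf s b) + \<Delta> b (sup s b)" "\<Delta> s c = \<Delta> (inf s b) b + \<Delta> (sup s b) c"
    if "a \<le> s" "s \<le> c" for s
  proof -
    have "\<Delta> a s = \<Delta> a (inf s b) + \<Delta> (inf s b) s" using that assms by (intro Delta_D1) auto
    also have "\<Delta> (inf s b) s = \<Delta> b (sup s b)"
      using Delta_D2[of b s] by (simp add: inf_commute sup_commute)
    finally show "\<Delta> a s = \<Delta> a (inf s b) + \<Delta> b (sup s b)" .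
    have "\<Delta> s c = \<Delta> s (sup s b) + \<Delta> (sup s b) c" using that assms by (intro Delta_D1) auto
    then show "\<Delta> s c = \<Delta> (inf s b) b + \<Delta> (sup s b) c" by (simp add: Delta_D2)
  qed
  show ?thesis
  proof (intro set_eqI iffI)
    fix p assume "p \<in> {(\<Delta> a t, \<Delta> t c) |t. a \<le> t \<and> t \<le> c}"
    then obtain s where s: "p = (\<Delta> a s, \<Delta> s c)" "a \<le> s" "s \<le> c" by blast
    have p: "p = (\<Delta> a (inf s b), \<Delta> (inf s b) b) + (\<Delta> b (sup s b), \<Delta> (sup s b) c)"
      using s key by simp
    show "p \<in> {(\<Delta> a t, \<Delta> t b) |t. a \<le> t \<and> t \<le> b} + {(\<Delta> b t, \<Delta> t c) |t. b \<le> t \<and> t \<le> c}"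
      unfolding p by (rule set_plus_intro) (use s assms in auto)
  next
    fix p assume "p \<in> {(\<Delta> a t, \<Delta> t b) |t. a \<le> t \<and> t \<le> b} + {(\<Delta> b t, \<Delta> t c) |t. b \<le> t \<and> t \<le> c}"
    then obtain t t' where t: "p = (\<Delta> a t, \<Delta> t b) + (\<Delta> b t', \<Delta> t' c)" "a \<le> t" "t \<le> b" "b \<le> t'" "t' \<le> c"
      by (auto elim!: set_plus_elim)
    obtain s where s: "inf b s = t" "sup b s = t'" "t \<le> s" "s \<le> t'"
      using relcompl_ex[OF t(3,4)] .
    have "p = (\<Delta> a s, \<Delta> s c)"
      using key[of s] s t by (simp add: inf_commute sup_commute order_trans[OF t(2)] order_trans[OF _ t(5)])
    then show "p \<in> {(\<Delta> a t, \<Delta> t c) |t. a \<le> t \<and> t \<le> c}"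
      using s t order_trans by blast
  qed
qed

text \<open>Joining with \<open>a\<close> and meeting with \<open>b\<close> are inverse isomorphisms
  between the transposed intervals, and they preserve the dimensions of the two sides of a
  cut.\<close>

lemma splittings_D2:
  "{(\<Delta> a t, \<Delta> t (sup a b)) |t. a \<le> t \<and> t \<le> sup a b} =
    {(\<Delta> (inf a b) t, \<Delta> t b) |t. inf a b \<le> t \<and> t \<le> (b::'a)}"
proof -
  have key: "(\<Delta> a (sup a t), \<Delta> (sup a t) (sup a b)) = (\<Delta> (inf a b) t, \<Delta> t b)"
    if "inf a b \<le> t" "t \<le> b" for t
  proof -
    have "inf a t = inf a b"
      using that by (metis inf.absorb2 inf.assoc inf.commute inf.orderE inf_le1 le_inf_iff order.antisym)
    moreover have "sup (sup a t) b = sup a b" using that by (simp add: sup_assoc sup_absorb2)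
    moreover have "inf (sup a t) b = t"
      using modl[OF that(2), of a] that by (simp add: sup_commute sup_absorb1)
    ultimately show ?thesis using Delta_D2[of a t] Delta_D2[of "sup a t" b] by simp
  qed
  have inv: "sup a (inf t b) = t" "inf a b \<le> inf t b" if "a \<le> t" "t \<le> sup a b" for t
  proof -
    have "sup a (inf b t) = inf (sup a b) t" by (rule modl[OF that(1)])
    then show "sup a (inf t b) = t" using that(2) by (simp add: inf_commute inf_absorb1)
    show "inf a b \<le> inf t b" using that(1) by (rule inf_mono) simp
  qed
  show ?thesis
  proof (intro set_eqI iffI)
    fix p assume "p \<in> {(\<Delta> a t, \<Delta> t (sup a b)) |t. a \<le> t \<and> t \<le> sup a b}"
    then obtain t where t: "p = (\<Delta> a t, \<Delta> t (sup a b))" "a \<le> t" "t \<le> sup a b" by blast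
    then have "p = (\<Delta> (inf a b) (inf t b), \<Delta> (inf t b) b)"
      using key[of "inf t b"] inv[of t] by simp
    then show "p \<in> {(\<Delta> (inf a b) t, \<Delta> t b) |t. inf a b \<le> t \<and> t \<le> b}"
      using inv[OF t(2,3)] by auto
  next
    fix p assume "p \<in> {(\<Delta> (inf a b) t, \<Delta> t b) |t. inf a b \<le> t \<and> t \<le> b}"
    then obtain t where t: "p = (\<Delta> (inf a b) t, \<Delta> t b)" "inf a b \<le> t" "t \<le> b" by blast
    then have "p = (\<Delta> a (sup a t), \<Delta> (sup a t) (sup a b))" using key by simp
    moreover have "a \<le> sup a t" "sup a t \<le> sup a b" using t(3) by (simp_all add: le_supI2)
    ultimately show "p \<in> {(\<Delta> a t, \<Delta> t (sup a b)) |t. a \<le> t \<and> t \<le> sup a b}" by blast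
  qed
qed

lemma dim_cong_splittings: "dim_cong M N \<Longrightarrow> splittings M = splittings N"
proof (induction rule: dim_cong.induct)
  case (D0 a)
  have "{(\<Delta> a t, \<Delta> t a) |t. a \<le> t \<and> t \<le> a} = 0"
    by (auto simp: Delta_D0 set_zero zero_prod_def dest: order.antisym intro!: exI[of _ a])
  then show ?case by (simp add: splittings_def)
next
  case (D1 a b c)
  then show ?case using splittings_D1[OF D1] by (simp add: splittings_def order_trans[OF D1])
next
  case (D2 a b)
  then show ?case using splittings_D2[of a b] by (simp add: splittings_def)
qed (simp_all add: splittings_def)

lemma splittings_sum: "(u, v) \<in> splittings M \<Longrightarrow> abs_dim M = u + v"
proof (induction M arbitrary: u v)
  case empty
  then show ?case by (simp add: splittings_def set_zero zero_prod_def abs_dim_empty)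
next
  case (add i M)
  then obtain t p where t: "lower i \<le> t" "t \<le> upper i" "p \<in> splittings M"
    "(u, v) = (\<Delta> (lower i) t, \<Delta> t (upper i)) + p"
    by (auto simp: splittings_def elim!: set_plus_elim)
  then have "abs_dim M = fst p + snd p" using add(1)[of "fst p" "snd p"] by simp
  then show ?case
    using t Delta_D1[OF t(1,2)] by (auto simp: abs_dim_add_mset ac_simps plus_prod_def)
qed

lemma splittings_trivial: "(abs_dim M, 0) \<in> splittings M" "(0, abs_dim M) \<in> splittings M"
proof (induction M)
  case empty
  show "(abs_dim {#}, 0) \<in> splittings {#}" "(0, abs_dim {#}) \<in> splittings {#}"
    by (simp_all add: splittings_def set_zero zero_prod_def abs_dim_empty)
next
  case (add i M)
  have S: "splittings (add_mset i M) =
      {(\<Delta> (lower i) t, \<Delta> t (upper i)) |t. lower i \<le> t \<and> t \<le> upper i} + splittings M"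
    by (simp add: splittings_def)
  have "(\<Delta> (lower i) (upper i), \<Delta> (upper i) (upper i)) + (abs_dim M, 0) \<in> splittings (add_mset i M)"
    "(\<Delta> (lower i) (lower i), \<Delta> (lower i) (upper i)) + (0, abs_dim M) \<in> splittings (add_mset i M)"
    unfolding S by (intro set_plus_intro add; use lower_le_upper[of i] in auto)+
  then show "(abs_dim (add_mset i M), 0) \<in> splittings (add_mset i M)"
    "(0, abs_dim (add_mset i M)) \<in> splittings (add_mset i M)"
    by (simp_all add: abs_dim_add_mset Delta_D0)
qed

lemma splittings_union: "splittings (M + N) = splittings M + splittings N"
  by (simp add: splittings_def)

lemma splittings_both: "(abs_dim M, abs_dim N) \<in> splittings (M + N)"
  unfolding splittings_union
  using set_plus_intro[OF splittings_trivial(1)[of M] splittings_trivial(2)[of N]] by simp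

text \<open>The pair \<open>(c, d)\<close> is a splitting of every multiset that represents
  \<open>c + d\<close>, in particular of \<open>A + B\<close>, whose splittings are sums of
  splittings of \<open>A\<close> and of \<open>B\<close>.\<close>

lemma dim_refinement:
  fixes a b c d :: "'a dim"
  assumes "a + b = c + d"
  obtains c1 c2 d1 d2 where "a = c1 + d1" "b = c2 + d2" "c = c1 + c2" "d = d1 + d2"
proof -
  obtain A B C D where M: "a = abs_dim A" "b = abs_dim B" "c = abs_dim C" "d = abs_dim D"
    by (metis abs_dim_exhaust)
  have "dim_cong (C + D) (A + B)"
    using assms unfolding M plus_dim.abs_eq dim.abs_eq_iff by (rule dim_cong.sym)
  then have "(c, d) \<in> splittings A + splittings B"
    using dim_cong_splittings splittings_both splittings_union M by metis
  then obtain p q where pq: "(c, d) = p + q" "p \<in> splittings A" "q \<in> splittings B"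
    by (rule set_plus_elim)
  then show ?thesis
    using that[of "fst p" "snd p" "fst q" "snd q"]
      splittings_sum[of "fst p" "snd p"] splittings_sum[of "fst q" "snd q"] M
    by (auto simp: plus_prod_def)
qed

text \<open>A splitting of a multiset with a single interval is an actual cut of \<open>x\<close>.
  Summands in \<open>Dim L\<close> can thus be realized by parts of \<open>x\<close>.\<close>

lemma Delta_split:
  assumes "\<Delta>\<^sub>0 x = b + c"
  obtains y z where "dsum y z (x::'a)" "\<Delta>\<^sub>0 y = b" "\<Delta>\<^sub>0 z = c"
proof -
  obtain B C where M: "b = abs_dim B" "c = abs_dim C" by (metis abs_dim_exhaust)
  have "dim_cong (B + C) {#Interval (bot, x)#}"
    using assms unfolding M plus_dim.abs_eq Delta.abs_eq dim.abs_eq_iff by (rule dim_cong.sym)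
  then have "(b, c) \<in> splittings {#Interval (bot, x)#}"
    using dim_cong_splittings splittings_both M by metis
  then obtain t where t: "b = \<Delta> bot t" "c = \<Delta> t x" "t \<le> x" by (auto simp: splittings_def)
  obtain z where z: "dsum t z x" using dsum_ex[OF t(3)] .
  show ?thesis using that[OF z] t Delta_compl[OF z] by simp
qed

lemma Delta_eq_0: "\<Delta>\<^sub>0 x = 0 \<longleftrightarrow> x = (bot::'a)"
proof
  assume "\<Delta>\<^sub>0 x = 0"
  then have "\<Delta>\<^sub>0 bot = \<Delta>\<^sub>0 x" by (simp add: Delta_D0)
  then show "x = bot" using Delta_eq_equidecomposable equidecomposable_bot by blast
qed (simp add: Delta_D0)

lemma Delta_modular:
  assumes "(s::'a) \<le> s'"
  shows "\<Delta> s s' = \<Delta> (inf d s) (inf d s') + \<Delta> (sup d s) (sup d s')"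
proof -
  define m where "m = sup s (inf d s')"
  have m: "m = inf (sup s d) s'" unfolding m_def by (rule modl[OF assms])
  have "s \<le> m" "m \<le> s'" by (simp_all add: m_def assms)
  then have "\<Delta> s s' = \<Delta> s m + \<Delta> m s'" by (rule Delta_D1)
  also have "\<Delta> s m = \<Delta> (inf s (inf d s')) (inf d s')" unfolding m_def by (rule Delta_D2)
  also have "inf s (inf d s') = inf d s" using assms by (metis inf.absorb1 inf.left_commute)
  also have "\<Delta> m s' = \<Delta> (sup d s) (sup (sup d s) s')" unfolding m sup_commute[of s d] by (rule Delta_D2[symmetric])
  also have "sup (sup d s) s' = sup d s'" using assms by (simp add: sup_assoc sup_absorb2)
  finally show ?thesis .
qed

end

context mc_lattice
begin

lemma equidecomposable_disj:
  assumes "equidecomposable x y" "inf x (y::'a) = bot"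
  shows "persp x y"
  using assms
proof (induction rule: equidecomposable.induct)
  case (equidecomposable_chain x y)
  then show ?case by (metis relpowp_persp_disj rtranclp_power)
next
  case (equidecomposable_dsum x1 y1 x2 y2 x y)
  have "inf x1 y1 = bot" "inf x2 y2 = bot"
    using equidecomposable_dsum(3,4,7) disj_mono dsum_le1 dsum_le2 by metis+
  then show ?case using equidecomposable_dsum persp_dsum by blast
qed

lemma Delta_eq_disj: "\<Delta>\<^sub>0 x = \<Delta>\<^sub>0 y \<Longrightarrow> inf x (y::'a) = bot \<Longrightarrow> persp x y"
  by (rule equidecomposable_disj[OF Delta_eq_equidecomposable])

section \<open>Countable additivity of the dimension\<close>

definition countably_equidecomposable :: "'a \<Rightarrow> 'a \<Rightarrow> bool" where
  "countably_equidecomposable a b \<longleftrightarrow> (\<exists>x y. independent x \<and> independent y \<and>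
    (\<forall>n. \<Delta>\<^sub>0 (x n) = \<Delta>\<^sub>0 (y n)) \<and> osum x = a \<and> osum y = b)"

lemma countably_equidecomposable_sym:
  "countably_equidecomposable a b \<Longrightarrow> countably_equidecomposable b a"
  unfolding countably_equidecomposable_def by metis

lemma Delta_osum_disj:
  assumes "independent x" "independent y" "\<And>n. \<Delta>\<^sub>0 (x n) = \<Delta>\<^sub>0 (y n)"
    "inf (osum x) (osum y) = (bot::'a)"
  shows "\<Delta>\<^sub>0 (osum x) = \<Delta>\<^sub>0 (osum y)"
proof -
  have "persp (x n) (y n)" for n
    using Delta_eq_disj[OF assms(3)] disj_mono[OF assms(4)] le_osum by blast
  then show ?thesis using persp_osum[OF assms(1,2) _ assms(4)] persp_Delta by blast
qed

lemma countably_equidecomposable_disj: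
  "countably_equidecomposable a b \<Longrightarrow> inf a b = bot \<Longrightarrow> \<Delta>\<^sub>0 a = \<Delta>\<^sub>0 b"
  unfolding countably_equidecomposable_def using Delta_osum_disj by blast

lemma countably_equidecomposable_persp:
  assumes "persp u a" "countably_equidecomposable a b"
  shows "countably_equidecomposable u b"
proof -
  obtain x y where xy: "independent x" "independent y" "\<And>n. \<Delta>\<^sub>0 (x n) = \<Delta>\<^sub>0 (y n)" "osum x = a" "osum y = b"
    using assms(2) unfolding countably_equidecomposable_def by blast
  obtain f g where fg: "persp_iso a u f g" using persp_iso_ex[OF persp_sym[OF assms(1)]] .
  note I = interval_iso_osum[OF persp_isoD(1)[OF fg] xy(1,4)]
  have "\<Delta>\<^sub>0 (f (x n)) = \<Delta>\<^sub>0 (y n)" for n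
    using persp_Delta[OF persp_isoD(2)[OF fg, of "x n"]] le_osum xy(3,4) by metis
  then show ?thesis unfolding countably_equidecomposable_def using I xy by blast
qed

lemma Delta_compl_part:
  assumes "dsum p d (b::'a)" "d \<le> x" "x \<le> x'" "x' \<le> b"
  shows "\<Delta> x x' = \<Delta> (inf p x) (inf p x')"
proof -
  have "sup d (inf p x') = inf (sup d p) x'" using assms by (intro modl) auto
  then have "sup d (inf p x') = x'"
    using dsum_sup[OF assms(1)] assms(4) by (simp add: inf_absorb2 sup_commute)
  moreover have "sup d (inf p x') \<le> sup x (inf p x')" using assms(2) by (intro sup_mono order_refl)
  ultimately have "sup x (inf p x') = x'"
    using assms(3) by (intro order.antisym) auto
  moreover have "inf x (inf p x') = inf p x"
    using assms(3) by (metis inf.absorb1 inf.left_commute)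
  ultimately show ?thesis using Delta_D2[of x "inf p x'"] by simp
qed

text \<open>The partial joins are traced on \<open>d\<close> and, after \<open>d\<close> has been
  added, on \<open>p\<close>. The trace on \<open>p\<close> is \<open>inf p (sup d (s n))\<close>
  and not \<open>inf p (s n)\<close>, so that by \<open>Delta_modular\<close> the two increments
  together account for all of \<open>b n\<close>.\<close>

lemma osum_refine:
  assumes "independent b" "dsum p d (osum b :: 'a)"
  obtains x y where "independent x" "independent y" "osum x = p" "osum y = d"
    "\<And>n. \<Delta>\<^sub>0 (b n) = \<Delta>\<^sub>0 (x n) + \<Delta>\<^sub>0 (y n)"
proof -
  define s where "s = partial_join b"
  have ms: "mono s" unfolding s_def by (rule mono_partial_join)
  have lims: "lim s = osum b" by (simp add: s_def osum_def)
  have s0: "s 0 = bot" by (simp add: s_def)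
  have sS: "s n \<le> s (Suc n)" for n using ms by (simp add: monoD)
  define t where "t n = inf d (s n)" for n
  define v where "v n = inf p (sup d (s n))" for n
  have "t n \<le> t (Suc n)" "v n \<le> v (Suc n)" for n
    unfolding t_def v_def by (intro inf_mono sup_mono order_refl sS)+
  then have "\<exists>y. dsum (t n) y (t (Suc n))" "\<exists>x. dsum (v n) x (v (Suc n))" for n
    using dsum_ex by blast+
  then obtain y x where y: "\<And>n. dsum (t n) (y n) (t (Suc n))" and x: "\<And>n. dsum (v n) (x n) (v (Suc n))"
    by metis
  have t0: "t 0 = bot" and v0: "v 0 = bot"
    using dsum_inf[OF assms(2)] by (simp_all add: t_def v_def s0)
  note T = increments[OF t0 y] and V = increments[OF v0 x]
  have "lim t = d"
    using inf_lim[OF ms, of d] dsum_le2[OF assms(2)] by (simp add: t_def[abs_def] lims inf_absorb1)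
  moreover have "lim v = p"
  proof -
    have m: "mono (\<lambda>n. sup d (s n))" using ms by (auto simp: mono_def intro: le_supI2)
    have "lim (\<lambda>n. sup d (s n)) = osum b"
      using sup_lim[of "\<lambda>n. d", OF _ ms] dsum_le2[OF assms(2)]
      by (simp add: lims mono_def sup_absorb2)
    then show ?thesis
      using inf_lim[OF m, of p] dsum_le1[OF assms(2)] by (simp add: v_def[abs_def] inf_absorb1)
  qed
  moreover have "\<Delta>\<^sub>0 (b n) = \<Delta>\<^sub>0 (x n) + \<Delta>\<^sub>0 (y n)" for n
  proof -
    have "\<Delta>\<^sub>0 (b n) = \<Delta> (s n) (s (Suc n))"
      using Delta_compl[OF independent_dsum[OF assms(1)]] unfolding s_def by simp
    also have "\<dots> = \<Delta> (t n) (t (Suc n)) + \<Delta> (sup d (s n)) (sup d (s (Suc n)))"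
      unfolding t_def by (rule Delta_modular[OF sS])
    also have "\<Delta> (sup d (s n)) (sup d (s (Suc n))) = \<Delta> (v n) (v (Suc n))"
      unfolding v_def
      using partial_join_le_osum dsum_le2[OF assms(2)] sS[of n]
      by (intro Delta_compl_part[OF assms(2)] sup_mono) (auto simp: s_def simp del: partial_join.simps)
    finally show ?thesis
      using Delta_compl[OF y] Delta_compl[OF x] by (simp add: add.commute)
  qed
  ultimately show ?thesis using that T(1,3) V(1,3) by metis
qed

lemma countably_equidecomposable_split:
  assumes "countably_equidecomposable a b" "dsum p d b"
  obtains u v where "dsum u v a" "countably_equidecomposable u p" "countably_equidecomposable v d"
proof -
  obtain x y where xy: "independent x" "independent y" "\<And>n. \<Delta>\<^sub>0 (x n) = \<Delta>\<^sub>0 (y n)" "osum x = a" "osum y = b"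
    using assms(1) unfolding countably_equidecomposable_def by blast
  obtain p' d' where r: "independent p'" "independent d'" "osum p' = p" "osum d' = d"
    "\<And>n. \<Delta>\<^sub>0 (y n) = \<Delta>\<^sub>0 (p' n) + \<Delta>\<^sub>0 (d' n)"
    using osum_refine[OF xy(2)] assms(2) xy(5) by blast
  have "\<exists>u v. dsum u v (x n) \<and> \<Delta>\<^sub>0 u = \<Delta>\<^sub>0 (p' n) \<and> \<Delta>\<^sub>0 v = \<Delta>\<^sub>0 (d' n)" for n
    using Delta_split[of "x n"] xy(3) r(5) by metis
  then obtain u v where uv: "\<And>n. dsum (u n) (v n) (x n)" "\<And>n. \<Delta>\<^sub>0 (u n) = \<Delta>\<^sub>0 (p' n)"
    "\<And>n. \<Delta>\<^sub>0 (v n) = \<Delta>\<^sub>0 (d' n)" by metis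
  note O = osum_split[OF xy(1) uv(1)]
  show ?thesis
    using that[of "osum u" "osum v"] O xy(4) r uv(2,3)
    unfolding countably_equidecomposable_def by blast
qed

section \<open>Comparison of countably equidecomposable elements\<close>

lemma disj_compls:
  assumes "dsum p (inf x y) (x::'a)" "dsum q (inf x y) y"
  shows "inf p q = bot"
proof -
  have "inf p q \<le> inf p (inf x y)"
    using dsum_le1[OF assms(1)] dsum_le1[OF assms(2)] by (simp add: le_infI1 le_infI2)
  then show ?thesis using dsum_inf[OF assms(1)] by (simp add: bot.extremum_uniqueI)
qed

text \<open>One round of comparing \<open>x\<close> with \<open>x'\<close>: the parts \<open>w, z\<close> of \<open>x\<close> and \<open>w', y'\<close> of \<open>x'\<close> outside
  the meet are matched with \<open>w'\<close>, \<open>z'\<close>, \<open>w\<close> and \<open>y\<close>; the parts \<open>x1\<close> and \<open>x1'\<close> of the meet remain.\<close>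

definition matching ::
    "'a \<Rightarrow> 'a \<Rightarrow> 'a \<times> 'a \<times> 'a \<times> 'a \<times> 'a \<times> 'a \<Rightarrow> 'a \<Rightarrow> 'a \<Rightarrow> bool" where
  "matching x x' = (\<lambda>(w, z, w', y', y, z') x1 x1'.
    dsum w z (sup w z) \<and> dsum (sup w z) (inf x x') x \<and>
    dsum w' y' (sup w' y') \<and> dsum (sup w' y') (inf x x') x' \<and>
    dsum y x1 (inf x x') \<and> dsum z' x1' (inf x x') \<and>
    \<Delta>\<^sub>0 w = \<Delta>\<^sub>0 w' \<and> \<Delta>\<^sub>0 z = \<Delta>\<^sub>0 z' \<and> \<Delta>\<^sub>0 y = \<Delta>\<^sub>0 y')"

text \<open>The decomposition of \<open>x\<close> by the meet is refined against the one transported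
  from \<open>x'\<close>. Three of the four resulting pairs have disjoint members and hence equal
  dimensions; the fourth lies inside the meet and is left for the next round.\<close>

lemma matching_ex:
  assumes "countably_equidecomposable x x'"
  obtains q x1 x1' where "matching x x' q x1 x1'" "countably_equidecomposable x1 x1'"
proof -
  define d where "d = inf x x'"
  have "d \<le> x" "d \<le> x'" by (simp_all add: d_def)
  then obtain p p' where p: "dsum p d x" and p': "dsum p' d x'"
    using dsum_ex dsum_commute by metis
  obtain a1 a2 where a: "dsum a1 a2 x" "countably_equidecomposable a1 p'" "countably_equidecomposable a2 d"
    using countably_equidecomposable_split[OF assms p'] .
  obtain w z y x1 w0 z0 y0 x0 where r: "dsum w z p" "dsum y x1 d" "dsum w0 y0 a1" "dsum z0 x0 a2"
    "persp w w0" "persp z z0" "persp y y0" "persp x1 x0"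
    using dsum_refine[OF p a(1)] .
  obtain w' y' where 1: "dsum w' y' p'" "countably_equidecomposable w' w0" "countably_equidecomposable y' y0"
    using countably_equidecomposable_split[OF countably_equidecomposable_sym[OF a(2)] r(3)] .
  obtain z' x1' where 2: "dsum z' x1' d" "countably_equidecomposable z' z0" "countably_equidecomposable x1' x0"
    using countably_equidecomposable_split[OF countably_equidecomposable_sym[OF a(3)] r(4)] .
  have eq: "countably_equidecomposable w w'" "countably_equidecomposable z z'"
    "countably_equidecomposable y y'" "countably_equidecomposable x1 x1'"
    using countably_equidecomposable_persp countably_equidecomposable_sym r(5-8) 1(2,3) 2(2,3) by blast+
  have dj: "inf p p' = bot" "inf p d = bot" "inf d p' = bot"
    using disj_compls[OF p[unfolded d_def] p'[unfolded d_def]] dsum_inf[OF p]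
      dsum_inf[OF dsum_commute[OF p']] .
  have le: "w \<le> p" "z \<le> p" "y \<le> d" "w' \<le> p'" "y' \<le> p'" "z' \<le> d"
    using r 1 2 dsum_le1 dsum_le2 by blast+
  have "\<Delta>\<^sub>0 w = \<Delta>\<^sub>0 w'" "\<Delta>\<^sub>0 z = \<Delta>\<^sub>0 z'" "\<Delta>\<^sub>0 y = \<Delta>\<^sub>0 y'"
    using countably_equidecomposable_disj[OF eq(1) disj_mono[OF dj(1) le(1,4)]]
      countably_equidecomposable_disj[OF eq(2) disj_mono[OF dj(2) le(2,6)]]
      countably_equidecomposable_disj[OF eq(3) disj_mono[OF dj(3) le(3,5)]] .
  then have "matching x x' (w, z, w', y', y, z') x1 x1'"
    unfolding matching_def prod.case d_def[symmetric] dsum_sup[OF r(1)] dsum_sup[OF 1(1)]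
    by (intro conjI r(1,2) 1(1) 2(1) p p')
  then show ?thesis using that eq(4) by blast
qed

text \<open>A term of \<open>x\<close> and its partner in \<open>y\<close> lie in neighbouring terms
  of \<open>t\<close>. Separating the indices by parity puts them into opposite halves of
  \<open>t\<close>, which are disjoint.\<close>

lemma Delta_osum_shifted:
  assumes t: "independent (t :: nat \<Rightarrow> 'a)" and x: "\<And>n. x n \<le> t (Suc n)" and y: "\<And>n. y n \<le> t n"
    and eq: "\<And>n. \<Delta>\<^sub>0 (x n) = \<Delta>\<^sub>0 (y n)"
  shows "\<Delta>\<^sub>0 (osum x) = \<Delta>\<^sub>0 (osum y)"
proof -
  have ix: "independent x" using independent_mono[OF osum_shift(1)[OF t] x] .
  have iy: "independent y" using independent_mono[OF t y] .
  define part where "part u b n = (if even n = b then u n else bot)" for u :: "nat \<Rightarrow> 'a" and b n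
  have split: "dsum (part u True n) (part u False n) (u n)" for u n
    by (simp add: part_def)
  note X = osum_split[of x "part x True" "part x False", OF ix split]
    and Y = osum_split[of y "part y True" "part y False", OF iy split]
    and T = osum_split[of t "part t True" "part t False", OF t split]
  have "\<Delta>\<^sub>0 (osum (part x b)) = \<Delta>\<^sub>0 (osum (part y b))" for b
  proof (rule Delta_osum_disj)
    show "independent (part x b)" "independent (part y b)"
      using X(1,2) Y(1,2) by (cases b; simp)+
    show "\<Delta>\<^sub>0 (part x b n) = \<Delta>\<^sub>0 (part y b n)" for n
      by (simp add: part_def eq)
    have "inf (osum (part t (\<not> b))) (osum (part t b)) = bot"
      using dsum_inf[OF T(3)] by (cases b) (simp_all add: inf_commute)
    moreover have "osum (part x b) \<le> osum (part t (\<not> b))"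
    proof (rule osum_least)
      fix n
      have "part x b n \<le> part t (\<not> b) (Suc n)" using x[of n] by (auto simp: part_def)
      then show "part x b n \<le> osum (part t (\<not> b))" using le_osum order_trans by blast
    qed
    moreover have "osum (part y b) \<le> osum (part t b)"
      by (rule osum_mono) (use y in \<open>auto simp: part_def\<close>)
    ultimately show "inf (osum (part x b)) (osum (part y b)) = bot" using disj_mono by blast
  qed
  then show ?thesis using Delta_dsum[OF X(3)] Delta_dsum[OF Y(3)] by simp
qed

text \<open>Iterate \<open>matching\<close>. The meets \<open>d n\<close> decrease, and the complement \<open>f\<close> of the sum of their
  differences \<open>t n\<close> in \<open>d 0\<close> is common to both sides, so that only the matched pieces have to be
  compared. Those that may meet their partners are compared after a shift by one index, which makes
  the even and the odd terms disjoint from their partners.\<close>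

lemma countably_equidecomposable_Delta:
  assumes "countably_equidecomposable a b"
  shows "\<Delta>\<^sub>0 a = \<Delta>\<^sub>0 b"
proof -
  have "\<exists>S. S 0 = (a, b) \<and> (\<forall>n. countably_equidecomposable (fst (S n)) (snd (S n)) \<and>
      (\<exists>q. matching (fst (S n)) (snd (S n)) q (fst (S (Suc n))) (snd (S (Suc n)))))"
  proof -
    define P where "P = (\<lambda>(n::nat) s. countably_equidecomposable (fst s) (snd s) \<and> (n = 0 \<longrightarrow> s = (a, b)))"
    have "\<exists>S. \<forall>n. P n (S n) \<and>
        (\<exists>q. matching (fst (S n)) (snd (S n)) q (fst (S (Suc n))) (snd (S (Suc n))))"
    proof (rule dependent_nat_choice)
      show "\<exists>s. P 0 s" using assms by (auto simp: P_def)
      fix s n assume "P n s"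
      then show "\<exists>s'. P (Suc n) s' \<and> (\<exists>q. matching (fst s) (snd s) q (fst s') (snd s'))"
        using matching_ex[of "fst s" "snd s"] unfolding P_def by (metis fst_conv snd_conv nat.simps(3))
    qed
    then show ?thesis unfolding P_def by blast
  qed
  then obtain S where S: "S 0 = (a, b)"
    "\<And>n. \<exists>q. matching (fst (S n)) (snd (S n)) q (fst (S (Suc n))) (snd (S (Suc n)))" by blast
  define x x' where "x n = fst (S n)" and "x' n = snd (S n)" for n
  obtain q where q: "\<And>n. matching (x n) (x' n) (q n) (x (Suc n)) (x' (Suc n))"
    using S(2) unfolding x_def x'_def by metis
  define w z w' y' y z' where "w n = fst (q n)" and "z n = fst (snd (q n))"
    and "w' n = fst (snd (snd (q n)))" and "y' n = fst (snd (snd (snd (q n))))"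
    and "y n = fst (snd (snd (snd (snd (q n)))))" and "z' n = snd (snd (snd (snd (snd (q n)))))" for n
  define d where "d n = inf (x n) (x' n)" for n
  define p p' where "p n = sup (w n) (z n)" and "p' n = sup (w' n) (y' n)" for n
  have M: "dsum (w n) (z n) (p n)" "dsum (p n) (d n) (x n)" "dsum (w' n) (y' n) (p' n)"
    "dsum (p' n) (d n) (x' n)" "dsum (y n) (x (Suc n)) (d n)" "dsum (z' n) (x' (Suc n)) (d n)"
    "\<Delta>\<^sub>0 (w n) = \<Delta>\<^sub>0 (w' n)" "\<Delta>\<^sub>0 (z n) = \<Delta>\<^sub>0 (z' n)" "\<Delta>\<^sub>0 (y n) = \<Delta>\<^sub>0 (y' n)" for n
    using q[of n] unfolding matching_def d_def p_def p'_def w_def z_def w'_def y'_def y_def z'_def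
    by (auto simp: case_prod_beta)
  have "sup (x (Suc n)) (x' (Suc n)) \<le> d n" for n
    using dsum_le2[OF M(5)] dsum_le2[OF M(6)] by simp
  then have "\<exists>v. dsum (sup (x (Suc n)) (x' (Suc n))) v (d n)" for n
    using dsum_ex by blast
  then obtain u where u: "\<And>n. dsum (sup (x (Suc n)) (x' (Suc n))) (u n) (d n)" by metis
  have join: "dsum (x n) (p' n) (sup (x n) (x' n))" "dsum (x' n) (p n) (sup (x n) (x' n))" for n
  proof -
    have "inf (x n) (p' n) = inf (p' n) (inf (x n) (x' n))"
      using dsum_le1[OF M(4)[of n]] by (metis inf.absorb1 inf.commute inf.left_commute)
    then have "inf (x n) (p' n) = bot" using dsum_inf[OF M(4)] by (simp add: d_def)
    moreover have "sup (x n) (p' n) = sup (x n) (x' n)"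
      using M(4)[of n] unfolding d_def dsum_def by (metis sup.assoc sup.commute sup_inf_absorb)
    ultimately show "dsum (x n) (p' n) (sup (x n) (x' n))" by (simp add: dsum_def)
    have "inf (x' n) (p n) = inf (p n) (inf (x n) (x' n))"
      using dsum_le1[OF M(2)[of n]] by (metis inf.absorb1 inf.commute inf.left_commute)
    then have "inf (x' n) (p n) = bot" using dsum_inf[OF M(2)] by (simp add: d_def)
    moreover have "sup (x' n) (p n) = sup (x n) (x' n)"
      using M(2)[of n] unfolding d_def dsum_def
      by (metis sup.assoc sup.commute sup_inf_absorb inf.commute)
    ultimately show "dsum (x' n) (p n) (sup (x n) (x' n))" by (simp add: dsum_def)
  qed
  \<comment> \<open>\<open>Y n\<close> and \<open>y n\<close> both complement
    \<open>x (Suc n)\<close> in \<open>d n\<close>, so \<open>Y n\<close> has the dimension of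
    \<open>y' n\<close>; in the same way \<open>Z n\<close> has the dimension of \<open>z n\<close>.
    Using one \<open>u n\<close> for both yields two decompositions of the same
    \<open>t n\<close>.\<close>
  define Y where "Y n = sup (p' (Suc n)) (u n)" for n
  define Z where "Z n = sup (p (Suc n)) (u n)" for n
  have Y: "dsum (p' (Suc n)) (u n) (Y n)" "dsum (x (Suc n)) (Y n) (d n)" for n
    using dsum_assoc[OF join(1) u] unfolding Y_def by blast+
  have Z: "dsum (p (Suc n)) (u n) (Z n)" "dsum (x' (Suc n)) (Z n) (d n)" for n
    using dsum_assoc[OF join(2) u] unfolding Z_def by blast+
  have DY: "\<Delta>\<^sub>0 (Y n) = \<Delta>\<^sub>0 (y' n)" and DZ: "\<Delta>\<^sub>0 (Z n) = \<Delta>\<^sub>0 (z n)" for n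
    using persp_Delta[OF persp_compl_mod[OF Y(2) dsum_commute[OF M(5)]]]
      persp_Delta[OF persp_compl_mod[OF Z(2) dsum_commute[OF M(6)]]] M(8,9) by simp_all
  define t where "t n = sup (p (Suc n)) (Y n)" for n
  have tY: "dsum (p (Suc n)) (Y n) (t n)" "dsum (t n) (d (Suc n)) (d n)" for n
    using dsum_assoc[OF dsum_commute[OF M(2)[of "Suc n"]] Y(2)] dsum_commute
    unfolding t_def by blast+
  have "t n = sup (p' (Suc n)) (Z n)" for n by (simp add: t_def Y_def Z_def sup_left_commute)
  then have tZ: "dsum (p' (Suc n)) (Z n) (t n)" for n
    using dsum_assoc(1)[OF dsum_commute[OF M(4)[of "Suc n"]] Z(2)] by simp
  note T = decrements[of t d, OF tY(2)]
  obtain f where f: "dsum (osum t) f (d 0)" using dsum_ex[OF T(3)] .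
  note OP = osum_split[of t "\<lambda>n. p (Suc n)" Y, OF T(1) tY(1)]
    and OP' = osum_split[of t "\<lambda>n. p' (Suc n)" Z, OF T(1) tZ]
  note W = osum_split[of "\<lambda>n. p (Suc n)" "\<lambda>n. w (Suc n)" "\<lambda>n. z (Suc n)", OF OP(1) M(1)]
    and W' = osum_split[of "\<lambda>n. p' (Suc n)" "\<lambda>n. w' (Suc n)" "\<lambda>n. y' (Suc n)", OF OP'(1) M(3)]
  have le: "w (Suc n) \<le> p (Suc n)" "w' (Suc n) \<le> p' (Suc n)" "p (Suc n) \<le> t n" "p' (Suc n) \<le> t n"
    "z (Suc n) \<le> t n" "y' (Suc n) \<le> t n" "Y n \<le> t n" "Z n \<le> t n" for n
    using M(1,3)[of "Suc n"] tY(1)[of n] tZ[of n] dsum_le1 dsum_le2 order_trans by meson+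
  have w: "\<Delta>\<^sub>0 (osum (\<lambda>n. w (Suc n))) = \<Delta>\<^sub>0 (osum (\<lambda>n. w' (Suc n)))"
  proof (rule Delta_osum_disj[OF W(1) W'(1) M(7)])
    \<comment> \<open>Thus the join of the \<open>w' (Suc n)\<close> lies in the part of
      \<open>osum t\<close> complementary to the join of the \<open>p (Suc n)\<close>.\<close>
    have "osum (\<lambda>n. p' (Suc n)) \<le> osum Y" by (rule osum_mono) (use Y dsum_le1 in blast)
    then have "osum (\<lambda>n. w' (Suc n)) \<le> osum Y"
      using dsum_le1[OF W'(3)] order_trans by blast
    then show "inf (osum (\<lambda>n. w (Suc n))) (osum (\<lambda>n. w' (Suc n))) = bot"
      using disj_mono[OF dsum_inf[OF OP(3)]] dsum_le1[OF W(3)] by blast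
  qed
  \<comment> \<open>\<open>Y (Suc n)\<close> lies in \<open>t (Suc n)\<close> and its partner
    \<open>y' (Suc n)\<close> in \<open>t n\<close>. The comparison starts at index 1, so
    \<open>Y 0\<close> and \<open>Z 0\<close> are split off below.\<close>
  have SY: "\<Delta>\<^sub>0 (osum (\<lambda>n. Y (Suc n))) = \<Delta>\<^sub>0 (osum (\<lambda>n. y' (Suc n)))"
    by (rule Delta_osum_shifted[OF T(1)]) (rule le DY)+
  have SZ: "\<Delta>\<^sub>0 (osum (\<lambda>n. Z (Suc n))) = \<Delta>\<^sub>0 (osum (\<lambda>n. z (Suc n)))"
    by (rule Delta_osum_shifted[OF T(1)]) (rule le DZ)+
  note [simp] = w SY SZ DY DZ
  have D1: "\<Delta>\<^sub>0 (osum t) = \<Delta>\<^sub>0 (osum (\<lambda>n. w' (Suc n))) + \<Delta>\<^sub>0 (osum (\<lambda>n. z (Suc n)))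
      + (\<Delta>\<^sub>0 (y' 0) + \<Delta>\<^sub>0 (osum (\<lambda>n. y' (Suc n))))"
    using Delta_dsum[OF OP(3)] Delta_dsum[OF W(3)] Delta_dsum[OF osum_shift(2)[OF OP(2)]] by simp
  have D2: "\<Delta>\<^sub>0 (osum t) = \<Delta>\<^sub>0 (osum (\<lambda>n. w' (Suc n))) + \<Delta>\<^sub>0 (osum (\<lambda>n. y' (Suc n)))
      + (\<Delta>\<^sub>0 (z 0) + \<Delta>\<^sub>0 (osum (\<lambda>n. z (Suc n))))"
    using Delta_dsum[OF OP'(3)] Delta_dsum[OF W'(3)] Delta_dsum[OF osum_shift(2)[OF OP'(2)]] by simp
  have "\<Delta>\<^sub>0 a = \<Delta>\<^sub>0 (w 0) + \<Delta>\<^sub>0 (z 0) + (\<Delta>\<^sub>0 (osum t) + \<Delta>\<^sub>0 f)"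
    using Delta_dsum[OF M(2)[of 0]] Delta_dsum[OF M(1)[of 0]] Delta_dsum[OF f] S(1)
    by (simp add: x_def)
  also have "\<dots> = \<Delta>\<^sub>0 (w' 0) + \<Delta>\<^sub>0 (y' 0) + (\<Delta>\<^sub>0 (osum t) + \<Delta>\<^sub>0 f)"
  proof -
    \<comment> \<open>No cancellation is involved: \<open>D1\<close> supplies a summand with
      \<open>y' 0\<close> and \<open>D2\<close> one with \<open>z 0\<close>, so that both sides
      become the same sum.\<close>
    have "\<Delta>\<^sub>0 (z 0) + \<Delta>\<^sub>0 (osum t) = \<Delta>\<^sub>0 (y' 0) + \<Delta>\<^sub>0 (osum t)"
      by (subst D1, subst D2) (simp only: ac_simps)
    then have "\<Delta>\<^sub>0 (z 0) + (\<Delta>\<^sub>0 (osum t) + \<Delta>\<^sub>0 f) = \<Delta>\<^sub>0 (y' 0) + (\<Delta>\<^sub>0 (osum t) + \<Delta>\<^sub>0 f)"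
      by (simp only: add.assoc[symmetric])
    then show ?thesis by (simp only: M(7) add.assoc)
  qed
  also have "\<dots> = \<Delta>\<^sub>0 b"
    using Delta_dsum[OF M(4)[of 0]] Delta_dsum[OF M(3)[of 0]] Delta_dsum[OF f] S(1)
    by (simp add: x'_def)
  finally show ?thesis .
qed

lemma Delta_osum_cong:
  assumes "independent x" "independent y" "\<And>n. \<Delta>\<^sub>0 (x n) = \<Delta>\<^sub>0 (y n)"
  shows "\<Delta>\<^sub>0 (osum x) = \<Delta>\<^sub>0 (osum y :: 'a)"
  by (rule countably_equidecomposable_Delta)
     (use assms in \<open>auto simp: countably_equidecomposable_def\<close>)

section \<open>Countable sums in the dimension monoid\<close>

lemma dim_conical:
  assumes "a + b = (0 :: 'a dim)" shows "a = 0"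
proof -
  have "\<Delta>\<^sub>0 (bot::'a) = a + b" by (simp add: assms Delta_D0)
  then obtain y z :: 'a where "dsum y z bot" "\<Delta>\<^sub>0 y = a" using Delta_split by blast
  then show ?thesis using dsum_le1 by (metis Delta_D0 bot.extremum_uniqueI)
qed

lemma dim_representation:
  "\<exists>(k::nat) x. a = (\<Sum>i<k. \<Delta>\<^sub>0 (x i :: 'a))"
proof -
  have "\<exists>(k::nat) x. abs_dim M = (\<Sum>i<k. \<Delta>\<^sub>0 (x i :: 'a))" for M
  proof (induction M)
    case empty
    then show ?case by (intro exI[of _ 0]) (simp add: abs_dim_empty)
  next
    case (add i M)
    then obtain k :: nat and x where kx: "abs_dim M = (\<Sum>i<k. \<Delta>\<^sub>0 (x i :: 'a))" by blast
    obtain c where c: "dsum (lower i) c (upper i)" using dsum_ex[OF lower_le_upper] .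
    have "(\<Sum>i<Suc k. \<Delta>\<^sub>0 ((x(k := c)) i)) = (\<Sum>i<k. \<Delta>\<^sub>0 (x i)) + \<Delta>\<^sub>0 c"
      by (simp cong: sum.cong_simp)
    then show ?case
      using kx Delta_compl[OF c] by (metis abs_dim_add_mset add.commute)
  qed
  then show ?thesis using abs_dim_exhaust[of a] by metis
qed

lemma Delta_sum_dsum:
  fixes x y z :: "nat \<Rightarrow> 'a"
  assumes "\<And>i. i < k \<Longrightarrow> dsum (y i) (z i) (x i)"
  shows "(\<Sum>i<k. \<Delta>\<^sub>0 (x i)) = (\<Sum>i<k. \<Delta>\<^sub>0 (y i)) + (\<Sum>i<k. \<Delta>\<^sub>0 (z i))"
  unfolding sum.distrib[symmetric] using assms by (intro sum.cong Delta_dsum) auto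

lemma Delta_sum_split:
  fixes x :: "nat \<Rightarrow> 'a"
  assumes "(\<Sum>i<k. \<Delta>\<^sub>0 (x i)) = b + c"
  shows "\<exists>y z. (\<forall>i<k. dsum (y i) (z i) (x i)) \<and>
    b = (\<Sum>i<k. \<Delta>\<^sub>0 (y i)) \<and> c = (\<Sum>i<k. \<Delta>\<^sub>0 (z i))"
  using assms
proof (induction k arbitrary: b c)
  case 0
  then show ?case using dim_conical[of b c] dim_conical[of c b] by (simp add: add.commute)
next
  case (Suc k)
  have "(\<Sum>i<k. \<Delta>\<^sub>0 (x i)) + \<Delta>\<^sub>0 (x k) = b + c" using Suc.prems by simp
  then obtain b1 b2 c1 c2 where bc: "(\<Sum>i<k. \<Delta>\<^sub>0 (x i)) = b1 + c1" "\<Delta>\<^sub>0 (x k) = b2 + c2"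
    "b = b1 + b2" "c = c1 + c2"
    by (rule dim_refinement)
  obtain y z where yz: "\<forall>i<k. dsum (y i) (z i) (x i)"
    "b1 = (\<Sum>i<k. \<Delta>\<^sub>0 (y i))" "c1 = (\<Sum>i<k. \<Delta>\<^sub>0 (z i))"
    using Suc.IH[OF bc(1)] by blast
  obtain u v where uv: "dsum u v (x k)" "\<Delta>\<^sub>0 u = b2" "\<Delta>\<^sub>0 v = c2" using Delta_split[OF bc(2)] .
  have "(\<Sum>i<Suc k. \<Delta>\<^sub>0 ((y(k := u)) i)) = b" "(\<Sum>i<Suc k. \<Delta>\<^sub>0 ((z(k := v)) i)) = c"
    using bc yz uv by (simp_all cong: sum.cong_simp)
  moreover have "\<forall>i<Suc k. dsum ((y(k := u)) i) ((z(k := v)) i) (x i)"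
    using yz(1) uv(1) by (simp add: less_Suc_eq)
  ultimately show ?case by metis
qed

text \<open>The countable sums of the dimension monoid are those computed termwise in \<open>L\<close>.\<close>

definition dim_sums :: "(nat \<Rightarrow> 'a dim) \<Rightarrow> 'a dim \<Rightarrow> bool" where
  "dim_sums a s \<longleftrightarrow> (\<exists>(k::nat) x. (\<forall>i<k. independent (x i)) \<and>
    (\<forall>n. a n = (\<Sum>i<k. \<Delta>\<^sub>0 (x i n))) \<and> s = (\<Sum>i<k. \<Delta>\<^sub>0 (osum (x i))))"

lemma dim_sums_single:
  fixes k :: nat
  assumes "\<And>i. i < k \<Longrightarrow> independent (z i)" "independent (x :: nat \<Rightarrow> 'a)"
    "\<And>n. (\<Sum>i<k. \<Delta>\<^sub>0 (z i n)) = \<Delta>\<^sub>0 (x n)"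
  shows "(\<Sum>i<k. \<Delta>\<^sub>0 (osum (z i))) = \<Delta>\<^sub>0 (osum x)"
  using assms
proof (induction k arbitrary: x)
  case 0
  then have "x = (\<lambda>n. bot)" using Delta_eq_0 by fastforce
  then show ?case by (simp add: Delta_D0)
next
  case (Suc k)
  have "\<exists>u v. dsum u v (x n) \<and> \<Delta>\<^sub>0 u = (\<Sum>i<k. \<Delta>\<^sub>0 (z i n)) \<and> \<Delta>\<^sub>0 v = \<Delta>\<^sub>0 (z k n)" for n
    using Delta_split[of "x n"] Suc.prems(3)[of n] by (metis sum.lessThan_Suc)
  then obtain u v where uv: "\<And>n. dsum (u n) (v n) (x n)"
    "\<And>n. (\<Sum>i<k. \<Delta>\<^sub>0 (z i n)) = \<Delta>\<^sub>0 (u n)" "\<And>n. \<Delta>\<^sub>0 (z k n) = \<Delta>\<^sub>0 (v n)" by metis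
  note O = osum_split[of x u v, OF Suc.prems(2) uv(1)]
  have "(\<Sum>i<k. \<Delta>\<^sub>0 (osum (z i))) = \<Delta>\<^sub>0 (osum u)"
    using Suc.IH[OF _ O(1) uv(2)] Suc.prems(1) by simp
  moreover have "\<Delta>\<^sub>0 (osum (z k)) = \<Delta>\<^sub>0 (osum v)"
    using Delta_osum_cong[OF _ O(2) uv(3)] Suc.prems(1) by simp
  ultimately show ?case by (simp add: Delta_dsum[OF O(3)])
qed

text \<open>One sequence of the second family is peeled off at a time. The terms of the first family
  are split accordingly, and the parts split off are compared with that single sequence by
  \<open>dim_sums_single\<close>.\<close>

lemma dim_sums_unique:
  assumes "dim_sums a s" "dim_sums a t"
  shows "s = t"
proof -
  have "(\<Sum>i<k. \<Delta>\<^sub>0 (osum (x i))) = (\<Sum>j<l. \<Delta>\<^sub>0 (osum (y j)))"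
    if "\<And>i. i < k \<Longrightarrow> independent (x i)" "\<And>j. j < l \<Longrightarrow> independent (y j)"
      "\<And>n. (\<Sum>i<k. \<Delta>\<^sub>0 (x i n)) = (\<Sum>j<l. \<Delta>\<^sub>0 (y j n))" for k l :: nat and x y :: "nat \<Rightarrow> nat \<Rightarrow> 'a"
    using that
  proof (induction l arbitrary: x)
    case 0
    then show ?case using dim_sums_single[of k x "\<lambda>n. bot"] by (simp add: Delta_D0)
  next
    case (Suc l)
    have "\<exists>u v. (\<forall>i<k. dsum (u i) (v i) (x i n)) \<and> (\<Sum>j<l. \<Delta>\<^sub>0 (y j n)) = (\<Sum>i<k. \<Delta>\<^sub>0 (u i)) \<and>
        \<Delta>\<^sub>0 (y l n) = (\<Sum>i<k. \<Delta>\<^sub>0 (v i))" for n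
    proof -
      have "(\<Sum>i<k. \<Delta>\<^sub>0 (x i n)) = (\<Sum>j<l. \<Delta>\<^sub>0 (y j n)) + \<Delta>\<^sub>0 (y l n)"
        using Suc.prems(3)[of n] by simp
      then show ?thesis by (rule Delta_sum_split)
    qed
    then obtain u v where uv: "\<And>n i. i < k \<Longrightarrow> dsum (u n i) (v n i) (x i n)"
      "\<And>n. (\<Sum>i<k. \<Delta>\<^sub>0 (u n i)) = (\<Sum>j<l. \<Delta>\<^sub>0 (y j n))" "\<And>n. (\<Sum>i<k. \<Delta>\<^sub>0 (v n i)) = \<Delta>\<^sub>0 (y l n)"
      by metis
    have O: "independent (\<lambda>n. u n i)" "independent (\<lambda>n. v n i)"
      "dsum (osum (\<lambda>n. u n i)) (osum (\<lambda>n. v n i)) (osum (x i))" if "i < k" for i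
      using osum_split[of "x i" "\<lambda>n. u n i" "\<lambda>n. v n i", OF Suc.prems(1)[OF that] uv(1)[OF that]]
      by blast+
    have "(\<Sum>i<k. \<Delta>\<^sub>0 (osum (x i))) = (\<Sum>i<k. \<Delta>\<^sub>0 (osum (\<lambda>n. u n i))) + (\<Sum>i<k. \<Delta>\<^sub>0 (osum (\<lambda>n. v n i)))"
      by (rule Delta_sum_dsum[OF O(3)])
    also have "(\<Sum>i<k. \<Delta>\<^sub>0 (osum (\<lambda>n. u n i))) = (\<Sum>j<l. \<Delta>\<^sub>0 (osum (y j)))"
      using Suc.IH[of "\<lambda>i n. u n i"] O(1) Suc.prems(2) uv(2) by simp
    also have "(\<Sum>i<k. \<Delta>\<^sub>0 (osum (\<lambda>n. v n i))) = \<Delta>\<^sub>0 (osum (y l))"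
      using dim_sums_single[of k "\<lambda>i n. v n i" "y l"] O(2) Suc.prems(2) uv(3) by simp
    finally show ?case by simp
  qed
  note key = this
  obtain k :: nat and x where x: "\<And>i. i < k \<Longrightarrow> independent (x i)"
    "\<And>n. a n = (\<Sum>i<k. \<Delta>\<^sub>0 (x i n))" "s = (\<Sum>i<k. \<Delta>\<^sub>0 (osum (x i)))"
    using assms(1) unfolding dim_sums_def by blast
  obtain l :: nat and y where y: "\<And>i. i < l \<Longrightarrow> independent (y i)"
    "\<And>n. a n = (\<Sum>i<l. \<Delta>\<^sub>0 (y i n))" "t = (\<Sum>i<l. \<Delta>\<^sub>0 (osum (y i)))"
    using assms(2) unfolding dim_sums_def by blast
  show ?thesis unfolding x(3) y(3) using x(2) y(2) by (intro key x(1) y(1)) auto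
qed

section \<open>The axioms of a generalized cardinal algebra\<close>

lemma dim_sums_Suc:
  assumes "dim_sums a s" obtains t where "dim_sums (\<lambda>n. a (Suc n)) t" "s = a 0 + t"
proof -
  obtain k :: nat and x where x: "\<And>i. i < k \<Longrightarrow> independent (x i)" "\<And>n. a n = (\<Sum>i<k. \<Delta>\<^sub>0 (x i n))"
    "s = (\<Sum>i<k. \<Delta>\<^sub>0 (osum (x i)))"
    using assms unfolding dim_sums_def by blast
  have "dim_sums (\<lambda>n. a (Suc n)) (\<Sum>i<k. \<Delta>\<^sub>0 (osum (\<lambda>n. x i (Suc n))))"
    unfolding dim_sums_def
    by (rule exI[of _ k], rule exI[of _ "\<lambda>i n. x i (Suc n)"]) (simp add: x osum_shift)
  moreover have "s = a 0 + (\<Sum>i<k. \<Delta>\<^sub>0 (osum (\<lambda>n. x i (Suc n))))"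
    unfolding x(2,3) by (rule Delta_sum_dsum[OF osum_shift(2)[OF x(1)]])
  ultimately show ?thesis by (rule that)
qed

lemma dim_sums_add:
  assumes "dim_sums (\<lambda>n. a n + b n) c"
  obtains s t where "dim_sums a s" "dim_sums b t" "c = s + t"
proof -
  obtain k :: nat and x where x: "\<And>i. i < k \<Longrightarrow> independent (x i)" "\<And>n. a n + b n = (\<Sum>i<k. \<Delta>\<^sub>0 (x i n))"
    "c = (\<Sum>i<k. \<Delta>\<^sub>0 (osum (x i)))"
    using assms unfolding dim_sums_def by blast
  have "\<exists>u v. (\<forall>i<k. dsum (u i) (v i) (x i n)) \<and> a n = (\<Sum>i<k. \<Delta>\<^sub>0 (u i)) \<and>
      b n = (\<Sum>i<k. \<Delta>\<^sub>0 (v i))" for n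
    by (rule Delta_sum_split[OF x(2)[symmetric]])
  then obtain u v where uv: "\<And>n i. i < k \<Longrightarrow> dsum (u n i) (v n i) (x i n)"
    "\<And>n. a n = (\<Sum>i<k. \<Delta>\<^sub>0 (u n i))" "\<And>n. b n = (\<Sum>i<k. \<Delta>\<^sub>0 (v n i))"
    by metis
  have O: "independent (\<lambda>n. u n i)" "independent (\<lambda>n. v n i)"
    "dsum (osum (\<lambda>n. u n i)) (osum (\<lambda>n. v n i)) (osum (x i))" if "i < k" for i
    using osum_split[of "x i" "\<lambda>n. u n i" "\<lambda>n. v n i", OF x(1)[OF that] uv(1)[OF that]]
    by blast+
  show ?thesis
  proof
    show "dim_sums a (\<Sum>i<k. \<Delta>\<^sub>0 (osum (\<lambda>n. u n i)))" unfolding dim_sums_def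
      by (rule exI[of _ k], rule exI[of _ "\<lambda>i n. u n i"]) (simp add: uv(2) O(1))
    show "dim_sums b (\<Sum>i<k. \<Delta>\<^sub>0 (osum (\<lambda>n. v n i)))" unfolding dim_sums_def
      by (rule exI[of _ k], rule exI[of _ "\<lambda>i n. v n i"]) (simp add: uv(3) O(2))
    show "c = (\<Sum>i<k. \<Delta>\<^sub>0 (osum (\<lambda>n. u n i))) + (\<Sum>i<k. \<Delta>\<^sub>0 (osum (\<lambda>n. v n i)))"
      unfolding x(3) by (rule Delta_sum_dsum[OF O(3)])
  qed
qed

lemma dim_sums_refine:
  assumes "dim_sums c (a + b)"
  obtains a' b' where "dim_sums a' a" "dim_sums b' b" "\<And>n. c n = a' n + b' n"
proof -
  obtain k :: nat and x where x: "\<And>i. i < k \<Longrightarrow> independent (x i)" "\<And>n. c n = (\<Sum>i<k. \<Delta>\<^sub>0 (x i n))"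
    "a + b = (\<Sum>i<k. \<Delta>\<^sub>0 (osum (x i)))"
    using assms unfolding dim_sums_def by blast
  obtain y z where yz: "\<And>i. i < k \<Longrightarrow> dsum (y i) (z i) (osum (x i))"
    "a = (\<Sum>i<k. \<Delta>\<^sub>0 (y i))" "b = (\<Sum>i<k. \<Delta>\<^sub>0 (z i))"
    using Delta_sum_split[OF x(3)[symmetric]] by blast
  have "\<exists>u v. independent u \<and> independent v \<and> osum u = y i \<and> osum v = z i \<and>
      (\<forall>n. \<Delta>\<^sub>0 (x i n) = \<Delta>\<^sub>0 (u n) + \<Delta>\<^sub>0 (v n))" if "i < k" for i
    by (rule osum_refine[OF x(1)[OF that] yz(1)[OF that]]) metis
  then obtain u v where uv: "\<And>i. i < k \<Longrightarrow> independent (u i)" "\<And>i. i < k \<Longrightarrow> independent (v i)"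
    "\<And>i. i < k \<Longrightarrow> osum (u i) = y i" "\<And>i. i < k \<Longrightarrow> osum (v i) = z i"
    "\<And>i n. i < k \<Longrightarrow> \<Delta>\<^sub>0 (x i n) = \<Delta>\<^sub>0 (u i n) + \<Delta>\<^sub>0 (v i n)"
    by metis
  show ?thesis
  proof
    show "dim_sums (\<lambda>n. \<Sum>i<k. \<Delta>\<^sub>0 (u i n)) a" unfolding dim_sums_def
      by (rule exI[of _ k], rule exI[of _ u]) (simp add: uv yz(2))
    show "dim_sums (\<lambda>n. \<Sum>i<k. \<Delta>\<^sub>0 (v i n)) b" unfolding dim_sums_def
      by (rule exI[of _ k], rule exI[of _ v]) (simp add: uv yz(3))
    show "c n = (\<Sum>i<k. \<Delta>\<^sub>0 (u i n)) + (\<Sum>i<k. \<Delta>\<^sub>0 (v i n))" for n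
      using uv(5) by (simp add: x(2) flip: sum.distrib)
  qed
qed

text \<open>A representation of \<open>a 0\<close> by \<open>k\<close> elements turns the given
  sequence into \<open>k\<close> decreasing sequences in \<open>L\<close>. Complements of the joins
  of their differences provide the remainder.\<close>

lemma dim_sums_remainder:
  assumes "\<And>n. a n = b n + a (Suc n)"
  obtains x s where "\<And>n. dim_sums (\<lambda>k. b (n + k)) (s n)" "\<And>n. a n = x + s n"
proof -
  obtain k :: nat and x0 where x0: "a 0 = (\<Sum>i<k. \<Delta>\<^sub>0 (x0 i))" using dim_representation[of "a 0"] by (elim exE) (rule that)
  have "\<exists>d. \<forall>n. (a n = (\<Sum>i<k. \<Delta>\<^sub>0 (d n i))) \<and>
      (\<exists>y. (\<forall>i<k. dsum (y i) (d (Suc n) i) (d n i)) \<and> b n = (\<Sum>i<k. \<Delta>\<^sub>0 (y i)))"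
  proof (rule dependent_nat_choice)
    show "\<exists>x. a 0 = (\<Sum>i<k. \<Delta>\<^sub>0 (x i))" using x0 by blast
    fix d n assume "a n = (\<Sum>i<k. \<Delta>\<^sub>0 (d i))"
    then have "(\<Sum>i<k. \<Delta>\<^sub>0 (d i)) = b n + a (Suc n)"
      by (rule HOL.trans[OF HOL.sym assms])
    then obtain y z where "\<forall>i<k. dsum (y i) (z i) (d i)" "b n = (\<Sum>i<k. \<Delta>\<^sub>0 (y i))"
      "a (Suc n) = (\<Sum>i<k. \<Delta>\<^sub>0 (z i))"
      using Delta_sum_split by blast
    then show "\<exists>d'. a (Suc n) = (\<Sum>i<k. \<Delta>\<^sub>0 (d' i)) \<and>
        (\<exists>y. (\<forall>i<k. dsum (y i) (d' i) (d i)) \<and> b n = (\<Sum>i<k. \<Delta>\<^sub>0 (y i)))"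
      by (intro exI[of _ z] exI[of _ y] conjI)
  qed
  then obtain d y where d: "\<And>n. a n = (\<Sum>i<k. \<Delta>\<^sub>0 (d n i))"
    "\<And>n i. i < k \<Longrightarrow> dsum (y n i) (d (Suc n) i) (d n i)" "\<And>n. b n = (\<Sum>i<k. \<Delta>\<^sub>0 (y n i))"
    by metis
  have T: "independent (\<lambda>n. y n i)" "dsum (partial_join (\<lambda>n. y n i) n) (d n i) (d 0 i)"
    "osum (\<lambda>n. y n i) \<le> d 0 i" if "i < k" for i n
    using decrements[of "\<lambda>n. y n i" "\<lambda>n. d n i", OF d(2)[OF that]] by blast+
  have "\<exists>e. dsum (osum (\<lambda>n. y n i)) e (d 0 i)" if "i < k" for i
    using dsum_ex[OF T(3)[OF that]] by blast
  then obtain e where e: "\<And>i. i < k \<Longrightarrow> dsum (osum (\<lambda>n. y n i)) (e i) (d 0 i)" by metis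
  have D: "\<Delta>\<^sub>0 (d n i) = \<Delta>\<^sub>0 (e i) + \<Delta>\<^sub>0 (osum (\<lambda>m. y (n + m) i))" if i: "i < k" for n i
  proof -
    have "osum (\<lambda>m. y (n + m) i) \<le> d n i"
      using decrements(3)[of "\<lambda>m. y (n + m) i" "\<lambda>m. d (n + m) i"] d(2)[OF i] by simp
    \<comment> \<open>\<open>f\<close> complements the tail in \<open>d n i\<close>, hence also the
      whole join in \<open>d 0 i\<close>. It therefore has the dimension of \<open>e i\<close>,
      whatever \<open>n\<close> is.\<close>
    then obtain f where f: "dsum (osum (\<lambda>m. y (n + m) i)) f (d n i)" using dsum_ex by blast
    have "dsum (partial_join (\<lambda>n. y n i) n) (osum (\<lambda>m. y (n + m) i)) (osum (\<lambda>n. y n i))"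
      by (rule osum_drop(2)[OF T(1)[OF i]])
    moreover have "dsum f (osum (\<lambda>m. y (n + m) i)) (d n i)" using f by (rule dsum_commute)
    then have "dsum f (sup (osum (\<lambda>m. y (n + m) i)) (partial_join (\<lambda>n. y n i) n)) (d 0 i)"
      by (rule dsum_assoc(2)[OF _ dsum_commute[OF T(2)[OF i]]])
    ultimately have "dsum (osum (\<lambda>n. y n i)) f (d 0 i)"
      using dsum_commute dsum_sup by (metis sup_commute)
    then have "\<Delta>\<^sub>0 f = \<Delta>\<^sub>0 (e i)" using persp_compl_mod e[OF i] persp_Delta by blast
    then show ?thesis using Delta_dsum[OF f] by (simp add: add.commute)
  qed
  show ?thesis
  proof
    show "dim_sums (\<lambda>m. b (n + m)) (\<Sum>i<k. \<Delta>\<^sub>0 (osum (\<lambda>m. y (n + m) i)))" for n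
      unfolding dim_sums_def
      by (rule exI[of _ k], rule exI[of _ "\<lambda>i m. y (n + m) i"])
         (simp add: d(3) osum_drop(1)[OF T(1)])
    show "a n = (\<Sum>i<k. \<Delta>\<^sub>0 (e i)) + (\<Sum>i<k. \<Delta>\<^sub>0 (osum (\<lambda>m. y (n + m) i)))" for n
      using D by (simp add: d(1) flip: sum.distrib)
  qed
qed

lemma monoid_is_gca_dim: "monoid_is_gca ((+) :: 'a dim \<Rightarrow> 'a dim \<Rightarrow> 'a dim) 0"
proof -
  define S where "S a = (if \<exists>s. dim_sums a s then Some (THE s. dim_sums a s) else None)" for a
  have S: "S a = Some s \<longleftrightarrow> dim_sums a s" for a s
    unfolding S_def using dim_sums_unique theI[of "dim_sums a"] by auto
  have "generalized_cardinal_algebra (\<lambda>x y. Some (x + y)) 0 S"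
  proof
    fix a :: "nat \<Rightarrow> 'a dim" and s
    assume "S a = Some s"
    then show "\<exists>t. S (\<lambda>n. a (Suc n)) = Some t \<and> Some (a 0 + t) = Some s"
      using dim_sums_Suc unfolding S by metis
  next
    fix a b d :: "nat \<Rightarrow> 'a dim" and c
    assume "\<And>n. Some (a n + b n) = Some (d n)" and c: "S d = Some c"
    then have "d = (\<lambda>n. a n + b n)" by auto
    then have "dim_sums (\<lambda>n. a n + b n) c" using c S by simp
    then show "\<exists>s t. S a = Some s \<and> S b = Some t \<and> Some (s + t) = Some c"
      unfolding S by (rule dim_sums_add) blast
  next
    fix a :: "'a dim"
    show "Some (a + 0) = Some a \<and> Some (0 + a) = Some a" by simp
  next
    fix a b s :: "'a dim" and c
    assume "Some (a + b) = Some s" "S c = Some s"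
    then show "\<exists>a' b'. S a' = Some a \<and> S b' = Some b \<and> (\<forall>n. Some (a' n + b' n) = Some (c n))"
      using dim_sums_refine unfolding S by (metis option.inject)
  next
    fix a b :: "nat \<Rightarrow> 'a dim"
    assume "\<And>n. Some (b n + a (Suc n)) = Some (a n)"
    then have "a n = b n + a (Suc n)" for n by (metis option.inject)
    then show "\<exists>x s. \<forall>n. S (\<lambda>k. b (n + k)) = Some (s n) \<and> Some (x + s n) = Some (a n)"
      using dim_sums_remainder[of a b] unfolding S by metis
  qed
  then show ?thesis
    unfolding monoid_is_gca_def using add.comm_monoid_axioms by blast
qed

section \<open>Absorption and cancellation\<close>

lemma dim_absorb_multiples:
  assumes "f + c = (c :: 'a dim)"
  obtains x s where "c = x + s" "dim_sums (\<lambda>n. f) s"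
  using dim_sums_remainder[of "\<lambda>n. c" "\<lambda>n. f", OF assms[symmetric]] by metis

lemma dim_absorb_const:
  assumes "dim_sums (\<lambda>n. f) (s :: 'a dim)" shows "f + s = s"
proof -
  obtain t where "dim_sums (\<lambda>n. f) t" "s = f + t" using dim_sums_Suc[OF assms] .
  then show ?thesis using dim_sums_unique[OF assms] by simp
qed

text \<open>If \<open>c\<close> absorbs \<open>f\<close>, the remainder postulate finds countably
  many copies of \<open>f\<close> in \<open>c\<close>. They contain countably many copies of
  \<open>d1\<close>, and these absorb one more.\<close>

lemma dim_absorb_part:
  assumes "f + c = c" "f = d1 + (d2 :: 'a dim)"
  shows "d1 + c = c"
proof -
  obtain x s where s: "c = x + s" "dim_sums (\<lambda>n. f) s" using dim_absorb_multiples[OF assms(1)] .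
  have "dim_sums (\<lambda>n. d1 + d2) s" using s(2) assms(2) by simp
  then obtain s1 s2 where s12: "dim_sums (\<lambda>n. d1) s1" "s = s1 + s2" by (rule dim_sums_add)
  have "d1 + s = s" unfolding s12(2) using dim_absorb_const[OF s12(1)] by (simp flip: add.assoc)
  then show ?thesis unfolding s(1) by (metis add.left_commute)
qed

text \<open>\<open>c\<close> absorbs each partial sum \<open>\<beta> m\<close> and so contains the
  sum of all of them. That sum absorbs \<open>s\<close>: passing from \<open>\<beta> k\<close> to
  \<open>\<beta> (Suc k)\<close> adds \<open>b (Suc k)\<close>, and \<open>\<beta> 0\<close> is
  \<open>b 0\<close>.\<close>

lemma dim_absorb_sums:
  assumes "\<And>n. b n + c = (c :: 'a dim)" "dim_sums b s"
  shows "s + c = c"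
proof -
  define \<beta> where "\<beta> m = (\<Sum>k\<le>m. b k)" for m
  have "\<beta> m + c = c" for m
    by (induction m) (simp_all add: \<beta>_def assms(1) add.assoc)
  then obtain x g where g: "\<And>n. dim_sums (\<lambda>k. \<beta> (n + k)) (g n)" "\<And>n. c = x + g n"
    using dim_sums_remainder[of "\<lambda>n. c" \<beta>] by metis
  have g0: "dim_sums \<beta> (g 0)" using g(1)[of 0] by simp
  obtain h where h: "dim_sums (\<lambda>k. \<beta> (Suc k)) h" "g 0 = b 0 + h"
    using dim_sums_Suc[OF g0] by (auto simp: \<beta>_def)
  have "(\<lambda>k. \<beta> (Suc k)) = (\<lambda>k. \<beta> k + b (Suc k))" by (simp add: \<beta>_def)
  then obtain g' t where "dim_sums \<beta> g'" "dim_sums (\<lambda>k. b (Suc k)) t" "h = g' + t"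
    using dim_sums_add h(1) by metis
  moreover obtain t' where "dim_sums (\<lambda>k. b (Suc k)) t'" "s = b 0 + t'"
    using dim_sums_Suc[OF assms(2)] .
  ultimately have "g 0 = s + g 0"
    using h(2) g0 dim_sums_unique by (metis add.assoc add.commute)
  then show ?thesis using g(2)[of 0] by (metis add.left_commute)
qed

text \<open>Refining \<open>a + c = b + c\<close> splits off a common part of \<open>a\<close> and
  \<open>b\<close> and leaves an equation of the same shape, whose new first terms are both summands
  of \<open>c\<close>. After countably many rounds the remainders \<open>e\<close> and
  \<open>f\<close> have occurred in \<open>c\<close> infinitely often, so \<open>c\<close> absorbs
  them.\<close>

lemma dim_cancellation:
  assumes "a + c = b + (c :: 'a dim)"
  obtains d e f where "a = d + e" "b = d + f" "e + c = c" "f + c = c"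
proof -
  define P where "P = (\<lambda>(n::nat) (a, b, c :: 'a dim). a + c = b + c)"
  define R where "R = (\<lambda>(a, b, c :: 'a dim) (a', b', c').
    (\<exists>d. a = d + a' \<and> b = d + b') \<and> c = a' + c' \<and> c = b' + c')"
  have "\<exists>S. \<forall>n. (P n (S n) \<and> (n = 0 \<longrightarrow> S n = (a, b, c))) \<and> R (S n) (S (Suc n))"
  proof (rule dependent_nat_choice)
    show "\<exists>s. P 0 s \<and> (0 = (0::nat) \<longrightarrow> s = (a, b, c))" using assms by (auto simp: P_def)
    fix s n assume s: "P n s \<and> (n = 0 \<longrightarrow> s = (a, b, c))"
    obtain a1 b1 c1 where abc: "s = (a1, b1, c1)" by (cases s)
    have "a1 + c1 = b1 + c1" using s abc by (simp add: P_def)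
    then obtain p q r t where "a1 = p + r" "c1 = q + t" "b1 = p + q" "c1 = r + t"
      by (rule dim_refinement)
    then have "P (Suc n) (r, q, t)" "R s (r, q, t)" by (auto simp: P_def R_def abc)
    then show "\<exists>s'. (P (Suc n) s' \<and> (Suc n = 0 \<longrightarrow> s' = (a, b, c))) \<and> R s s'" by blast
  qed
  then obtain S where S: "S 0 = (a, b, c)" "\<And>n. R (S n) (S (Suc n))" by blast
  define A B C where "A n = fst (S n)" and "B n = fst (snd (S n))" and "C n = snd (snd (S n))" for n
  have "\<exists>d. A n = d + A (Suc n) \<and> B n = d + B (Suc n)"
    and C: "C n = A (Suc n) + C (Suc n)" "C n = B (Suc n) + C (Suc n)" for n
    using S(2)[of n] unfolding R_def A_def B_def C_def by (auto simp: case_prod_beta)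
  then obtain d where d: "\<And>n. A n = d n + A (Suc n)" "\<And>n. B n = d n + B (Suc n)" by metis
  have init: "A 0 = a" "B 0 = b" "C 0 = c" by (simp_all add: A_def B_def C_def S(1))
  obtain e s where s: "\<And>n. dim_sums (\<lambda>k. d (n + k)) (s n)" "\<And>n. A n = e + s n"
    by (rule dim_sums_remainder[of A d, OF d(1)]) (rule that)
  obtain f s' where s': "\<And>n. dim_sums (\<lambda>k. d (n + k)) (s' n)" "\<And>n. B n = f + s' n"
    by (rule dim_sums_remainder[of B d, OF d(2)]) (rule that)
  have "s' = s" using s(1) s'(1) dim_sums_unique by blast
  have absorb: "e + c = c" if D: "\<And>n. C n = D (Suc n) + C (Suc n)" "\<And>n. D n = e + s n" for D e
  proof -
    obtain x t where t: "\<And>n. dim_sums (\<lambda>k. D (Suc (n + k))) (t n)" "\<And>n. C n = x + t n"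
      by (rule dim_sums_remainder[of C "\<lambda>n. D (Suc n)", OF D(1)]) (rule that)
    have "dim_sums (\<lambda>k. e + s (Suc k)) (t 0)" using t(1)[of 0] D(2) by simp
    then obtain u v where "dim_sums (\<lambda>k. e) u" "t 0 = u + v" by (rule dim_sums_add)
    then have "e + t 0 = t 0" using dim_absorb_const by (metis add.assoc)
    then show ?thesis using t(2)[of 0] init(3) by (metis add.left_commute)
  qed
  show ?thesis
  proof (rule that)
    show "a = s 0 + e" "b = s 0 + f"
      using s(2)[of 0] s'(2)[of 0] init \<open>s' = s\<close> by (simp_all add: add.commute)
    show "e + c = c" using absorb C(1) s(2) by blast
    show "f + c = c" using absorb C(2) s'(2) \<open>s' = s\<close> by blast
  qed
qed

section \<open>Countable sums as suprema\<close>

lemma dim_sums_partial: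
  assumes "dim_sums a s" obtains t where "s = (\<Sum>k<n. a k) + t"
proof -
  have "\<exists>t. dim_sums (\<lambda>k. a (n + k)) t \<and> s = (\<Sum>k<n. a k) + t"
  proof (induction n)
    case (Suc n)
    then obtain t where t: "dim_sums (\<lambda>k. a (n + k)) t" "s = (\<Sum>k<n. a k) + t" by blast
    obtain t' where "dim_sums (\<lambda>k. a (n + Suc k)) t'" "t = a (n + 0) + t'"
      using dim_sums_Suc[OF t(1)] .
    then show ?case using t(2) by (auto simp: add.assoc)
  qed (use assms in simp)
  then show ?thesis using that by blast
qed

text \<open>An upper bound of the partial sums need not split off the summands coherently; by cancellation
  it splits off parts of them, and the other parts are absorbed by the partial sums.\<close>

lemma dim_sums_least:
  assumes a: "dim_sums a s" and u: "\<And>n. (\<Sum>k<n. a k) \<le> (u :: 'a dim)"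
  shows "s \<le> u"
proof -
  define S where "S n = (\<Sum>k<n. a k)" for n
  have S: "S 0 = 0" "\<And>n. S (Suc n) = S n + a n" by (simp_all add: S_def)
  define P where "P n r \<longleftrightarrow> u = S n + r \<and> (n = 0 \<longrightarrow> r = u)" for n r
  have "\<exists>r. \<forall>n. P n (r n) \<and>
      (\<exists>p q. a n = p + q \<and> q + S n = S n \<and> r n = p + r (Suc n))"
  proof (rule dependent_nat_choice)
    show "\<exists>r. P 0 r" by (simp add: P_def S)
    fix r n assume r: "P n r"
    obtain v where "u = S (Suc n) + v" using u[of "Suc n"] unfolding less_eq_dim_def S_def by metis
    \<comment> \<open>The old remainder \<open>r\<close> and the new \<open>v\<close> give two
      expressions for \<open>u\<close>. Cancelling \<open>S n\<close> leaves error terms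
      \<open>e\<close> and \<open>f\<close> that \<open>S n\<close> absorbs.\<close>
    then have "r + S n = (a n + v) + S n" using r by (simp add: P_def S ac_simps)
    then obtain d e f where def: "r = d + e" "a n + v = d + f" "e + S n = S n" "f + S n = S n"
      by (rule dim_cancellation)
    \<comment> \<open>\<open>q\<close> is the part of \<open>a n\<close> that falls into the
      absorbed \<open>f\<close>; the other part \<open>p\<close> can be split off from
      \<open>r\<close> coherently.\<close>
    obtain p v1 q v2 where pq: "a n = p + q" "v = v1 + v2" "d = p + v1" "f = q + v2"
      using dim_refinement[OF def(2)] by metis
    have q: "q + S n = S n" by (rule dim_absorb_part[OF def(4) pq(4)])
    have "u = S n + (p + (v1 + e))" using r by (simp add: P_def def pq add.assoc)
    also have "\<dots> = (q + S n) + (p + (v1 + e))" by (simp only: q)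
    also have "\<dots> = S (Suc n) + (v1 + e)" by (simp add: S pq(1) ac_simps)
    finally have "P (Suc n) (v1 + e)" by (simp add: P_def)
    moreover have "r = p + (v1 + e)" by (simp add: def pq add.assoc)
    ultimately show "\<exists>r'. P (Suc n) r' \<and> (\<exists>p q. a n = p + q \<and> q + S n = S n \<and> r = p + r')"
      using pq(1) q by blast
  qed
  then obtain r p q where r: "\<And>n. P n (r n)" "\<And>n. a n = p n + q n" "\<And>n. q n + S n = S n"
    "\<And>n. r n = p n + r (Suc n)"
    by metis
  obtain x g where g: "\<And>n. dim_sums (\<lambda>k. p (n + k)) (g n)" "\<And>n. r n = x + g n"
    by (rule dim_sums_remainder[of r p, OF r(4)]) (rule that)
  have g0: "dim_sums p (g 0)" using g(1)[of 0] by simp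
  have Sp: "S n = (\<Sum>k<n. p k)" for n
  proof (induction n)
    case (Suc n)
    have "S (Suc n) = (q n + S n) + p n" by (simp add: S r(2) ac_simps)
    also have "\<dots> = S n + p n" by (simp only: r(3))
    finally show ?case using Suc by simp
  qed (simp add: S)
  have "q n + g 0 = g 0" for n
  proof -
    obtain t where "g 0 = S n + t" using dim_sums_partial[OF g0] Sp by metis
    then show ?thesis using r(3)[of n] by (metis add.assoc)
  qed
  moreover have "dim_sums (\<lambda>n. p n + q n) s" using a by (simp flip: r(2))
  then obtain g' h where "dim_sums p g'" "dim_sums q h" "s = g' + h" by (rule dim_sums_add)
  ultimately have "s = g 0"
    using dim_absorb_sums dim_sums_unique[OF g0] by (metis add.commute)
  moreover have "r 0 = u" using r(1)[of 0] unfolding P_def by blast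
  then have "u = x + g 0" using g(2)[of 0] by simp
  ultimately show ?thesis unfolding less_eq_dim_def by (metis add.commute)
qed

text \<open>The differences of the sequence are independent with join \<open>lim a\<close>, and the
  partial sums of their dimensions are dimensions of terms of the sequence. The supremum is thus an
  instance of \<open>dim_sums_least\<close>.\<close>

lemma Delta_lim:
  assumes "mono (a :: nat \<Rightarrow> 'a)"
  shows "isLub UNIV (range (\<lambda>n. \<Delta>\<^sub>0 (a n))) (\<Delta>\<^sub>0 (lim a))"
  unfolding isLub_UNIV_iff
proof (intro conjI allI impI)
  show "\<Delta>\<^sub>0 (a n) \<le> \<Delta>\<^sub>0 (lim a)" for n
    unfolding less_eq_dim_def using Delta_D1[of bot "a n" "lim a"] lim_upper[OF assms] by auto
  fix u assume u: "\<forall>n. \<Delta>\<^sub>0 (a n) \<le> u"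
  \<comment> \<open>The leading \<open>bot\<close> makes \<open>a 0\<close> the first difference and
    matches the empty partial sum.\<close>
  define t where "t n = (case n of 0 \<Rightarrow> bot | Suc m \<Rightarrow> a m)" for n
  have t: "t 0 = bot" "\<And>n. t (Suc n) = a n" by (simp_all add: t_def)
  have tS: "t n \<le> t (Suc n)" for n
    using assms by (cases n) (simp_all add: t monoD)
  then have mt: "mono t" by (simp add: mono_iff_le_Suc)
  have "\<exists>e. dsum (t n) e (t (Suc n))" for n using dsum_ex[OF tS] by blast
  then obtain e where e: "\<And>n. dsum (t n) (e n) (t (Suc n))" by metis
  note I = increments[OF t(1) e]
  have "lim t = lim a" using lim_Suc[OF mt] t(2) by simp
  have "dim_sums (\<lambda>n. \<Delta>\<^sub>0 (e n)) (\<Delta>\<^sub>0 (osum e))"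
    unfolding dim_sums_def by (rule exI[of _ 1], rule exI[of _ "\<lambda>i. e"]) (simp add: I(1))
  moreover have "(\<Sum>k<n. \<Delta>\<^sub>0 (e k)) = \<Delta>\<^sub>0 (t n)" for n
    by (induction n) (simp_all add: t(1) Delta_D0 Delta_dsum[OF e])
  moreover have "\<Delta>\<^sub>0 (t n) \<le> u" for n
    by (cases n) (use u in \<open>simp_all add: t Delta_D0 less_eq_dim_def\<close>)
  ultimately have "\<Delta>\<^sub>0 (osum e) \<le> u" using dim_sums_least by metis
  then show "\<Delta>\<^sub>0 (lim a) \<le> u" by (simp add: I(3) \<open>lim t = lim a\<close>)
qed

end

theorem proposition13p10:
  assumes "sectionally_complemented TYPE('a::bounded_lattice_bot)"
    and "modular_lattice TYPE('a)"
    and "aleph0_meet_continuous TYPE('a)"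
  shows "monoid_is_gca ((+) :: 'a dim \<Rightarrow> 'a dim \<Rightarrow> 'a dim) 0 \<and>
    (\<forall>(a :: nat \<Rightarrow> 'a) s. mono a \<and> isLub UNIV (range a) s \<longrightarrow>
      isLub UNIV (range (\<lambda>n. \<Delta>\<^sub>0 (a n))) (\<Delta>\<^sub>0 s))"
proof -
  interpret mc_lattice "TYPE('a)" using assms by unfold_locales
  show ?thesis using monoid_is_gca_dim Delta_lim isLub_eq_lim by metis
qed

end
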